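(* Let $n,k\geq 1$ be integers and let $M^k_n\subseteq\Delta_{2^n-1}$ be the restricted Boltzmann machine model with $n$ visible and $k$ hidden nodes. If $k \leq 2^{\,n-\lceil \log_2 (n+1)\rceil}$ or if $k \geq 2^{\,n-\lfloor \log_2 (n+1)\rfloor}$, then $M^k_n$ is a semialgebraic set of dimension $\min\{nk+n+k,\,2^n-1\}$.
   Context: For parameters $W\in\mathbb{R}^{k\times n}$, $b\in\mathbb{R}^n$, $c\in\mathbb{R}^k$ and states $v\in\{0,1\}^n$, $h\in\{0,1\}^k$, put $\psi(v,h)=\exp(h^{\top}Wv+b^{\top}v+c^{\top}h)$ and $p(v)=\frac{1}{Z}\sum_{h\in\{0,1\}^k}\psi(v,h)$, where $Z=\sum_{v,h}\psi(v,h)$. The RBM model $M^k_n$ is the set of all vectors $(p(v))_{v\in\{0,1\}^n}$ in the open probability simplex $\Delta_{2^n-1}\subset\mathbb{R}^{2^n}$ obtained as $(W,b,c)$ ranges over $\mathbb{R}^{k\times n}\times\mathbb{R}^n\times\mathbb{R}^k$. This is the image of a polynomial map after the substitution $\gamma_i=e^{c_i}$, $\omega_{ij}=e^{W_{ij}}$, $\beta_j=e^{b_j}$, hence a semialgebraic set; its dimension is its dimension as a semialgebraic set. *)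

theory Defs
  imports Complex_Main
begin

definition euclid :: "nat \<Rightarrow> (nat \<Rightarrow> real) set" where
  "euclid N = {x. \<forall>i\<ge>N. x i = 0}"

inductive_set polyfun :: "nat \<Rightarrow> ((nat \<Rightarrow> real) \<Rightarrow> real) set" for N :: nat where
  pf_const: "(\<lambda>x. c) \<in> polyfun N"
| pf_var: "i < N \<Longrightarrow> (\<lambda>x. x i) \<in> polyfun N"
| pf_add: "p \<in> polyfun N \<Longrightarrow> q \<in> polyfun N \<Longrightarrow> (\<lambda>x. p x + q x) \<in> polyfun N"
| pf_mult: "p \<in> polyfun N \<Longrightarrow> q \<in> polyfun N \<Longrightarrow> (\<lambda>x. p x * q x) \<in> polyfun N"

inductive semialgebraic :: "nat \<Rightarrow> (nat \<Rightarrow> real) set \<Rightarrow> bool" for N :: nat where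
  sa_zero: "p \<in> polyfun N \<Longrightarrow> semialgebraic N {x \<in> euclid N. p x = 0}"
| sa_pos: "p \<in> polyfun N \<Longrightarrow> semialgebraic N {x \<in> euclid N. p x > 0}"
| sa_union: "semialgebraic N A \<Longrightarrow> semialgebraic N B \<Longrightarrow> semialgebraic N (A \<union> B)"
| sa_compl: "semialgebraic N A \<Longrightarrow> semialgebraic N (euclid N - A)"

definition proj_has_interior :: "nat set \<Rightarrow> (nat \<Rightarrow> real) set \<Rightarrow> bool" where
  "proj_has_interior I A \<longleftrightarrow>
     (\<exists>y e. e > 0 \<and>
        (\<forall>z. (\<forall>i\<in>I. \<bar>z i - y i\<bar> < e) \<longrightarrow> (\<exists>x\<in>A. \<forall>i\<in>I. x i = z i)))"

text \<open>Dimension of a (nonempty) semialgebraic set A in R^N: the largest d such that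
  the image of A under some coordinate projection R^N -> R^d has nonempty interior
  (Bochnak--Coste--Roy, Real Algebraic Geometry, Sect. 2.8).\<close>
definition sa_dim :: "nat \<Rightarrow> (nat \<Rightarrow> real) set \<Rightarrow> nat" where
  "sa_dim N A = (GREATEST d. \<exists>I. I \<subseteq> {..<N} \<and> card I = d \<and> proj_has_interior I A)"

text \<open>A state v in {0,1}^n is encoded by the index j < 2^n with v_i = bit i of j.\<close>
definition bitv :: "nat \<Rightarrow> nat \<Rightarrow> real" where
  "bitv j i = (if odd (j div 2 ^ i) then 1 else 0)"

definition rbm_psi :: "nat \<Rightarrow> nat \<Rightarrow> (nat \<Rightarrow> nat \<Rightarrow> real) \<Rightarrow> (nat \<Rightarrow> real) \<Rightarrow> (nat \<Rightarrow> real)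
    \<Rightarrow> nat \<Rightarrow> nat \<Rightarrow> real" where
  "rbm_psi n k W b c v h = exp ((\<Sum>a<k. \<Sum>i<n. bitv h a * W a i * bitv v i)
      + (\<Sum>i<n. b i * bitv v i) + (\<Sum>a<k. c a * bitv h a))"

definition rbm_Z :: "nat \<Rightarrow> nat \<Rightarrow> (nat \<Rightarrow> nat \<Rightarrow> real) \<Rightarrow> (nat \<Rightarrow> real) \<Rightarrow> (nat \<Rightarrow> real) \<Rightarrow> real" where
  "rbm_Z n k W b c = (\<Sum>v<2^n. \<Sum>h<2^k. rbm_psi n k W b c v h)"

definition rbm_dist :: "nat \<Rightarrow> nat \<Rightarrow> (nat \<Rightarrow> nat \<Rightarrow> real) \<Rightarrow> (nat \<Rightarrow> real) \<Rightarrow> (nat \<Rightarrow> real)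
    \<Rightarrow> nat \<Rightarrow> real" where
  "rbm_dist n k W b c = (\<lambda>v. if v < 2^n
      then (\<Sum>h<2^k. rbm_psi n k W b c v h) / rbm_Z n k W b c else 0)"

text \<open>The RBM model M^k_n as a subset of R^(2^n); parameters W in R^(k x n), b in R^n,
  c in R^k (entries with out-of-range indices are irrelevant).\<close>
definition rbm_model :: "nat \<Rightarrow> nat \<Rightarrow> (nat \<Rightarrow> real) set" where
  "rbm_model n k = {p. \<exists>W b c. p = rbm_dist n k W b c}"

end

theory Submission
  imports Defs "HOL-Library.FuncSet"
begin

text \<open>
  Semialgebraicity is the Tarski--Seidenberg theorem, proved by Cohen's method: the real roots of a
  polynomial are functions of its coefficients whose substitution into polynomials creates no new
  sign conditions, by induction on the degree.

  For the dimension, write the parameters as one family \<open>\<theta>\<close>. The unnormalised distribution is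
  \<open>exp (\<Sum>\<^sub>i b\<^sub>i v\<^sub>i) \<Prod>\<^sub>a (1 + exp (W\<^sub>a v + c\<^sub>a))\<close>, so the gradient of its logarithm at \<open>v\<close> consists of
  \<open>v\<close> and of the vectors \<open>\<sigma> (W\<^sub>a v + c\<^sub>a) (v, 1)\<close>. Scaling the parameters to infinity turns the
  sigmoids into indicators of half-spaces, and it suffices that the functions \<open>1, v\<^sub>i, 1\<^sub>H\<^sub>a, 1\<^sub>H\<^sub>a v\<^sub>i\<close>
  on the cube are independent (or spanning) for some half-spaces \<open>H\<^sub>a\<close>. Hamming balls of radius 1 are
  half-spaces and their points are affinely independent. Balls around the words of a covering code
  give a spanning family. Balls around the words of a packing code give an independent family if
  the rest of the cube affinely spans; this rest contains another ball when k is small, and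
  a coset of the (shortened Hamming) code otherwise. Only (n, k) = (2, 1), (4, 2), (5, 4) escape this
  argument. For the upper bound, too many coordinates are algebraically dependent by counting
  monomials.
\<close>

section \<open>Sign sets and effective functions\<close>

text \<open>The dimension is defined by open boxes inside coordinate projections. A lower bound
  therefore needs a local surjectivity theorem, an upper bound needs that no larger box fits;
  neither uses semialgebraicity. The constant 1 among the functions comes from normalisation:
  dividing by the partition function subtracts from each gradient its mean, a multiple of 1. The
  limit of infinite parameters is not a point of the parameter space. It serves because independence
  and spanning are open conditions, so they already hold at a large finite scale. The threshold
  comes from parity checks with r bits: n distinct nonzero columns give at least 2^(n-r) codewords
  with disjoint balls of n+1 states. With fewer nodes than codewords a ball stays free. When all
  codewords may be used, the visible biases have to be determined on states whose syndrome is
  neither 0 nor a column, and such a syndrome exists only if n+1 < 2^r. If n+1 = 2^r, the code is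
  perfect, there are more parameters than the simplex has dimensions, and spanning replaces
  independence.\<close>

definition func_ring :: "('e \<Rightarrow> real) set \<Rightarrow> bool" where
  "func_ring K \<longleftrightarrow> (\<forall>c. (\<lambda>_. c) \<in> K) \<and>
     (\<forall>f\<in>K. \<forall>g\<in>K. (\<lambda>y. f y + g y) \<in> K \<and> (\<lambda>y. f y * g y) \<in> K)"

lemma func_ring_const: "func_ring K \<Longrightarrow> (\<lambda>_. c) \<in> K"
  and func_ring_add: "func_ring K \<Longrightarrow> f \<in> K \<Longrightarrow> g \<in> K \<Longrightarrow> (\<lambda>y. f y + g y) \<in> K"
  and func_ring_mult: "func_ring K \<Longrightarrow> f \<in> K \<Longrightarrow> g \<in> K \<Longrightarrow> (\<lambda>y. f y * g y) \<in> K"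
  by (simp_all add: func_ring_def)

lemma func_ring_minus: assumes "func_ring K" "f \<in> K" shows "(\<lambda>y. - f y) \<in> K"
  using func_ring_mult[OF assms(1) func_ring_const[OF assms(1), of "-1"] assms(2)] by simp

lemma func_ring_diff: assumes "func_ring K" "f \<in> K" "g \<in> K" shows "(\<lambda>y. f y - g y) \<in> K"
  using func_ring_add[OF assms(1,2) func_ring_minus[OF assms(1,3)]] by simp

lemma func_ring_power: assumes "func_ring K" "f \<in> K" shows "(\<lambda>y. f y ^ m) \<in> K"
  by (induction m) (use assms func_ring_const func_ring_mult in auto)

lemmas func_ring_intros = func_ring_const func_ring_add func_ring_mult func_ring_minus
  func_ring_diff func_ring_power

section \<open>Boolean algebras of sign conditions\<close>

inductive_set sgn_alg :: "('e \<Rightarrow> real) set \<Rightarrow> 'e set set" for K where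
  sgn_alg_pos: "f \<in> K \<Longrightarrow> {y. 0 < f y} \<in> sgn_alg K"
| sgn_alg_Un: "A \<in> sgn_alg K \<Longrightarrow> B \<in> sgn_alg K \<Longrightarrow> A \<union> B \<in> sgn_alg K"
| sgn_alg_Compl: "A \<in> sgn_alg K \<Longrightarrow> - A \<in> sgn_alg K"

lemma sgn_alg_disj: "{y. P y} \<in> sgn_alg K \<Longrightarrow> {y. Q y} \<in> sgn_alg K \<Longrightarrow> {y. P y \<or> Q y} \<in> sgn_alg K"
  using sgn_alg_Un[of "{y. P y}" K "{y. Q y}"] by (simp add: Un_def)

lemma sgn_alg_not: "{y. P y} \<in> sgn_alg K \<Longrightarrow> {y. \<not> P y} \<in> sgn_alg K"
  using sgn_alg_Compl[of "{y. P y}" K] by (simp add: Compl_eq)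

lemma sgn_alg_conj: "{y. P y} \<in> sgn_alg K \<Longrightarrow> {y. Q y} \<in> sgn_alg K \<Longrightarrow> {y. P y \<and> Q y} \<in> sgn_alg K"
  using sgn_alg_not[OF sgn_alg_disj[OF sgn_alg_not sgn_alg_not, of P K Q]] by simp

lemma sgn_alg_less:
  "func_ring K \<Longrightarrow> f \<in> K \<Longrightarrow> g \<in> K \<Longrightarrow> {y. f y < g y} \<in> sgn_alg K"
  using sgn_alg_pos[OF func_ring_diff, of K g f] by simp

lemma sgn_alg_le:
  "func_ring K \<Longrightarrow> f \<in> K \<Longrightarrow> g \<in> K \<Longrightarrow> {y. f y \<le> g y} \<in> sgn_alg K"
  using sgn_alg_not[OF sgn_alg_less, of K g f] by (simp add: not_less)

lemma sgn_alg_eq: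
  "func_ring K \<Longrightarrow> f \<in> K \<Longrightarrow> g \<in> K \<Longrightarrow> {y. f y = g y} \<in> sgn_alg K"
  using sgn_alg_conj[OF sgn_alg_le sgn_alg_le, of K f g g f] by (simp add: order_eq_iff)

lemma sgn_alg_const: assumes "func_ring K" shows "{y. P} \<in> sgn_alg K"
  using sgn_alg_less[OF assms func_ring_const[OF assms] func_ring_const[OF assms],
      of 0 "if P then 1 else 0"] by (cases P) simp_all

lemma sgn_alg_bex:
  assumes "func_ring K" and "\<And>u. u \<in> set us \<Longrightarrow> {y. P u y} \<in> sgn_alg K"
  shows "{y. \<exists>u\<in>set us. P u y} \<in> sgn_alg K"
  using assms(2)
proof (induction us)
  case Nil
  show ?case using sgn_alg_const[OF assms(1), of False] by simp
next
  case (Cons u us)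
  have "{y. P u y} \<in> sgn_alg K" "{y. \<exists>u\<in>set us. P u y} \<in> sgn_alg K" using Cons by auto
  from sgn_alg_disj[OF this] show ?case by simp
qed

lemma sgn_alg_ball:
  assumes "func_ring K" and "\<And>u. u \<in> set us \<Longrightarrow> {y. P u y} \<in> sgn_alg K"
  shows "{y. \<forall>u\<in>set us. P u y} \<in> sgn_alg K"
  using sgn_alg_not[OF sgn_alg_bex[OF assms(1) sgn_alg_not[OF assms(2)]], of us "\<lambda>u. u"]
  by simp

lemmas sgn_alg_intros = sgn_alg_less sgn_alg_le sgn_alg_eq sgn_alg_conj sgn_alg_disj sgn_alg_not
  sgn_alg_ball sgn_alg_bex

lemma sgn_alg_mono: "A \<in> sgn_alg K \<Longrightarrow> K \<subseteq> L \<Longrightarrow> A \<in> sgn_alg L"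
  by (induction rule: sgn_alg.induct) (auto intro: sgn_alg.intros)

text \<open>A polynomial in x whose coefficients, lowest degree first, are functions of a parameter
  y. The last coefficient may vanish at some y, so the length bounds the degree without fixing
  it.\<close>

fun ev :: "('e \<Rightarrow> real) list \<Rightarrow> 'e \<Rightarrow> real \<Rightarrow> real" where
  "ev [] y x = 0"
| "ev (c # cs) y x = c y + x * ev cs y x"

lemma ev_mem:
  assumes "func_ring K" "cs \<in> lists K" "f \<in> K" shows "(\<lambda>y. ev cs y (f y)) \<in> K"
  using assms(2) by (induction cs) (auto intro!: func_ring_intros assms)

lemma ev_append: "ev (cs @ ds) y x = ev cs y x + x ^ length cs * ev ds y x"
  by (induction cs) (auto simp: algebra_simps)

lemma ev_add:
  assumes "func_ring K" "cs \<in> lists K" "ds \<in> lists K"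
  shows "\<exists>es\<in>lists K. length es = max (length cs) (length ds) \<and>
    (\<forall>y x. ev es y x = ev cs y x + ev ds y x)"
  using assms(2,3)
proof (induction cs arbitrary: ds)
  case Nil
  then show ?case by (intro bexI[of _ ds]) auto
next
  case (Cons c cs)
  note c = Cons.hyps(1)
  show ?case
  proof (cases ds)
    case Nil
    then show ?thesis using Cons by (intro bexI[of _ "c # cs"]) auto
  next
    case (Cons d ds')
    with Cons.IH[of ds'] Cons.prems obtain es where es: "es \<in> lists K"
      "length es = max (length cs) (length ds')" "\<forall>y x. ev es y x = ev cs y x + ev ds' y x"
      by auto
    then show ?thesis using Cons Cons.prems
      by (intro bexI[of _ "(\<lambda>y. c y + d y) # es"])
        (auto simp: algebra_simps intro!: func_ring_intros assms(1) c)
  qed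
qed

lemma ev_smult:
  assumes "func_ring K" "cs \<in> lists K" "f \<in> K"
  shows "\<exists>es\<in>lists K. length es = length cs \<and> (\<forall>y x. ev es y x = f y * ev cs y x)"
  using assms(2)
proof (induction cs)
  case Nil
  then show ?case by (intro bexI[of _ "[]"]) auto
next
  case (Cons c cs)
  then obtain es where "es \<in> lists K" "length es = length cs" "\<forall>y x. ev es y x = f y * ev cs y x"
    by auto
  with Cons show ?case
    by (intro bexI[of _ "(\<lambda>y. f y * c y) # es"])
      (auto simp: algebra_simps intro!: func_ring_intros assms)
qed

lemma ev_mult:
  assumes "func_ring K" "cs \<in> lists K" "ds \<in> lists K"
  shows "\<exists>es\<in>lists K. \<forall>y x. ev es y x = ev cs y x * ev ds y x"
  using assms(2)
proof (induction cs)
  case Nil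
  then show ?case by (intro bexI[of _ "[]"]) auto
next
  case (Cons c cs)
  then obtain es where es: "es \<in> lists K" "\<forall>y x. ev es y x = ev cs y x * ev ds y x"
    by auto
  obtain fs where fs: "fs \<in> lists K" "\<forall>y x. ev fs y x = c y * ev ds y x"
    using ev_smult[OF assms(1,3) Cons.hyps(1)] by blast
  have "(\<lambda>_. 0) # es \<in> lists K" using es func_ring_const[OF assms(1)] by simp
  then obtain gs where "gs \<in> lists K" "\<forall>y x. ev gs y x = ev fs y x + ev ((\<lambda>_. 0) # es) y x"
    using ev_add[OF assms(1) fs(1)] by blast
  then show ?case using es(2) fs(2) by (intro bexI[of _ gs]) (simp_all add: algebra_simps)
qed

lemma ev_deriv:
  assumes "func_ring K" "cs \<in> lists K"
  shows "\<exists>ds\<in>lists K. length ds = length cs - 1 \<and>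
    (\<forall>y x. ((\<lambda>x. ev cs y x) has_real_derivative ev ds y x) (at x))"
  using assms(2)
proof (induction cs)
  case Nil
  then show ?case by (intro bexI[of _ "[]"]) auto
next
  case (Cons c cs)
  then obtain ds where ds: "ds \<in> lists K" "length ds = length cs - 1"
    "\<And>y x. ((\<lambda>x. ev cs y x) has_real_derivative ev ds y x) (at x)" by auto
  show ?case
  proof (cases "cs = []")
    case True
    then show ?thesis by (intro bexI[of _ "[]"]) auto
  next
    case False
    have "(\<lambda>_. 0) # ds \<in> lists K" using ds(1) func_ring_const[OF assms(1)] by simp
    then obtain es where es: "es \<in> lists K" "length es = max (length cs) (length ((\<lambda>_. 0 :: real) # ds))"
      "\<forall>y x. ev es y x = ev cs y x + ev ((\<lambda>_. 0) # ds) y x"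
      using ev_add[OF assms(1) Cons.hyps(2)] by blast
    have "((\<lambda>x. ev (c # cs) y x) has_real_derivative ev es y x) (at x)" for y x
      using es(3) by (auto intro!: derivative_eq_intros ds(3))
    moreover have "length es = length (c # cs) - 1" using es(2) ds(2) False by (simp add: Suc_leI)
    ultimately show ?thesis using es(1) by blast
  qed
qed

lemma isCont_ev: "isCont (\<lambda>x. ev cs y x) x"
  by (induction cs) (simp_all add: isCont_mult isCont_add)

text \<open>Cohen's notion of effective function: substituting f into a polynomial over K
  does not create new sign sets. The hull collects the functions that stay effective over
  every ring extension, which makes it a ring with the same sign sets as K.\<close>

definition effective :: "('e \<Rightarrow> real) set \<Rightarrow> ('e \<Rightarrow> real) \<Rightarrow> bool" where
  "effective K f \<longleftrightarrow> (\<forall>cs\<in>lists K. {y. 0 < ev cs y (f y)} \<in> sgn_alg K)"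

definition eff_hull :: "('e \<Rightarrow> real) set \<Rightarrow> ('e \<Rightarrow> real) set" where
  "eff_hull K = {f. \<forall>L. func_ring L \<longrightarrow> K \<subseteq> L \<longrightarrow> effective L f}"

definition adjoin :: "('e \<Rightarrow> real) set \<Rightarrow> ('e \<Rightarrow> real) \<Rightarrow> ('e \<Rightarrow> real) set" where
  "adjoin K f = {\<lambda>y. ev cs y (f y) | cs. cs \<in> lists K}"

lemma subset_adjoin: assumes "func_ring K" shows "K \<subseteq> adjoin K f" "f \<in> adjoin K f"
proof -
  have "h \<in> adjoin K f" if "h \<in> K" for h
    unfolding adjoin_def using that by (intro CollectI exI[of _ "[h]"]) auto
  then show "K \<subseteq> adjoin K f" by auto
  have "f = (\<lambda>y. ev [\<lambda>_. 0, \<lambda>_. 1] y (f y))" by auto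
  then show "f \<in> adjoin K f" unfolding adjoin_def using func_ring_const[OF assms]
    by (intro CollectI exI[of _ "[\<lambda>_. 0, \<lambda>_. 1]"]) auto
qed

lemma func_ring_adjoin: assumes "func_ring K" shows "func_ring (adjoin K f)"
  unfolding func_ring_def
proof (intro conjI allI ballI)
  fix c show "(\<lambda>_. c) \<in> adjoin K f"
    using subset_adjoin[OF assms] func_ring_const[OF assms] by blast
next
  fix g h assume "g \<in> adjoin K f" "h \<in> adjoin K f"
  then obtain cs ds where *: "cs \<in> lists K" "ds \<in> lists K" and
    gh: "g = (\<lambda>y. ev cs y (f y))" "h = (\<lambda>y. ev ds y (f y))"
    unfolding adjoin_def by auto
  show "(\<lambda>y. g y + h y) \<in> adjoin K f"
  proof -
    obtain es where "es \<in> lists K" "\<forall>y x. ev es y x = ev cs y x + ev ds y x"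
      using ev_add[OF assms *] by blast
    then show ?thesis unfolding gh adjoin_def by (intro CollectI exI[of _ es]) auto
  qed
  show "(\<lambda>y. g y * h y) \<in> adjoin K f"
  proof -
    obtain es where "es \<in> lists K" "\<forall>y x. ev es y x = ev cs y x * ev ds y x"
      using ev_mult[OF assms *] by blast
    then show ?thesis unfolding gh adjoin_def by (intro CollectI exI[of _ es]) auto
  qed
qed

lemma sgn_alg_adjoin:
  assumes "func_ring K" "effective K f" shows "sgn_alg (adjoin K f) \<subseteq> sgn_alg K"
proof
  fix A assume "A \<in> sgn_alg (adjoin K f)"
  then show "A \<in> sgn_alg K"
    by induction (use assms(2) in \<open>auto simp: adjoin_def effective_def intro: sgn_alg.intros\<close>)
qed

lemma effective_mem: assumes "func_ring K" "f \<in> K" shows "effective K f"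
  unfolding effective_def using sgn_alg_pos[OF ev_mem[OF assms(1) _ assms(2)]] by simp

lemma subset_eff_hull: "K \<subseteq> eff_hull K"
  using effective_mem by (auto simp: eff_hull_def)

text \<open>Sign sets descend along the tower L, L[g], L[g][f], each step being effective; a
  polynomial over L evaluated at h is an element of the top ring.\<close>

lemma effective_adjoin2:
  assumes "func_ring L" "effective L g" "effective (adjoin L g) f" "h \<in> adjoin (adjoin L g) f"
  shows "effective L h"
  unfolding effective_def
proof
  fix cs assume "cs \<in> lists L"
  let ?M = "adjoin (adjoin L g) f"
  have "cs \<in> lists ?M"
    using \<open>cs \<in> lists L\<close> subset_adjoin(1)[OF assms(1), of g]
      subset_adjoin(1)[OF func_ring_adjoin[OF assms(1), of g], of f] by (auto simp: lists_eq_set)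
  then have "{y. 0 < ev cs y (h y)} \<in> sgn_alg ?M"
    by (intro sgn_alg_pos ev_mem func_ring_adjoin assms)
  then show "{y. 0 < ev cs y (h y)} \<in> sgn_alg L"
    using sgn_alg_adjoin[OF func_ring_adjoin[OF assms(1)] assms(3)] sgn_alg_adjoin[OF assms(1,2)]
    by blast
qed

text \<open>Here effectiveness over all extensions is essential: to treat f + g and f * g over L,
  adjoin g and use that f is still effective over the larger ring L[g].\<close>

lemma func_ring_eff_hull: assumes "func_ring K" shows "func_ring (eff_hull K)"
  unfolding func_ring_def
proof (intro conjI allI ballI)
  fix c show "(\<lambda>_. c) \<in> eff_hull K"
    using subset_eff_hull func_ring_const[OF assms] by blast
next
  fix f g assume fg: "f \<in> eff_hull K" "g \<in> eff_hull K"
  have "effective L (\<lambda>y. f y + g y) \<and> effective L (\<lambda>y. f y * g y)"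
    if L: "func_ring L" "K \<subseteq> L" for L
  proof -
    have 1: "effective L g" using fg(2) L by (auto simp: eff_hull_def)
    have R: "func_ring (adjoin L g)" by (rule func_ring_adjoin[OF L(1)])
    have 2: "effective (adjoin L g) f"
      using fg(1) R subset_adjoin(1)[OF L(1)] L(2) unfolding eff_hull_def by blast
    have "f \<in> adjoin (adjoin L g) f" "g \<in> adjoin (adjoin L g) f"
      using subset_adjoin[OF R, of f] subset_adjoin[OF L(1), of g] by auto
    then show ?thesis
      using effective_adjoin2[OF L(1) 1 2] func_ring_adjoin[OF R, of f]
      by (auto intro: func_ring_intros)
  qed
  then show "(\<lambda>y. f y + g y) \<in> eff_hull K" "(\<lambda>y. f y * g y) \<in> eff_hull K"
    by (auto simp: eff_hull_def)
qed

lemma sgn_alg_eff_hull: assumes "func_ring K" shows "sgn_alg (eff_hull K) = sgn_alg K"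
proof
  show "sgn_alg K \<subseteq> sgn_alg (eff_hull K)"
    using sgn_alg_mono[OF _ subset_eff_hull] by auto
  show "sgn_alg (eff_hull K) \<subseteq> sgn_alg K"
  proof
    fix A assume "A \<in> sgn_alg (eff_hull K)"
    then show "A \<in> sgn_alg K"
    proof induction
      case (sgn_alg_pos f)
      then have "effective K f" using assms by (auto simp: eff_hull_def)
      then show ?case using func_ring_const[OF assms] unfolding effective_def
        by (auto dest!: bspec[of _ _ "[\<lambda>_. 0, \<lambda>_. 1]"])
    qed (auto intro: sgn_alg.intros)
  qed
qed

lemma eff_hull_mono: "K \<subseteq> L \<Longrightarrow> eff_hull K \<subseteq> eff_hull L"
  by (auto simp: eff_hull_def)

definition eff_closed :: "('e \<Rightarrow> real) set \<Rightarrow> bool" where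
  "eff_closed K \<longleftrightarrow> func_ring K \<and> eff_hull K \<subseteq> K"

lemma eff_closed_ring: "eff_closed K \<Longrightarrow> func_ring K"
  by (simp add: eff_closed_def)

lemma effective_eff_hullD:
  assumes "func_ring L" "effective (eff_hull L) f" shows "effective L f"
  unfolding effective_def
proof
  fix cs assume "cs \<in> lists L"
  then have "cs \<in> lists (eff_hull L)" using subset_eff_hull by (auto simp: lists_eq_set)
  then show "{y. 0 < ev cs y (f y)} \<in> sgn_alg L"
    using assms(2) sgn_alg_eff_hull[OF assms(1)] unfolding effective_def by auto
qed

lemma eff_closed_eff_hull: assumes "func_ring K" shows "eff_closed (eff_hull K)"
proof -
  have "f \<in> eff_hull K" if "f \<in> eff_hull (eff_hull K)" for f
  proof -
    have "effective L f" if L: "func_ring L" "K \<subseteq> L" for L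
    proof (rule effective_eff_hullD[OF L(1)])
      show "effective (eff_hull L) f"
        using \<open>f \<in> eff_hull (eff_hull K)\<close> func_ring_eff_hull[OF L(1)] eff_hull_mono[OF L(2)]
        unfolding eff_hull_def[of "eff_hull K"] by auto
    qed
    then show ?thesis by (auto simp: eff_hull_def)
  qed
  then show ?thesis using func_ring_eff_hull[OF assms] by (auto simp: eff_closed_def)
qed

text \<open>A ring may be replaced by its hull, which has the same sign sets. So effectiveness has
  to be tested over closed rings only, where divisions and root functions are available.\<close>

lemma eff_closed_memI:
  assumes "eff_closed K" "\<And>L. eff_closed L \<Longrightarrow> K \<subseteq> L \<Longrightarrow> effective L f"
  shows "f \<in> K"
proof -
  have "effective L f" if L: "func_ring L" "K \<subseteq> L" for L
    using effective_eff_hullD[OF L(1)] assms(2)[OF eff_closed_eff_hull[OF L(1)]]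
      subset_eff_hull[of L] L(2) by blast
  then have "f \<in> eff_hull K" by (auto simp: eff_hull_def)
  then show ?thesis using assms(1) by (auto simp: eff_closed_def)
qed

text \<open>Clearing denominators reduces the sign of a polynomial at 1 / f to that of a ring
  element. Inverses serve to make polynomials monic.\<close>

lemma eff_closed_inverse:
  assumes K: "eff_closed K" and f: "f \<in> K" shows "(\<lambda>y. 1 / f y) \<in> K"
proof (rule eff_closed_memI[OF K])
  fix L assume L: "eff_closed L" "K \<subseteq> L"
  note R = eff_closed_ring[OF L(1)]
  have fL: "f \<in> L" using f L by auto
  show "effective L (\<lambda>y. 1 / f y)"
    unfolding effective_def
  proof
    fix cs assume cs: "cs \<in> lists L"
    have "\<exists>g\<in>L. \<forall>y. f y \<noteq> 0 \<longrightarrow> g y = f y ^ length cs * ev cs y (1 / f y)"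
      using cs
    proof (induction cs)
      case Nil
      then show ?case using func_ring_const[OF R, of 0] by auto
    next
      case (Cons c cs)
      then obtain g where "g \<in> L" "\<forall>y. f y \<noteq> 0 \<longrightarrow> g y = f y ^ length cs * ev cs y (1 / f y)"
        by auto
      then show ?case using Cons.hyps
        by (intro bexI[of _ "\<lambda>y. f y ^ Suc (length cs) * c y + g y"])
          (auto simp: field_simps intro!: func_ring_intros R fL)
    qed
    then obtain g where g: "g \<in> L" "\<forall>y. f y \<noteq> 0 \<longrightarrow> g y = f y ^ length cs * ev cs y (1 / f y)"
      by auto
    \<comment> \<open>The factor \<open>f y ^ length cs\<close> enters twice, once inside g, so in
      total as a square that keeps the sign. Where \<open>f y = 0\<close>, the convention 1 / 0 = 0
      means evaluation at 0.\<close>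
    have eq: "{y. 0 < ev cs y (1 / f y)} =
      {y. (f y \<noteq> 0 \<and> 0 < f y ^ length cs * g y) \<or> (f y = 0 \<and> 0 < ev cs y 0)}"
    proof -
      have "0 < ev cs y (1 / f y) \<longleftrightarrow> 0 < f y ^ length cs * g y" if "f y \<noteq> 0" for y
      proof -
        have "f y ^ length cs * g y = (f y ^ length cs)\<^sup>2 * ev cs y (1 / f y)"
          using g(2) that by (simp add: power2_eq_square)
        moreover have "(f y ^ length cs)\<^sup>2 > 0" using that by simp
        ultimately show ?thesis by (metis zero_less_mult_pos mult_pos_pos)
      qed
      then have "0 < ev cs y (1 / f y) \<longleftrightarrow>
        (f y \<noteq> 0 \<and> 0 < f y ^ length cs * g y) \<or> (f y = 0 \<and> 0 < ev cs y 0)" for y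
        by (cases "f y = 0") auto
      then show ?thesis by auto
    qed
    show "{y. 0 < ev cs y (1 / f y)} \<in> sgn_alg L"
      unfolding eq
      by (intro sgn_alg_intros R func_ring_intros fL g(1) ev_mem cs)
  qed
qed

section \<open>Sign changes and isolated roots on the real line\<close>

lemma sign_change_root:
  fixes f :: "real \<Rightarrow> real"
  assumes "\<And>x. isCont f x" "a < b" "f a * f b < 0"
  shows "\<exists>x. a < x \<and> x < b \<and> f x = 0"
proof -
  have "\<exists>x\<ge>a. x \<le> b \<and> f x = 0"
  proof (cases "f a < 0")
    case True
    then have "f b > 0" using assms(3) by (auto simp: mult_less_0_iff)
    then show ?thesis using IVT[of f a 0 b] assms(1,2) True by force
  next
    case False
    then have "f b < 0" "f a > 0" using assms(3) by (auto simp: mult_less_0_iff)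
    then show ?thesis using IVT2[of f b 0 a] assms(1,2) by force
  qed
  then obtain x where x: "a \<le> x" "x \<le> b" "f x = 0" by blast
  then have "x \<noteq> a" "x \<noteq> b" using assms(3) by auto
  then show ?thesis using x by (intro exI[of _ x]) auto
qed

lemma sgn_eq_if_no_root:
  fixes f :: "real \<Rightarrow> real"
  assumes "\<And>x. isCont f x" "\<And>z. min a b \<le> z \<Longrightarrow> z \<le> max a b \<Longrightarrow> f z \<noteq> 0"
  shows "sgn (f a) = sgn (f b)"
proof (rule ccontr)
  assume ne: "sgn (f a) \<noteq> sgn (f b)"
  then have "a \<noteq> b" by auto
  have "f a \<noteq> 0" "f b \<noteq> 0" using assms(2)[of a] assms(2)[of b] by auto
  then have "f (min a b) * f (max a b) < 0"
    using ne by (auto simp: min_def max_def mult_less_0_iff sgn_if split: if_splits)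
  then show False
    using sign_change_root[OF assms(1), of "min a b" "max a b"] assms(2) \<open>a \<noteq> b\<close>
    by (auto simp: min_def max_def split: if_splits)
qed

text \<open>A second root would produce a zero of f' between the two. The sign of
  \<open>f s * f x\<close> then tells on which side of the root x lies without mentioning the root,
  which is how later sign conditions refer to it.\<close>

lemma unique_root:
  fixes f f' :: "real \<Rightarrow> real"
  assumes D: "\<And>x. (f has_real_derivative f' x) (at x)"
    and st: "s < t" "f s * f t < 0" and nz: "\<And>x. s < x \<Longrightarrow> x < t \<Longrightarrow> f' x \<noteq> 0"
  shows "\<exists>r. s < r \<and> r < t \<and> f r = 0 \<and>
    (\<forall>x. s < x \<longrightarrow> x < t \<longrightarrow> (f x = 0 \<longleftrightarrow> x = r) \<and> (0 < f s * f x \<longleftrightarrow> x < r))"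
proof -
  have C: "isCont f x" for x using D DERIV_isCont by blast
  obtain r where r: "s < r" "r < t" "f r = 0" using sign_change_root[OF C st] by auto
  have no2: False if "s < a" "a < b" "b < t" "f a = 0" "f b = 0" for a b
  proof -
    have "\<exists>z>a. z < b \<and> f b - f a = (b - a) * f' z"
      using MVT2[of a b f f'] D \<open>a < b\<close> by auto
    then obtain z where z: "z > a" "z < b" "f b - f a = (b - a) * f' z" by auto
    then show False using nz[of z] that by auto
  qed
  have uniq: "f x = 0 \<longleftrightarrow> x = r" if "s < x" "x < t" for x
    using no2[of x r] no2[of r x] r that by (cases x r rule: linorder_cases) auto
  have "0 < f s * f x \<longleftrightarrow> x < r" if x: "s < x" "x < t" for x
  proof
    assume pos: "0 < f s * f x"
    show "x < r"
    proof (rule ccontr)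
      assume "\<not> x < r"
      then have "r < x" using pos r by (cases "x = r") auto
      have "f x * f t < 0" using pos st(2) by (auto simp: zero_less_mult_iff mult_less_0_iff)
      then obtain z where "x < z" "z < t" "f z = 0" using sign_change_root[OF C x(2)] by auto
      then show False using uniq[of z] x \<open>r < x\<close> by auto
    qed
  next
    assume "x < r"
    have "f x \<noteq> 0" using uniq[OF x] \<open>x < r\<close> by auto
    moreover have "f s \<noteq> 0" using st by auto
    moreover have "\<not> f s * f x < 0"
    proof
      assume "f s * f x < 0"
      then obtain z where "s < z" "z < x" "f z = 0" using sign_change_root[OF C x(1)] by auto
      then show False using uniq[of z] x \<open>x < r\<close> by auto
    qed
    ultimately show "0 < f s * f x" by (metis linorder_neqE_linordered_idom mult_eq_0_iff)
  qed
  then show ?thesis using r uniq by auto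
qed

section \<open>Tarski--Seidenberg\<close>

text \<open>The functions hit every root, but further values and any order are allowed; this avoids
  counting real roots. Parameters at which the polynomial vanishes identically are exempt.\<close>

definition root_cover :: "('e \<Rightarrow> real) list \<Rightarrow> ('e \<Rightarrow> real) list \<Rightarrow> bool" where
  "root_cover cs us \<longleftrightarrow>
     (\<forall>y x. (\<exists>z. ev cs y z \<noteq> 0) \<longrightarrow> ev cs y x = 0 \<longrightarrow> (\<exists>u\<in>set us. u y = x))"

text \<open>The degree is at most \<open>length cs - 1\<close>; the additional factor of absolute
  value x on the left avoids this subtraction and includes the empty list.\<close>

lemma ev_growth:
  assumes "func_ring K" "cs \<in> lists K"
  shows "\<exists>b\<in>K. \<forall>y. 0 \<le> b y \<and> (\<forall>x. 1 \<le> \<bar>x\<bar> \<longrightarrow> \<bar>ev cs y x\<bar> * \<bar>x\<bar> \<le> b y * \<bar>x\<bar> ^ length cs)"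
  using assms(2)
proof (induction cs)
  case Nil
  show ?case using func_ring_const[OF assms(1), of 0] by auto
next
  case (Cons c cs)
  then obtain b where b: "b \<in> K" "\<And>y. 0 \<le> b y"
    "\<And>y x. 1 \<le> \<bar>x\<bar> \<Longrightarrow> \<bar>ev cs y x\<bar> * \<bar>x\<bar> \<le> b y * \<bar>x\<bar> ^ length cs" by blast
  \<comment> \<open>\<open>1 + c y * c y\<close> dominates the absolute value of \<open>c y\<close>
    and lies in the ring, whereas the absolute value itself need not.\<close>
  have "(\<lambda>y. (1 + c y * c y) + b y) \<in> K"
    using Cons.hyps(1) b(1) by (intro func_ring_intros assms(1))
  moreover have "0 \<le> (1 + c y * c y) + b y" for y using b(2)[of y] by (simp add: add_nonneg_nonneg)
  moreover have "\<bar>ev (c # cs) y x\<bar> * \<bar>x\<bar> \<le> ((1 + c y * c y) + b y) * \<bar>x\<bar> ^ length (c # cs)"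
    if x: "1 \<le> \<bar>x\<bar>" for y x
  proof -
    have c1: "\<bar>c y\<bar> \<le> 1 + c y * c y"
    proof -
      have "0 \<le> (\<bar>c y\<bar> - 1)\<^sup>2" by simp
      then have "2 * \<bar>c y\<bar> \<le> 1 + \<bar>c y\<bar> * \<bar>c y\<bar>" by (simp add: power2_eq_square algebra_simps)
      also have "\<bar>c y\<bar> * \<bar>c y\<bar> = c y * c y" by simp
      finally show ?thesis by linarith
    qed
    have x1: "\<bar>x\<bar> \<le> \<bar>x\<bar> ^ Suc (length cs)" using x by (simp add: mult_le_cancel_left1)
    have "\<bar>ev (c # cs) y x\<bar> * \<bar>x\<bar> \<le> (\<bar>c y\<bar> + \<bar>x\<bar> * \<bar>ev cs y x\<bar>) * \<bar>x\<bar>"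
      by (intro mult_right_mono) (simp_all add: abs_triangle_ineq[THEN order_trans] abs_mult)
    also have "\<dots> = \<bar>c y\<bar> * \<bar>x\<bar> + \<bar>x\<bar> * (\<bar>ev cs y x\<bar> * \<bar>x\<bar>)" by (simp add: algebra_simps)
    also have "\<dots> \<le> (1 + c y * c y) * \<bar>x\<bar> ^ Suc (length cs) + \<bar>x\<bar> * (b y * \<bar>x\<bar> ^ length cs)"
      by (intro add_mono mult_mono mult_left_mono b(3) x c1 x1) auto
    finally show ?thesis by (simp add: algebra_simps)
  qed
  ultimately show ?case by (intro bexI[of _ "\<lambda>y. (1 + c y * c y) + b y"]) blast+
qed

text \<open>At a root the lower terms balance the leading one, which the growth bound excludes
  beyond \<open>1 + b y\<close>. The bound is itself a ring element, so that it can serve as an end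
  point for root isolation.\<close>

lemma monic_root_bound:
  assumes "func_ring K" "cs \<in> lists K"
  shows "\<exists>b\<in>K. \<forall>y x. b y \<le> \<bar>x\<bar> \<longrightarrow> ev (cs @ [\<lambda>_. 1]) y x \<noteq> 0"
proof -
  obtain b where b: "b \<in> K" "\<And>y. 0 \<le> b y"
    "\<And>y x. 1 \<le> \<bar>x\<bar> \<Longrightarrow> \<bar>ev cs y x\<bar> * \<bar>x\<bar> \<le> b y * \<bar>x\<bar> ^ length cs"
    using ev_growth[OF assms] by blast
  have "ev (cs @ [\<lambda>_. 1]) y x \<noteq> 0" if x: "1 + b y \<le> \<bar>x\<bar>" for y x
  proof
    assume "ev (cs @ [\<lambda>_. 1]) y x = 0"
    then have "\<bar>ev cs y x\<bar> = \<bar>x\<bar> ^ length cs"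
      by (simp add: ev_append power_abs[symmetric] abs_minus_cancel eq_neg_iff_add_eq_0[symmetric])
    then have "\<bar>x\<bar> ^ length cs * \<bar>x\<bar> \<le> \<bar>x\<bar> ^ length cs * b y" using b(3)[of x y] b(2)[of y] x
      by (simp add: mult.commute)
    moreover have "\<bar>x\<bar> ^ length cs > 0" using x b(2)[of y] by (intro zero_less_power) linarith
    ultimately show False using x by simp
  qed
  moreover have "(\<lambda>y. 1 + b y) \<in> K" by (intro func_ring_intros assms b)
  ultimately show ?thesis by (intro bexI[of _ "\<lambda>y. 1 + b y"]) blast+
qed

text \<open>Let m be the length of cs. If q reduces to r' + d X^(m-1), then X q reduces to X r' - d
  cs, since the monic modulus replaces X^m by - cs. Only values at roots are compared, so no
  quotient is carried along.\<close>

lemma monic_remainder: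
  assumes "func_ring K" "cs \<in> lists K" "q \<in> lists K" "cs \<noteq> []"
  shows "\<exists>r\<in>lists K. length r = length cs \<and>
    (\<forall>y x. ev (cs @ [\<lambda>_. 1]) y x = 0 \<longrightarrow> ev q y x = ev r y x)"
  using assms(3)
proof (induction q)
  case Nil
  have "ev (replicate m (\<lambda>_. 0)) y x = 0" for m y x by (induction m) auto
  then show ?case using func_ring_const[OF assms(1), of 0]
    by (intro bexI[of _ "replicate (length cs) (\<lambda>_. 0)"]) auto
next
  case (Cons c q)
  then obtain r where r: "r \<in> lists K" "length r = length cs"
    "\<And>y x. ev (cs @ [\<lambda>_. 1]) y x = 0 \<Longrightarrow> ev q y x = ev r y x" by blast
  obtain r' d where rd: "r = r' @ [d]" using assms(4) r(2) by (metis length_0_conv rev_exhaust)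
  have K: "r' \<in> lists K" "d \<in> K" using r(1) rd by auto
  obtain es where es: "es \<in> lists K" "length es = length cs" "\<And>y x. ev es y x = - d y * ev cs y x"
    using ev_smult[OF assms(1,2) func_ring_minus[OF assms(1) K(2)]] by blast
  have "c # r' \<in> lists K" using K Cons by auto
  then obtain fs where fs: "fs \<in> lists K" "length fs = max (length (c # r')) (length es)"
    "\<And>y x. ev fs y x = ev (c # r') y x + ev es y x"
    using ev_add[OF assms(1) _ es(1)] by blast
  have "ev (c # q) y x = ev fs y x" if "ev (cs @ [\<lambda>_. 1]) y x = 0" for y x
  proof -
    have "ev cs y x = - (x ^ length cs)" using that by (simp add: ev_append)
    moreover have "length cs = Suc (length r')" using rd r(2) by simp
    ultimately show ?thesis using r(3)[OF that] rd by (simp add: fs es ev_append algebra_simps)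
  qed
  moreover have "length fs = length cs" using fs(2) es(2) rd r(2) by simp
  ultimately show ?case using fs(1) by blast
qed

text \<open>By the mean value theorem \<open>f s\<close> and \<open>f t\<close> are a negative and a
  positive multiple of values of f', which has constant sign between s and t.\<close>

lemma simple_root_sign_change:
  fixes f f' :: "real \<Rightarrow> real"
  assumes D: "\<And>x. (f has_real_derivative f' x) (at x)" and C: "\<And>x. isCont f' x"
    and st: "s < x" "x < t" "f x = 0" and nz: "\<And>x. s < x \<Longrightarrow> x < t \<Longrightarrow> f' x \<noteq> 0"
  shows "f s * f t < 0"
proof -
  have "\<exists>z>s. z < x \<and> f x - f s = (x - s) * f' z" using MVT2[OF st(1), of f f'] D by auto
  then obtain a where a: "s < a" "a < x" "f s = - ((x - s) * f' a)" using st(3) by auto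
  have "\<exists>z>x. z < t \<and> f t - f x = (t - x) * f' z" using MVT2[OF st(2), of f f'] D by auto
  then obtain b where b: "x < b" "b < t" "f t = (t - x) * f' b" using st(3) by auto
  have "\<not> f' a * f' b < 0"
  proof
    assume "f' a * f' b < 0"
    then obtain z where "a < z" "z < b" "f' z = 0"
      using sign_change_root[OF C, of a b] a b by auto
    then show False using nz[of z] a b by auto
  qed
  moreover have "f' a \<noteq> 0" "f' b \<noteq> 0" using nz[of a] nz[of b] a b by auto
  ultimately have "f' a * f' b > 0" by (metis linorder_neqE_linordered_idom mult_eq_0_iff)
  then have "((x - s) * (t - x)) * (f' a * f' b) > 0" using st by simp
  then show ?thesis unfolding a(3) b(3) by (simp add: algebra_simps)
qed

lemma nearest_below:
  fixes x :: real
  assumes "finite S" "\<exists>s\<in>S. s < x"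
  shows "\<exists>s\<in>S. s < x \<and> (\<forall>z\<in>S. \<not> (s < z \<and> z < x))"
proof -
  let ?T = "{s\<in>S. s < x}"
  have "finite ?T" "?T \<noteq> {}" using assms by auto
  then have "Max ?T \<in> ?T" "\<And>z. z \<in> ?T \<Longrightarrow> z \<le> Max ?T" by (rule Max_in, simp add: Max_ge)
  then show ?thesis by (intro bexI[of _ "Max ?T"]) force+
qed

lemma nearest_above:
  fixes x :: real
  assumes "finite S" "\<exists>s\<in>S. x < s"
  shows "\<exists>s\<in>S. x < s \<and> (\<forall>z\<in>S. \<not> (x < z \<and> z < s))"
proof -
  have "\<exists>s\<in>uminus ` S. s < - x \<and> (\<forall>z\<in>uminus ` S. \<not> (s < z \<and> z < - x))"
    using assms by (intro nearest_below) auto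
  then show ?thesis by force
qed

text \<open>The sign of a polynomial q at the unique root of A between s and t is found by
  reducing q modulo A and locating the root among the zeros of the remainder, which have
  lower degree.\<close>

lemma isolated_root_mem:
  assumes K: "eff_closed K"
    and IH: "\<And>L cs. eff_closed L \<Longrightarrow> K \<subseteq> L \<Longrightarrow> cs \<in> lists L \<Longrightarrow> length cs \<le> m \<Longrightarrow> \<exists>us\<in>lists L. root_cover cs us"
    and ms: "ms \<in> lists K" "length ms = m" "0 < m"
    and st: "s \<in> K" "t \<in> K"
    and cond: "{y. P y} \<in> sgn_alg K"
    and iso: "\<And>y. P y \<Longrightarrow> s y < r y \<and> r y < t y \<and> ev (ms @ [\<lambda>_. 1]) y (r y) = 0 \<and>
      (\<forall>x. s y < x \<longrightarrow> x < t y \<longrightarrow> (ev (ms @ [\<lambda>_. 1]) y x = 0 \<longleftrightarrow> x = r y) \<and>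
        (0 < ev (ms @ [\<lambda>_. 1]) y (s y) * ev (ms @ [\<lambda>_. 1]) y x \<longleftrightarrow> x < r y))"
    and nP: "\<And>y. \<not> P y \<Longrightarrow> r y = 0"
  shows "r \<in> K"
proof (rule eff_closed_memI[OF K])
  fix L assume L: "eff_closed L" "K \<subseteq> L"
  note R = eff_closed_ring[OF L(1)]
  have msL: "ms \<in> lists L" using ms L(2) by (auto simp: lists_eq_set)
  have stL: "s \<in> L" "t \<in> L" using st L(2) by auto
  define A where "A = ms @ [\<lambda>_. 1]"
  have AL: "A \<in> lists L" using msL func_ring_const[OF R] by (simp add: A_def)
  show "effective L r"
    unfolding effective_def
  proof
    fix q assume q: "q \<in> lists L"
    obtain p where p: "p \<in> lists L" "length p = m"
      "\<And>y x. ev A y x = 0 \<Longrightarrow> ev q y x = ev p y x"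
      using monic_remainder[OF R msL q] ms unfolding A_def by auto
    obtain us where us: "us \<in> lists L" "root_cover p us" using IH[OF L p(1)] p(2) by auto
    have usL: "u \<in> L" if "u \<in> set us" for u using us(1) that by auto
    \<comment> \<open>\<open>eqr\<close> and \<open>ltr\<close> express u = r and u < r by sign
      conditions in which r does not occur. This works because r is the only root of A between s and
      t and the sign of A relative to its sign at s shows the side.\<close>
    define eqr where "eqr u y \<longleftrightarrow> s y < u y \<and> u y < t y \<and> ev A y (u y) = 0" for u y
    define ltr where "ltr u y \<longleftrightarrow> u y \<le> s y \<or>
      (s y < u y \<and> u y < t y \<and> 0 < ev A y (s y) * ev A y (u y))" for u y
    \<comment> \<open>Positivity of the remainder p at r: either r is a value of the cover, or r
      lies in a gap between u and w that contains no such value. In the gap p has constant sign,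
      which is read off at the midpoint; s and t act as outermost ends.\<close>
    define pos where "pos y \<longleftrightarrow> (\<exists>u\<in>set us. eqr u y \<and> 0 < ev p y (u y)) \<or>
      (\<exists>u\<in>set (s # us). \<exists>w\<in>set (t # us). ltr u y \<and> (\<not> ltr w y \<and> \<not> eqr w y) \<and>
        (\<forall>z\<in>set us. \<not> (u y < z y \<and> z y < w y)) \<and> 0 < ev p y ((u y + w y) * (1 / 2)))" for y
    have "{y. pos y} \<in> sgn_alg L"
      unfolding pos_def eqr_def ltr_def
      by (intro sgn_alg_intros R func_ring_intros stL ev_mem AL p(1); use usL stL in auto)
    \<comment> \<open>Outside P the root function has its default value 0.\<close>
    then have D: "{y. (P y \<and> pos y) \<or> (\<not> P y \<and> 0 < ev q y 0)} \<in> sgn_alg L"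
      using sgn_alg_mono[OF cond L(2)]
      by (intro sgn_alg_disj sgn_alg_conj sgn_alg_not sgn_alg_less R func_ring_intros ev_mem q) 
    have "0 < ev q y (r y) \<longleftrightarrow> pos y" if Py: "P y" for y
    proof -
      have r: "s y < r y" "r y < t y" "ev A y (r y) = 0"
        "\<And>x. s y < x \<Longrightarrow> x < t y \<Longrightarrow> ev A y x = 0 \<longleftrightarrow> x = r y"
        "\<And>x. s y < x \<Longrightarrow> x < t y \<Longrightarrow> 0 < ev A y (s y) * ev A y x \<longleftrightarrow> x < r y"
        using iso[OF Py] unfolding A_def by auto
      have eqr: "eqr u y \<longleftrightarrow> u y = r y" for u using r unfolding eqr_def by metis
      have ltr: "ltr u y \<longleftrightarrow> u y < r y" for u
        using r(1,2) r(5)[of "u y"] unfolding ltr_def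
        by (cases "u y \<le> s y"; cases "u y < t y") auto
      have "0 < ev p y (r y) \<longleftrightarrow> pos y"
      proof
        assume gt: "0 < ev p y (r y)"
        show "pos y"
        proof (cases "\<exists>u\<in>set us. u y = r y")
          case True
          then show ?thesis using gt unfolding pos_def eqr by metis
        next
          case False
          let ?S = "(\<lambda>u. u y) ` set (s # us)" and ?T = "(\<lambda>u. u y) ` set (t # us)"
          obtain u where u: "u \<in> set (s # us)" "u y < r y" "\<forall>z\<in>?S. \<not> (u y < z \<and> z < r y)"
            using nearest_below[of ?S "r y"] r(1) by auto
          obtain w where w: "w \<in> set (t # us)" "r y < w y" "\<forall>z\<in>?T. \<not> (r y < z \<and> z < w y)"
            using nearest_above[of ?T "r y"] r(2) by auto
          have no: "\<not> (u y < z y \<and> z y < w y)" if "z \<in> set us" for z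
            using u(3) w(3) False that by (cases "z y" "r y" rule: linorder_cases) auto
          have "sgn (ev p y (r y)) = sgn (ev p y ((u y + w y) * (1 / 2)))"
          proof (rule sgn_eq_if_no_root[where f = "ev p y"])
            fix z assume z: "min (r y) ((u y + w y) * (1 / 2)) \<le> z"
              "z \<le> max (r y) ((u y + w y) * (1 / 2))"
            then have "u y < z" "z < w y" using u(2) w(2) by (auto simp: min_def max_def split: if_splits)
            then show "ev p y z \<noteq> 0" using no us(2) gt unfolding root_cover_def
              by (metis less_irrefl)
          qed (rule isCont_ev)
          then have "0 < ev p y ((u y + w y) * (1 / 2))" using gt by (metis sgn_1_pos)
          then show ?thesis unfolding pos_def eqr ltr using u(1,2) w(1,2) no
            by (intro disjI2 bexI[of _ u] bexI[of _ w]) auto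
        qed
      next
        assume "pos y"
        then show "0 < ev p y (r y)"
          unfolding pos_def eqr ltr
        proof (elim disjE bexE conjE)
          fix u w assume uw: "u y < r y" "\<not> w y < r y" "w y \<noteq> r y"
            "\<forall>z\<in>set us. \<not> (u y < z y \<and> z y < w y)" and gt: "0 < ev p y ((u y + w y) * (1 / 2))"
          have "sgn (ev p y (r y)) = sgn (ev p y ((u y + w y) * (1 / 2)))"
          proof (rule sgn_eq_if_no_root[where f = "ev p y"])
            fix z assume z: "min (r y) ((u y + w y) * (1 / 2)) \<le> z"
              "z \<le> max (r y) ((u y + w y) * (1 / 2))"
            then have "u y < z" "z < w y" using uw by (auto simp: min_def max_def split: if_splits)
            then show "ev p y z \<noteq> 0" using uw us(2) gt unfolding root_cover_def
              by (metis less_irrefl)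
          qed (rule isCont_ev)
          then show "0 < ev p y (r y)" using gt by (metis sgn_1_pos)
        qed auto
      qed
      then show ?thesis using p(3)[OF r(3)] by simp
    qed
    then have "0 < ev q y (r y) \<longleftrightarrow> (P y \<and> pos y) \<or> (\<not> P y \<and> 0 < ev q y 0)" for y
      using nP[of y] by (cases "P y") auto
    then have "{y. 0 < ev q y (r y)} = {y. (P y \<and> pos y) \<or> (\<not> P y \<and> 0 < ev q y 0)}" by simp
    then show "{y. 0 < ev q y (r y)} \<in> sgn_alg L" using D by simp
  qed
qed

text \<open>Critical points come from the induction hypothesis; together with a root bound they cut
  the line into pieces with at most one root each. Since their order depends on y, a root function
  is formed for every pair (s, t) and is meaningful where no critical point lies in between and A
  changes sign.\<close>

lemma monic_root_cover:
  assumes K: "eff_closed K"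
    and IH: "\<And>L cs. eff_closed L \<Longrightarrow> K \<subseteq> L \<Longrightarrow> cs \<in> lists L \<Longrightarrow> length cs \<le> m \<Longrightarrow> \<exists>us\<in>lists L. root_cover cs us"
    and ms: "ms \<in> lists K" "length ms = m" "0 < m"
  shows "\<exists>us\<in>lists K. root_cover (ms @ [\<lambda>_. 1]) us"
proof -
  note R = eff_closed_ring[OF K]
  define A where "A = ms @ [\<lambda>_. 1 :: real]"
  have AK: "A \<in> lists K" using ms func_ring_const[OF R] by (simp add: A_def)
  obtain ds where ds: "ds \<in> lists K" "length ds = length A - 1"
    "\<And>y x. ((\<lambda>x. ev A y x) has_real_derivative ev ds y x) (at x)"
    using ev_deriv[OF R AK] by blast
  obtain ts where ts: "ts \<in> lists K" "root_cover ds ts"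
    using IH[OF K subset_refl ds(1)] ds(2) ms(2) by (auto simp: A_def)
  obtain b where b: "b \<in> K" "\<And>y x. b y \<le> \<bar>x\<bar> \<Longrightarrow> ev A y x \<noteq> 0"
    using monic_root_bound[OF R ms(1)] unfolding A_def by blast
  define ps where "ps = b # (\<lambda>y. - b y) # ts"
  have tsK: "u \<in> K" if "u \<in> set ts" for u using ts(1) that by auto
  have psK: "u \<in> K" if "u \<in> set ps" for u
    using that tsK b(1) func_ring_minus[OF R b(1)] by (auto simp: ps_def)
  \<comment> \<open>The cover of the derivative says nothing where the derivative vanishes
    identically. There A would be constant, but it has a root and is nonzero at the root
    bound.\<close>
  have crit: "\<exists>u\<in>set ts. u y = x" if root: "ev A y x0 = 0" and x: "ev ds y x = 0" for x x0 y
  proof -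
    have "\<exists>z. ev ds y z \<noteq> 0"
    proof (rule ccontr)
      assume "\<nexists>z. ev ds y z \<noteq> 0"
      then have "\<And>x. ((\<lambda>x. ev A y x) has_real_derivative 0) (at x)" using ds(3) by metis
      then have "ev A y \<bar>b y\<bar> = ev A y x0" using DERIV_isconst_all by metis
      then show False using b(2)[of y "\<bar>b y\<bar>"] root by simp
    qed
    then show ?thesis using ts(2) x unfolding root_cover_def by blast
  qed
  define P where "P s t y \<longleftrightarrow> s y < t y \<and> (\<forall>u\<in>set ts. \<not> (s y < u y \<and> u y < t y)) \<and>
    ev A y (s y) * ev A y (t y) < 0" for s t y
  define r where "r s t y = (if P s t y then (THE x. s y < x \<and> x < t y \<and> ev A y x = 0) else 0)" for s t y
  have root: "s y < r s t y \<and> r s t y < t y \<and> ev A y (r s t y) = 0 \<and>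
      (\<forall>x. s y < x \<longrightarrow> x < t y \<longrightarrow> (ev A y x = 0 \<longleftrightarrow> x = r s t y) \<and>
        (0 < ev A y (s y) * ev A y x \<longleftrightarrow> x < r s t y))" if Py: "P s t y" for s t y
  proof -
    have lt: "s y < t y" and sc: "ev A y (s y) * ev A y (t y) < 0"
      and no: "\<forall>u\<in>set ts. \<not> (s y < u y \<and> u y < t y)" using Py by (auto simp: P_def)
    obtain x0 where "ev A y x0 = 0" using sign_change_root[OF isCont_ev lt sc] by blast
    then have nz: "ev ds y x \<noteq> 0" if "s y < x" "x < t y" for x using crit no that by metis
    obtain \<rho> where \<rho>: "s y < \<rho>" "\<rho> < t y" "ev A y \<rho> = 0"
      "\<forall>x. s y < x \<longrightarrow> x < t y \<longrightarrow> (ev A y x = 0 \<longleftrightarrow> x = \<rho>) \<and>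
        (0 < ev A y (s y) * ev A y x \<longleftrightarrow> x < \<rho>)"
      using unique_root[OF ds(3) lt sc nz] by blast
    then have "r s t y = \<rho>" unfolding r_def using Py by (auto intro!: the_equality)
    then show ?thesis using \<rho> by auto
  qed
  have rK: "r s t \<in> K" if "s \<in> set ps" "t \<in> set ps" for s t
  proof (rule isolated_root_mem[OF K IH ms])
    show "s \<in> K" "t \<in> K" using psK that by auto
    then show "{y. P s t y} \<in> sgn_alg K"
      unfolding P_def by (intro sgn_alg_intros R func_ring_intros ev_mem AK; use tsK in auto)
    show "\<not> P s t y \<Longrightarrow> r s t y = 0" for y by (simp add: r_def)
  qed (use root in \<open>auto simp: A_def\<close>)
  define us where "us = ts @ concat (map (\<lambda>s. map (r s) ps) ps)"
  have "us \<in> lists K" using tsK rK by (auto simp: us_def lists_eq_set)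
  moreover have "root_cover A us"
    unfolding root_cover_def
  proof (intro allI impI)
    fix y x assume Ax: "ev A y x = 0"
    show "\<exists>u\<in>set us. u y = x"
    proof (cases "\<exists>u\<in>set ts. u y = x")
      case True
      then show ?thesis by (auto simp: us_def)
    next
      case False
      have bx: "\<bar>x\<bar> < b y" using b(2)[of y x] Ax by force
      let ?S = "(\<lambda>u. u y) ` set ps"
      obtain s where s: "s \<in> set ps" "s y < x" "\<forall>z\<in>?S. \<not> (s y < z \<and> z < x)"
      proof -
        have "- b y \<in> ?S" "- b y < x" using bx by (auto simp: ps_def)
        then have "\<exists>s\<in>?S. s < x" by blast
        from nearest_below[OF _ this] show ?thesis using that by blast
      qed
      obtain t where t: "t \<in> set ps" "x < t y" "\<forall>z\<in>?S. \<not> (x < z \<and> z < t y)"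
      proof -
        have "b y \<in> ?S" "x < b y" using bx by (auto simp: ps_def)
        then have "\<exists>s\<in>?S. x < s" by blast
        from nearest_above[OF _ this] show ?thesis using that by blast
      qed
      have no: "\<not> (s y < u y \<and> u y < t y)" if u: "u \<in> set ts" for u
      proof -
        have "u y \<in> ?S" "u y \<noteq> x" using u False by (auto simp: ps_def)
        then show ?thesis using s(3) t(3) by (cases "u y" x rule: linorder_cases) auto
      qed
      have nz: "ev ds y z \<noteq> 0" if z: "s y < z" "z < t y" for z
        using crit[OF Ax, of z] no z by auto
      have "P s t y" unfolding P_def
        using no s(2) t(2) simple_root_sign_change[OF ds(3) isCont_ev s(2) t(2) Ax nz] by auto
      then have "r s t y = x" using root[of s t y] s t Ax by metis
      then show ?thesis using s(1) t(1) by (auto simp: us_def)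
    qed
  qed
  ultimately show ?thesis unfolding A_def by blast
qed

text \<open>Induction on the number of coefficients. Where the leading coefficient vanishes, the
  shorter polynomial is covered by induction; elsewhere division makes the polynomial monic. The
  ring varies in the induction because the monic case calls the hypothesis over extensions.\<close>

lemma root_cover_exists:
  assumes "eff_closed K" "cs \<in> lists K"
  shows "\<exists>us\<in>lists K. root_cover cs us"
proof -
  have "\<exists>us\<in>lists K. root_cover cs us"
    if "eff_closed K" "cs \<in> lists K" "length cs \<le> Suc n" for n cs and K :: "('a \<Rightarrow> real) set"
    using that
  proof (induction n arbitrary: K cs)
    case 0
    then have "cs = [] \<or> (\<exists>c. cs = [c])" by (cases cs) auto
    then have "root_cover cs []" by (auto simp: root_cover_def)
    then show ?case by auto
  next
    case (Suc n)
    note R = eff_closed_ring[OF Suc.prems(1)]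
    show ?case
    proof (cases "length cs \<le> Suc n")
      case True
      then show ?thesis using Suc.IH[OF Suc.prems(1,2)] by simp
    next
      case False
      then have len: "length cs = Suc (Suc n)" using Suc.prems(3) by simp
      then obtain ds a where cs: "cs = ds @ [a]" by (metis Zero_not_Suc length_0_conv rev_exhaust)
      have ds: "ds \<in> lists K" "a \<in> K" "length ds = Suc n" using Suc.prems(2) cs len by auto
      obtain us where us: "us \<in> lists K" "root_cover ds us"
        using Suc.IH[OF Suc.prems(1) ds(1)] ds(3) by auto
      obtain ms where ms: "ms \<in> lists K" "length ms = length ds"
        "\<And>y x. ev ms y x = 1 / a y * ev ds y x"
        using ev_smult[OF R ds(1) eff_closed_inverse[OF Suc.prems(1) ds(2)]] by blast
      obtain vs where vs: "vs \<in> lists K" "root_cover (ms @ [\<lambda>_. 1]) vs"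
        using monic_root_cover[OF Suc.prems(1) Suc.IH ms(1)] ms(2) ds(3) by auto
      have "root_cover cs (us @ vs)"
        unfolding root_cover_def
      proof (intro allI impI)
        fix y x assume nz: "\<exists>z. ev cs y z \<noteq> 0" and x: "ev cs y x = 0"
        have csev: "ev cs y z = ev ds y z + z ^ length ds * a y" for z
          by (simp add: cs ev_append)
        show "\<exists>u\<in>set (us @ vs). u y = x"
        proof (cases "a y = 0")
          case True
          then show ?thesis using us(2) nz x csev by (auto simp: root_cover_def)
        next
          case False
          then have *: "ev (ms @ [\<lambda>_. 1]) y z = ev cs y z / a y" for z
            by (simp add: csev ev_append ms field_simps)
          have "\<exists>z. ev (ms @ [\<lambda>_. 1]) y z \<noteq> 0" "ev (ms @ [\<lambda>_. 1]) y x = 0"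
            using nz x False unfolding * by auto
          then show ?thesis using vs(2) unfolding root_cover_def by auto
        qed
      qed
      then show ?thesis using us(1) vs(1) by (intro bexI[of _ "us @ vs"]) auto
    qed
  qed
  from this[OF assms, of "length cs"] show ?thesis by simp
qed

section \<open>Elimination of one existential quantifier\<close>

definition poly_ring :: "('e \<Rightarrow> real) set \<Rightarrow> ('e \<times> real \<Rightarrow> real) set" where
  "poly_ring K = {\<lambda>p. ev cs (fst p) (snd p) | cs. cs \<in> lists K}"

lemma sgn_alg_poly_ring_section:
  assumes "func_ring K" "S \<in> sgn_alg (poly_ring K)" "h \<in> K"
  shows "{y. (y, h y) \<in> S} \<in> sgn_alg K"
  using assms(2)
proof induction
  case (sgn_alg_pos f)
  then obtain cs where "cs \<in> lists K" "f = (\<lambda>p. ev cs (fst p) (snd p))"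
    by (auto simp: poly_ring_def)
  then show ?case using sgn_alg.sgn_alg_pos[OF ev_mem[OF assms(1) _ assms(3)]] by simp
next
  case (sgn_alg_Un A B)
  then show ?case using sgn_alg_disj by simp
next
  case (sgn_alg_Compl A)
  then show ?case using sgn_alg_not by simp
qed

lemma sgn_alg_poly_ring_signs:
  assumes "S \<in> sgn_alg (poly_ring K)"
  shows "\<exists>qs. set qs \<subseteq> lists K \<and> (\<forall>y x x'. (\<forall>q\<in>set qs. sgn (ev q y x) = sgn (ev q y x')) \<longrightarrow>
    (y, x) \<in> S \<longrightarrow> (y, x') \<in> S)"
proof -
  \<comment> \<open>Stated as an equivalence, so that the case of complements is immediate.\<close>
  have "\<exists>qs. set qs \<subseteq> lists K \<and> (\<forall>y x x'. (\<forall>q\<in>set qs. sgn (ev q y x) = sgn (ev q y x')) \<longrightarrow>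
    ((y, x) \<in> S \<longleftrightarrow> (y, x') \<in> S))"
    using assms
  proof induction
    case (sgn_alg_pos f)
    then obtain cs where "cs \<in> lists K" "f = (\<lambda>p. ev cs (fst p) (snd p))"
      by (auto simp: poly_ring_def)
    then show ?case by (intro exI[of _ "[cs]"]) (auto simp: sgn_if split: if_splits)
  next
    case (sgn_alg_Un A B)
    then obtain qs rs where "set qs \<subseteq> lists K" "\<forall>y x x'. (\<forall>q\<in>set qs. sgn (ev q y x) = sgn (ev q y x')) \<longrightarrow>
      ((y, x) \<in> A \<longleftrightarrow> (y, x') \<in> A)" "set rs \<subseteq> lists K"
      "\<forall>y x x'. (\<forall>q\<in>set rs. sgn (ev q y x) = sgn (ev q y x')) \<longrightarrow> ((y, x) \<in> B \<longleftrightarrow> (y, x') \<in> B)"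
      by blast
    then show ?case by (intro exI[of _ "qs @ rs"]) (simp add: ball_Un, blast)
  next
    case (sgn_alg_Compl A)
    then show ?case by simp
  qed
  then show ?thesis by blast
qed

text \<open>One test point in each component of the complement of S: midpoints for bounded gaps, u +
  1 and u - 1 for the unbounded ones, 0 if S is empty. Taking all pairs avoids sorting S.\<close>

lemma sample_point:
  fixes x :: real
  assumes "finite S" "x \<notin> S"
  shows "\<exists>s\<in>{0} \<union> (\<lambda>u. u + 1) ` S \<union> (\<lambda>u. u - 1) ` S \<union> (\<lambda>(u, w). (u + w) * (1 / 2)) ` (S \<times> S).
    \<forall>z. min x s \<le> z \<longrightarrow> z \<le> max x s \<longrightarrow> z \<notin> S"
proof -
  have B: "\<exists>u\<in>S. u < x \<and> (\<forall>z\<in>S. \<not> (u < z \<and> z < x))" if "\<exists>u\<in>S. u < x"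
    using nearest_below[OF assms(1) that] .
  have T: "\<exists>w\<in>S. x < w \<and> (\<forall>z\<in>S. \<not> (x < z \<and> z < w))" if "\<exists>w\<in>S. x < w"
    using nearest_above[OF assms(1) that] .
  have tri: "z < x \<or> x < z" if "z \<in> S" for z using that assms(2) by (metis linorder_less_linear)
  consider "\<exists>u\<in>S. u < x" "\<exists>w\<in>S. x < w" | "\<exists>u\<in>S. u < x" "\<not> (\<exists>w\<in>S. x < w)"
    | "\<not> (\<exists>u\<in>S. u < x)" "\<exists>w\<in>S. x < w" | "S = {}" using tri by blast
  then show ?thesis
  proof cases
    case 1
    then obtain u w where uw: "u \<in> S" "w \<in> S" "u < x" "x < w"
      "\<forall>z\<in>S. \<not> (u < z \<and> z < x)" "\<forall>z\<in>S. \<not> (x < z \<and> z < w)"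
      using B T by blast
    have "z \<notin> S" if "min x ((u + w) * (1 / 2)) \<le> z" "z \<le> max x ((u + w) * (1 / 2))" for z
    proof
      assume "z \<in> S"
      moreover have "u < z" "z < w" using that uw(3,4) by (auto simp: min_def max_def split: if_splits)
      ultimately show False using uw(5,6) tri by blast
    qed
    then show ?thesis using uw(1,2)
      by (intro bexI[of _ "(u + w) * (1 / 2)"] allI impI UnI2 image_eqI[of _ _ "(u, w)"]) auto
  next
    case 2
    then obtain u where u: "u \<in> S" "u < x" "\<forall>z\<in>S. \<not> (u < z \<and> z < x)" using B by blast
    have "z \<notin> S" if "min x (u + 1) \<le> z" "z \<le> max x (u + 1)" for z
    proof
      assume "z \<in> S"
      moreover have "u < z" using that u(2) by (auto simp: min_def split: if_splits)
      ultimately show False using u(3) 2(2) tri by blast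
    qed
    then show ?thesis using u(1) by (intro bexI[of _ "u + 1"]) auto
  next
    case 3
    then obtain w where w: "w \<in> S" "x < w" "\<forall>z\<in>S. \<not> (x < z \<and> z < w)" using T by blast
    have "z \<notin> S" if "min x (w - 1) \<le> z" "z \<le> max x (w - 1)" for z
    proof
      assume "z \<in> S"
      moreover have "z < w" using that w(2) by (auto simp: max_def split: if_splits)
      ultimately show False using w(3) 3(1) tri by blast
    qed
    then show ?thesis using w(1) by (intro bexI[of _ "w - 1"]) auto
  next
    case 4
    then show ?thesis by auto
  qed
qed

text \<open>The signs of finitely many polynomials change only at covered roots, so a suitable x
  exists iff one of finitely many sample functions of y is suitable. These belong to the closed ring
  K, and substituting them yields sign sets over K.\<close>

lemma sgn_alg_exists:
  assumes K: "eff_closed K" and S: "S \<in> sgn_alg (poly_ring K)"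
  shows "{y. \<exists>x. (y, x) \<in> S} \<in> sgn_alg K"
proof -
  note R = eff_closed_ring[OF K]
  obtain qs where qs: "set qs \<subseteq> lists K"
    "\<And>y x x'. (\<forall>q\<in>set qs. sgn (ev q y x) = sgn (ev q y x')) \<Longrightarrow> (y, x) \<in> S \<Longrightarrow> (y, x') \<in> S"
    using sgn_alg_poly_ring_signs[OF S] by blast
  have "\<forall>q\<in>set qs. \<exists>us. us \<in> lists K \<and> root_cover q us"
    using root_cover_exists[OF K] qs(1) by blast
  then obtain c where c: "\<And>q. q \<in> set qs \<Longrightarrow> c q \<in> lists K \<and> root_cover q (c q)" by metis
  define us where "us = concat (map c qs)"
  have usK: "u \<in> K" if "u \<in> set us" for u using that c by (auto simp: us_def lists_eq_set)
  define ss where "ss = (\<lambda>_. 0) # us @ map (\<lambda>u y. u y + 1) us @ map (\<lambda>u y. u y - 1) us @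
    map (\<lambda>(u, w) y. (u y + w y) * (1 / 2)) (List.product us us)"
  have ssK: "s \<in> K" if "s \<in> set ss" for s
  proof -
    have "(\<lambda>_. 0) \<in> K" "\<And>u. u \<in> K \<Longrightarrow> (\<lambda>y. u y + 1) \<in> K" "\<And>u. u \<in> K \<Longrightarrow> (\<lambda>y. u y - 1) \<in> K"
      "\<And>u w. u \<in> K \<Longrightarrow> w \<in> K \<Longrightarrow> (\<lambda>y. (u y + w y) * (1 / 2)) \<in> K"
      by (intro func_ring_intros R; assumption)+
    then show ?thesis using that usK unfolding ss_def by auto
  qed
  have "\<exists>s\<in>set ss. (y, s y) \<in> S" if yx: "(y, x) \<in> S" for y x
  proof (cases "\<exists>u\<in>set us. u y = x")
    case True
    then show ?thesis using yx by (auto simp: ss_def)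
  next
    case False
    let ?T = "(\<lambda>u. u y) ` set us"
    have "\<exists>s\<in>{0} \<union> (\<lambda>u. u + 1) ` ?T \<union> (\<lambda>u. u - 1) ` ?T \<union> (\<lambda>(u, w). (u + w) * (1 / 2)) ` (?T \<times> ?T).
      \<forall>z. min x s \<le> z \<longrightarrow> z \<le> max x s \<longrightarrow> z \<notin> ?T"
      using False by (intro sample_point) auto
    then obtain t where t: "t \<in> {0} \<union> (\<lambda>u. u + 1) ` ?T \<union> (\<lambda>u. u - 1) ` ?T \<union> (\<lambda>(u, w). (u + w) * (1 / 2)) ` (?T \<times> ?T)"
      "\<forall>z. min x t \<le> z \<longrightarrow> z \<le> max x t \<longrightarrow> z \<notin> ?T" by (rule bexE)
    have "\<exists>s\<in>set ss. s y = t"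
      using t(1)
    proof (elim UnE)
      assume "t \<in> {0}"
      then show ?thesis by (intro bexI[of _ "\<lambda>_. 0"]) (simp_all add: ss_def)
    next
      assume "t \<in> (\<lambda>u. u + 1) ` ?T"
      then obtain u where "u \<in> set us" "t = u y + 1" by blast
      then show ?thesis by (intro bexI[of _ "\<lambda>y. u y + 1"]) (simp_all add: ss_def)
    next
      assume "t \<in> (\<lambda>u. u - 1) ` ?T"
      then obtain u where "u \<in> set us" "t = u y - 1" by blast
      then show ?thesis by (intro bexI[of _ "\<lambda>y. u y - 1"]) (simp_all add: ss_def)
    next
      assume "t \<in> (\<lambda>(u, w). (u + w) * (1 / 2)) ` (?T \<times> ?T)"
      then obtain u w where uw: "u \<in> set us" "w \<in> set us" "t = (u y + w y) * (1 / 2)" by auto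
      then have "(u, w) \<in> set (List.product us us)" by simp
      then have "(\<lambda>(u, w) y. (u y + w y) * (1 / 2)) (u, w) \<in>
          (\<lambda>(u, w) y. (u y + w y) * (1 / 2)) ` set (List.product us us)" by (rule imageI)
      then have "(\<lambda>y. (u y + w y) * (1 / 2)) \<in> set ss"
        unfolding ss_def set_append set_map list.set by simp
      then show ?thesis unfolding uw(3) by (rule bexI[rotated]) (rule refl)
    qed
    then obtain s where s: "s \<in> set ss" "s y = t" by blast
    have "sgn (ev q y x) = sgn (ev q y t)" if q: "q \<in> set qs" for q
    proof (cases "\<exists>z. ev q y z \<noteq> 0")
      case True
      show ?thesis
      proof (rule sgn_eq_if_no_root[where f = "ev q y"])
        fix z assume "min x t \<le> z" "z \<le> max x t"
        then have "z \<notin> ?T" by (rule t(2)[rule_format])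
        then have "\<not> (\<exists>u\<in>set (c q). u y = z)" using q by (auto simp: us_def)
        then show "ev q y z \<noteq> 0" using c[OF q] True unfolding root_cover_def by blast
      qed (rule isCont_ev)
    qed auto
    then show ?thesis using qs(2)[OF _ yx] s by blast
  qed
  then have "{y. \<exists>x. (y, x) \<in> S} = {y. \<exists>s\<in>set ss. (y, s y) \<in> S}" by blast
  also have "\<dots> \<in> sgn_alg K"
    by (intro sgn_alg_bex R sgn_alg_poly_ring_section S ssK)
  finally show ?thesis .
qed

section \<open>From polynomial functions to semialgebraic sets\<close>

lemma polyfun_ring: "func_ring (polyfun N)"
  by (auto simp: func_ring_def intro: polyfun.intros)

lemma polyfun_Suc_ev:
  assumes "p \<in> polyfun (Suc N)"
  shows "\<exists>cs\<in>lists (polyfun N). \<forall>y x. p (y(N := x)) = ev cs y x"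
  using assms
proof induction
  case (pf_const c)
  show ?case by (intro bexI[of _ "[\<lambda>_. c]"]) (auto intro: polyfun.intros)
next
  case (pf_var i)
  show ?case
  proof (cases "i = N")
    case True
    then show ?thesis by (intro bexI[of _ "[\<lambda>_. 0, \<lambda>_. 1]"]) (auto intro: polyfun.intros)
  next
    case False
    then show ?thesis using pf_var by (intro bexI[of _ "[\<lambda>x. x i]"]) (auto intro: polyfun.intros)
  qed
next
  case (pf_add p q)
  then obtain cs ds where cs: "cs \<in> lists (polyfun N)" "\<forall>y x. p (y(N := x)) = ev cs y x"
    and ds: "ds \<in> lists (polyfun N)" "\<forall>y x. q (y(N := x)) = ev ds y x" by blast
  obtain es where "es \<in> lists (polyfun N)" "\<forall>y x. ev es y x = ev cs y x + ev ds y x"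
    using ev_add[OF polyfun_ring cs(1) ds(1)] by blast
  then show ?case using cs ds by (intro bexI[of _ es]) (simp_all del: fun_upd_apply)
next
  case (pf_mult p q)
  then obtain cs ds where cs: "cs \<in> lists (polyfun N)" "\<forall>y x. p (y(N := x)) = ev cs y x"
    and ds: "ds \<in> lists (polyfun N)" "\<forall>y x. q (y(N := x)) = ev ds y x" by blast
  obtain es where "es \<in> lists (polyfun N)" "\<forall>y x. ev es y x = ev cs y x * ev ds y x"
    using ev_mult[OF polyfun_ring cs(1) ds(1)] by blast
  then show ?case using cs ds by (intro bexI[of _ es]) (simp_all del: fun_upd_apply)
qed

lemma semialgebraic_sgn_alg:
  assumes "semialgebraic (Suc N) A"
  shows "\<exists>S\<in>sgn_alg (poly_ring (polyfun N)). \<forall>y\<in>euclid N. \<forall>x. y(N := x) \<in> A \<longleftrightarrow> (y, x) \<in> S"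
  using assms
proof induction
  have pos: "{p. 0 < ev cs (fst p) (snd p)} \<in> sgn_alg (poly_ring (polyfun N))"
    if "cs \<in> lists (polyfun N)" for cs
    using that by (intro sgn_alg_pos) (auto simp: poly_ring_def)
  have eu: "y(N := x) \<in> euclid (Suc N)" if "y \<in> euclid N" for y x using that by (auto simp: euclid_def)
  {
    case (sa_pos p)
    then obtain cs where "cs \<in> lists (polyfun N)" "\<forall>y x. p (y(N := x)) = ev cs y x"
      using polyfun_Suc_ev by blast
    then show ?case
      by (intro bexI[OF _ pos] ballI allI) (simp_all add: eu del: fun_upd_apply)
  next
    case (sa_zero p)
    then obtain cs where cs: "cs \<in> lists (polyfun N)" "\<forall>y x. p (y(N := x)) = ev cs y x"
      using polyfun_Suc_ev by blast
    obtain ds where ds: "ds \<in> lists (polyfun N)" "\<forall>y x. ev ds y x = -1 * ev cs y x"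
      using ev_smult[OF polyfun_ring cs(1) pf_const[of "-1"]] by blast
    \<comment> \<open>Sign sets are generated by strict positivity, so a zero is described as the
      absence of both strict signs.\<close>
    have "{p. \<not> (0 < ev cs (fst p) (snd p) \<or> 0 < ev ds (fst p) (snd p))} \<in> sgn_alg (poly_ring (polyfun N))"
      by (intro sgn_alg_not sgn_alg_disj pos cs ds)
    then show ?case
      by (rule bexI[rotated], intro ballI allI) (simp add: eu cs(2) ds(2) not_less order_eq_iff conj_commute del: fun_upd_apply)
  next
    case (sa_union A B)
    then obtain S T where "S\<in>sgn_alg (poly_ring (polyfun N))" "\<forall>y\<in>euclid N. \<forall>x. y(N := x) \<in> A \<longleftrightarrow> (y, x) \<in> S"
      "T\<in>sgn_alg (poly_ring (polyfun N))" "\<forall>y\<in>euclid N. \<forall>x. y(N := x) \<in> B \<longleftrightarrow> (y, x) \<in> T" by blast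
    then show ?case by (intro bexI[of _ "S \<union> T"] sgn_alg_Un) (simp_all del: fun_upd_apply)
  next
    case (sa_compl A)
    then obtain S where "S\<in>sgn_alg (poly_ring (polyfun N))" "\<forall>y\<in>euclid N. \<forall>x. y(N := x) \<in> A \<longleftrightarrow> (y, x) \<in> S"
      by blast
    then show ?case by (intro bexI[of _ "- S"] sgn_alg_Compl) (simp_all add: eu del: fun_upd_apply)
  }
qed

lemma sgn_alg_semialgebraic:
  assumes "A \<in> sgn_alg (polyfun N)" shows "semialgebraic N (euclid N \<inter> A)"
  using assms
proof induction
  case (sgn_alg_pos f)
  then show ?case using sa_pos[of f N] by (simp add: Collect_conj_eq)
next
  case (sgn_alg_Un A B)
  then show ?case using sa_union by (simp add: Int_Un_distrib)
next
  case (sgn_alg_Compl A)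
  moreover have "euclid N \<inter> - A = euclid N - (euclid N \<inter> A)" by auto
  ultimately show ?case using sa_compl by simp
qed

text \<open>Roots are not polynomial in the coefficients, so the quantifier is eliminated over the
  effective hull, whose sign sets are again those of the polynomials.\<close>

theorem tarski_seidenberg:
  assumes "semialgebraic (Suc N) A"
  shows "semialgebraic N {y\<in>euclid N. \<exists>x. y(N := x) \<in> A}"
proof -
  obtain S where S: "S \<in> sgn_alg (poly_ring (polyfun N))"
    "\<forall>y\<in>euclid N. \<forall>x. y(N := x) \<in> A \<longleftrightarrow> (y, x) \<in> S"
    using semialgebraic_sgn_alg[OF assms] by blast
  let ?K = "eff_hull (polyfun N)"
  have "poly_ring (polyfun N) \<subseteq> poly_ring ?K"
    using subset_eff_hull[of "polyfun N"] by (force simp: poly_ring_def lists_eq_set)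
  then have "S \<in> sgn_alg (poly_ring ?K)" using sgn_alg_mono[OF S(1)] by blast
  from sgn_alg_exists[OF eff_closed_eff_hull[OF polyfun_ring] this]
  have "{y. \<exists>x. (y, x) \<in> S} \<in> sgn_alg (polyfun N)"
    using sgn_alg_eff_hull[OF polyfun_ring[of N]] by simp
  from sgn_alg_semialgebraic[OF this]
  have "semialgebraic N (euclid N \<inter> {y. \<exists>x. (y, x) \<in> S})" .
  also have "euclid N \<inter> {y. \<exists>x. (y, x) \<in> S} = {y\<in>euclid N. \<exists>x. y(N := x) \<in> A}" using S(2) by blast
  finally show ?thesis .
qed

section \<open>Linear algebra and submersions\<close>

text \<open>V indexes points and D functions on them. This and \<open>surj_matrix\<close> mean that
  the functions are independent, respectively spanning, on V; no notion of rank or dimension is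
  involved.\<close>

definition inj_matrix :: "'v set \<Rightarrow> 'd set \<Rightarrow> ('v \<Rightarrow> 'd \<Rightarrow> real) \<Rightarrow> bool" where
  "inj_matrix V D M \<longleftrightarrow> (\<forall>c. (\<forall>v\<in>V. (\<Sum>j\<in>D. c j * M v j) = 0) \<longrightarrow> (\<forall>j\<in>D. c j = 0))"

definition surj_matrix :: "'v set \<Rightarrow> 'd set \<Rightarrow> ('v \<Rightarrow> 'd \<Rightarrow> real) \<Rightarrow> bool" where
  "surj_matrix V D M \<longleftrightarrow> (\<forall>g. \<exists>x. \<forall>v\<in>V. (\<Sum>j\<in>D. x j * M v j) = g v)"

lemma inj_matrix_insert:
  assumes "finite D" "k \<notin> D" "inj_matrix V (insert k D) M"
  shows "inj_matrix V D M" and "\<exists>v\<in>V. M v k \<noteq> (\<Sum>j\<in>D. x j * M v j)"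
proof -
  show "inj_matrix V D M"
    unfolding inj_matrix_def
  proof (intro allI impI)
    fix c assume c: "\<forall>v\<in>V. (\<Sum>j\<in>D. c j * M v j) = 0"
    have "(\<Sum>j\<in>insert k D. (c(k := 0)) j * M v j) = (\<Sum>j\<in>D. c j * M v j)" for v
      using assms(1,2) by (auto intro!: sum.cong)
    then have "\<forall>j\<in>insert k D. (c(k := 0)) j = 0"
      using assms(3) c unfolding inj_matrix_def by metis
    then show "\<forall>j\<in>D. c j = 0" using assms(2) by (metis fun_upd_other insertI2)
  qed
  show "\<exists>v\<in>V. M v k \<noteq> (\<Sum>j\<in>D. x j * M v j)"
  proof (rule ccontr)
    assume "\<not> ?thesis"
    then have eq: "M v k = (\<Sum>j\<in>D. x j * M v j)" if "v \<in> V" for v using that by blast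
    have "(\<Sum>j\<in>insert k D. (x(k := -1)) j * M v j) = - M v k + (\<Sum>j\<in>D. x j * M v j)" for v
      using assms(1,2) by (auto intro!: sum.cong)
    then have "\<forall>v\<in>V. (\<Sum>j\<in>insert k D. (x(k := -1)) j * M v j) = 0" using eq by simp
    then have "(x(k := -1)) k = 0" using assms(3) unfolding inj_matrix_def by blast
    then show False by simp
  qed
qed

text \<open>Row rank equals column rank. The new column minus the combination of old ones that
  agrees with it on I vanishes on I, but not at some v. This v becomes the new row, and multiples of
  the residual correct the value at v without disturbing I.\<close>

lemma inj_matrix_rows:
  assumes "finite D" "finite V" "inj_matrix V D M"
  shows "\<exists>I\<subseteq>V. card I = card D \<and> surj_matrix I D M"
  using assms(1,3)
proof (induction D)
  case empty
  show ?case by (intro exI[of _ "{}"]) (auto simp: surj_matrix_def)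
next
  case (insert k D)
  note ins = inj_matrix_insert[OF insert.hyps(1,2) insert.prems]
  obtain I where I: "I \<subseteq> V" "card I = card D" "surj_matrix I D M" using insert.IH[OF ins(1)] by blast
  obtain x where x: "\<And>i. i \<in> I \<Longrightarrow> (\<Sum>j\<in>D. x j * M i j) = M i k"
    using I(3)[unfolded surj_matrix_def, rule_format, of "\<lambda>i. M i k"] by blast
  obtain v where v: "v \<in> V" "M v k \<noteq> (\<Sum>j\<in>D. x j * M v j)" using ins(2) by blast
  define r where "r w = M w k - (\<Sum>j\<in>D. x j * M w j)" for w
  have rI: "r i = 0" if "i \<in> I" for i using x[OF that] by (simp add: r_def)
  have rv: "r v \<noteq> 0" using v by (simp add: r_def)
  have vI: "v \<notin> I" using rI rv by blast
  have "surj_matrix (insert v I) (insert k D) M"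
    unfolding surj_matrix_def
  proof
    fix g
    obtain w where w: "\<And>i. i \<in> I \<Longrightarrow> (\<Sum>j\<in>D. w j * M i j) = g i"
      using I(3)[unfolded surj_matrix_def, rule_format, of g] by blast
    define t where "t = (g v - (\<Sum>j\<in>D. w j * M v j)) / r v"
    define c where "c j = (if j = k then t else w j - t * x j)" for j
    have c: "(\<Sum>j\<in>insert k D. c j * M u j) = (\<Sum>j\<in>D. w j * M u j) + t * r u" for u
    proof -
      have "(\<Sum>j\<in>insert k D. c j * M u j) = t * M u k + (\<Sum>j\<in>D. c j * M u j)"
        using insert.hyps by (simp add: c_def)
      also have "(\<Sum>j\<in>D. c j * M u j) = (\<Sum>j\<in>D. w j * M u j - t * (x j * M u j))"
        using insert.hyps(2) by (intro sum.cong) (auto simp: c_def algebra_simps)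
      finally show ?thesis
        by (simp add: r_def sum_subtractf sum_distrib_left[symmetric] algebra_simps)
    qed
    have "(\<Sum>j\<in>insert k D. c j * M u j) = g u" if "u \<in> insert v I" for u
      using that unfolding c by (auto simp: rI w t_def rv)
    then show "\<exists>x. \<forall>v\<in>insert v I. (\<Sum>j\<in>insert k D. x j * M v j) = g v" by blast
  qed
  moreover have "card (insert v I) = card (insert k D)"
    using vI I(2) insert.hyps finite_subset[OF I(1) assms(2)] by simp
  ultimately show ?case using I(1) v(1) by (intro exI[of _ "insert v I"]) auto
qed

lemma inj_matrix_left_inverse:
  assumes "finite D" "finite V" "inj_matrix V D M"
  shows "\<exists>L. \<forall>j\<in>D. \<forall>k\<in>D. (\<Sum>v\<in>V. L j v * M v k) = (if j = k then 1 else 0)"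
  using assms(1,3)
proof (induction D)
  case empty
  show ?case by auto
next
  case (insert k D)
  note ins = inj_matrix_insert[OF insert.hyps(1,2) insert.prems]
  obtain L where L: "\<And>j l. j \<in> D \<Longrightarrow> l \<in> D \<Longrightarrow> (\<Sum>v\<in>V. L j v * M v l) = (if j = l then 1 else 0)"
    using insert.IH[OF ins(1)] by blast
  define x where "x j = (\<Sum>v\<in>V. L j v * M v k)" for j
  obtain v where v: "v \<in> V" "M v k \<noteq> (\<Sum>j\<in>D. x j * M v j)" using ins(2) by blast
  define r where "r = M v k - (\<Sum>j\<in>D. x j * M v j)"
  have r: "r \<noteq> 0" using v by (simp add: r_def)
  \<comment> \<open>T evaluates at v and removes the part seen by the old left inverse: it kills the
    old columns and, after division by r, takes the value 1 on the new one.\<close>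
  define T where "T w = ((if w = v then 1 else 0) - (\<Sum>j\<in>D. M v j * L j w)) / r" for w
  have T: "(\<Sum>w\<in>V. T w * M w l) = (M v l - (\<Sum>j\<in>D. M v j * (\<Sum>w\<in>V. L j w * M w l))) / r" for l
  proof -
    have "(\<Sum>w\<in>V. T w * M w l) = (\<Sum>w\<in>V. (if w = v then M w l else 0) - (\<Sum>j\<in>D. M v j * (L j w * M w l))) / r"
      unfolding T_def sum_divide_distrib
      by (intro sum.cong) (auto simp: algebra_simps sum_distrib_left diff_divide_distrib sum_divide_distrib)
    also have "(\<Sum>w\<in>V. (if w = v then M w l else 0) - (\<Sum>j\<in>D. M v j * (L j w * M w l))) =
        M v l - (\<Sum>w\<in>V. \<Sum>j\<in>D. M v j * (L j w * M w l))"
      using v(1) assms(2) by (simp add: sum_subtractf)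
    also have "(\<Sum>w\<in>V. \<Sum>j\<in>D. M v j * (L j w * M w l)) = (\<Sum>j\<in>D. M v j * (\<Sum>w\<in>V. L j w * M w l))"
      by (subst sum.swap) (simp add: sum_distrib_left)
    finally show ?thesis .
  qed
  have Tk: "(\<Sum>w\<in>V. T w * M w k) = 1"
    unfolding T using r by (simp add: x_def[symmetric] r_def mult.commute)
  have TD: "(\<Sum>w\<in>V. T w * M w l) = 0" if "l \<in> D" for l
  proof -
    have "(\<Sum>j\<in>D. M v j * (\<Sum>w\<in>V. L j w * M w l)) = (\<Sum>j\<in>D. if j = l then M v j else 0)"
      using L that by (intro sum.cong) auto
    then show ?thesis unfolding T using that insert.hyps(1) by simp
  qed
  define L' where "L' j w = (if j = k then T w else L j w - x j * T w)" for j w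
  have L'D: "(\<Sum>w\<in>V. L' j w * M w l) = (\<Sum>w\<in>V. L j w * M w l) - x j * (\<Sum>w\<in>V. T w * M w l)"
    if "j \<in> D" for j l
  proof -
    have "(\<Sum>w\<in>V. L' j w * M w l) = (\<Sum>w\<in>V. L j w * M w l - x j * (T w * M w l))"
      using that insert.hyps(2) by (intro sum.cong) (auto simp: L'_def algebra_simps)
    then show ?thesis by (simp add: sum_subtractf sum_distrib_left)
  qed
  have "(\<Sum>w\<in>V. L' j w * M w l) = (if j = l then 1 else 0)" if "j \<in> insert k D" "l \<in> insert k D" for j l
  proof (cases "j = k")
    case True
    then have "(\<Sum>w\<in>V. L' j w * M w l) = (\<Sum>w\<in>V. T w * M w l)" by (simp add: L'_def)
    then show ?thesis using True that(2) Tk TD insert.hyps(2) by auto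
  next
    case False
    then have j: "j \<in> D" using that by auto
    show ?thesis
    proof (cases "l = k")
      case True
      then show ?thesis using False unfolding L'D[OF j] by (simp add: Tk x_def)
    next
      case False
      then show ?thesis using that(2) unfolding L'D[OF j] by (simp add: TD L j)
    qed
  qed
  then show ?case by blast
qed

lemma wide_matrix_kernel:
  fixes M :: "'v \<Rightarrow> 'd \<Rightarrow> real"
  assumes "finite D" "finite V" "card V < card D"
  shows "\<exists>c. (\<exists>j\<in>D. c j \<noteq> 0) \<and> (\<forall>v\<in>V. (\<Sum>j\<in>D. c j * M v j) = 0)"
proof -
  have "\<not> inj_matrix V D M"
    using inj_matrix_rows[OF assms(1,2)] assms(3) card_mono[OF assms(2)] by (metis not_less)
  then show ?thesis unfolding inj_matrix_def by blast
qed

text \<open>Diagonal dominance: each row deviates from the identity by at most 1/2 in total, so the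
  largest coordinate of a kernel vector would be at most half of itself.\<close>

lemma near_identity_inj:
  fixes E :: "'d \<Rightarrow> 'd \<Rightarrow> real"
  assumes "finite D" "\<And>i j. i \<in> D \<Longrightarrow> j \<in> D \<Longrightarrow> \<bar>E i j - (if i = j then 1 else 0)\<bar> * (2 * card D) \<le> 1"
  shows "inj_matrix D D E"
  unfolding inj_matrix_def
proof (intro allI impI)
  fix c assume c: "\<forall>i\<in>D. (\<Sum>j\<in>D. c j * E i j) = 0"
  show "\<forall>j\<in>D. c j = 0"
  proof (cases "D = {}")
    case False
    then have card: "0 < card D" using assms(1) by (simp add: card_gt_0_iff)
    define m where "m = Max ((\<lambda>j. \<bar>c j\<bar>) ` D)"
    have m: "\<bar>c j\<bar> \<le> m" if "j \<in> D" for j using assms(1) that by (simp add: m_def)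
    have "m \<in> (\<lambda>j. \<bar>c j\<bar>) ` D" unfolding m_def using False assms(1) by (intro Max_in) auto
    then obtain i where i: "i \<in> D" "m = \<bar>c i\<bar>" by blast
    have "c i = (\<Sum>j\<in>D. if j = i then c j else 0)" using assms(1) i by simp
    also have "\<dots> = (\<Sum>j\<in>D. c j * E i j - c j * (E i j - (if i = j then 1 else 0)))"
      by (intro sum.cong) (auto simp: algebra_simps)
    also have "\<dots> = - (\<Sum>j\<in>D. c j * (E i j - (if i = j then 1 else 0)))"
      using c i by (simp add: sum_subtractf)
    finally have "m = \<bar>\<Sum>j\<in>D. c j * (E i j - (if i = j then 1 else 0))\<bar>" using i by simp
    also have "\<dots> \<le> (\<Sum>j\<in>D. \<bar>c j * (E i j - (if i = j then 1 else 0))\<bar>)" by (rule sum_abs)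
    also have "\<dots> \<le> (\<Sum>j\<in>D. m * (1 / (2 * card D)))"
    proof (rule sum_mono)
      fix j assume j: "j \<in> D"
      have "\<bar>E i j - (if i = j then 1 else 0)\<bar> \<le> 1 / (2 * card D)"
        using assms(2)[OF i(1) j] card by (simp add: field_simps)
      then show "\<bar>c j * (E i j - (if i = j then 1 else 0))\<bar> \<le> m * (1 / (2 * card D))"
        unfolding abs_mult using m[OF j] by (intro mult_mono) auto
    qed
    also have "\<dots> = m / 2" using card by simp
    finally have "m \<le> 0" by simp
    then show ?thesis using m by fastforce
  qed auto
qed

lemma near_identity_eventually_inj:
  fixes E :: "nat \<Rightarrow> 'd \<Rightarrow> 'd \<Rightarrow> real"
  assumes D: "finite D"
    and lim: "\<And>i j. i \<in> D \<Longrightarrow> j \<in> D \<Longrightarrow> (\<lambda>t. E t i j) \<longlonglongrightarrow> (if i = j then 1 else 0)"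
  shows "eventually (\<lambda>t. inj_matrix D D (E t)) sequentially"
proof -
  have "eventually (\<lambda>t. \<bar>E t i j - (if i = j then 1 else 0)\<bar> * (2 * card D) \<le> 1) sequentially"
    if ij: "i \<in> D" "j \<in> D" for i j
  proof -
    have "(\<lambda>t. \<bar>E t i j - (if i = j then 1 else 0)\<bar> * (2 * card D)) \<longlonglongrightarrow>
      \<bar>(if i = j then 1 else 0) - (if i = j then 1 else 0 :: real)\<bar> * (2 * card D)"
      by (intro tendsto_intros lim ij)
    then have "eventually (\<lambda>t. \<bar>E t i j - (if i = j then 1 else 0)\<bar> * (2 * card D) < 1) sequentially"
      by (intro order_tendstoD(2)) auto
    then show ?thesis by eventually_elim simp
  qed
  then have "eventually (\<lambda>t. \<forall>i\<in>D. \<forall>j\<in>D. \<bar>E t i j - (if i = j then 1 else 0)\<bar> * (2 * card D) \<le> 1) sequentially"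
    using D by (simp add: eventually_ball_finite)
  then show ?thesis
  proof eventually_elim
    case (elim t)
    show ?case by (rule near_identity_inj[OF D]) (use elim in blast)
  qed
qed

text \<open>A left inverse of the limit times \<open>M t\<close> tends to the identity and so is
  eventually injective; then \<open>M t\<close> is injective as well.\<close>

lemma inj_matrix_stable:
  fixes M :: "nat \<Rightarrow> 'v \<Rightarrow> 'd \<Rightarrow> real"
  assumes D: "finite D" and V: "finite V" and inj: "inj_matrix V D M\<^sub>0"
    and lim: "\<And>v j. v \<in> V \<Longrightarrow> j \<in> D \<Longrightarrow> (\<lambda>t. M t v j) \<longlonglongrightarrow> M\<^sub>0 v j"
  shows "eventually (\<lambda>t. inj_matrix V D (M t)) sequentially"
proof -
  obtain L where L: "\<forall>j\<in>D. \<forall>k\<in>D. (\<Sum>v\<in>V. L j v * M\<^sub>0 v k) = (if j = k then 1 else 0)"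
    using inj_matrix_left_inverse[OF D V inj] by blast
  have "(\<lambda>t. \<Sum>v\<in>V. L j v * M t v k) \<longlonglongrightarrow> (\<Sum>v\<in>V. L j v * M\<^sub>0 v k)" if "j \<in> D" "k \<in> D" for j k
    by (intro tendsto_intros lim that)
  then have "eventually (\<lambda>t. inj_matrix D D (\<lambda>j k. \<Sum>v\<in>V. L j v * M t v k)) sequentially"
    using L by (intro near_identity_eventually_inj D) auto
  then show ?thesis
  proof eventually_elim
    case (elim t)
    show ?case
      unfolding inj_matrix_def
    proof (intro allI impI)
      fix c assume c: "\<forall>v\<in>V. (\<Sum>j\<in>D. c j * M t v j) = 0"
      have "(\<Sum>k\<in>D. c k * (\<Sum>v\<in>V. L j v * M t v k)) = (\<Sum>v\<in>V. L j v * (\<Sum>k\<in>D. c k * M t v k))" for j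
        unfolding sum_distrib_left by (subst sum.swap) (simp add: mult_ac)
      then have "\<forall>j\<in>D. (\<Sum>k\<in>D. c k * (\<Sum>v\<in>V. L j v * M t v k)) = 0" using c by simp
      then show "\<forall>j\<in>D. c j = 0" using elim unfolding inj_matrix_def by blast
    qed
  qed
qed

lemma surj_matrix_right_inverse:
  assumes "surj_matrix V D M"
  shows "\<exists>X. \<forall>w\<in>V. \<forall>v\<in>V. (\<Sum>j\<in>D. X w j * M v j) = (if v = w then 1 else 0)"
proof -
  have "\<forall>w. \<exists>x. \<forall>v\<in>V. (\<Sum>j\<in>D. x j * M v j) = (if v = w then 1 else 0)"
    using assms unfolding surj_matrix_def by (intro allI) (erule allE)
  then show ?thesis by metis
qed

lemma surj_matrix_stable:
  fixes M :: "nat \<Rightarrow> 'v \<Rightarrow> 'd \<Rightarrow> real"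
  assumes D: "finite D" and V: "finite V" and surj: "surj_matrix V D M\<^sub>0"
    and lim: "\<And>v j. v \<in> V \<Longrightarrow> j \<in> D \<Longrightarrow> (\<lambda>t. M t v j) \<longlonglongrightarrow> M\<^sub>0 v j"
  shows "eventually (\<lambda>t. surj_matrix V D (M t)) sequentially"
proof -
  obtain X where X: "\<forall>w\<in>V. \<forall>v\<in>V. (\<Sum>j\<in>D. X w j * M\<^sub>0 v j) = (if v = w then 1 else 0)"
    using surj_matrix_right_inverse[OF surj] by blast
  have "(\<lambda>t. \<Sum>j\<in>D. X w j * M t v j) \<longlonglongrightarrow> (\<Sum>j\<in>D. X w j * M\<^sub>0 v j)" if "v \<in> V" "w \<in> V" for v w
    by (intro tendsto_intros lim that)
  then have "eventually (\<lambda>t. inj_matrix V V (\<lambda>v w. \<Sum>j\<in>D. X w j * M t v j)) sequentially"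
    using X by (intro near_identity_eventually_inj V) auto
  then show ?thesis
  proof eventually_elim
    case (elim t)
    \<comment> \<open>For a square matrix the rows selected by injectivity are all rows, so
      injectivity gives surjectivity.\<close>
    obtain I where "I \<subseteq> V" "card I = card V" "surj_matrix I V (\<lambda>v w. \<Sum>j\<in>D. X w j * M t v j)"
      using inj_matrix_rows[OF V V elim] by blast
    then have S: "surj_matrix V V (\<lambda>v w. \<Sum>j\<in>D. X w j * M t v j)" using card_subset_eq[OF V] by blast
    show ?case
      unfolding surj_matrix_def
    proof
      fix g
      obtain x where x: "\<forall>v\<in>V. (\<Sum>w\<in>V. x w * (\<Sum>j\<in>D. X w j * M t v j)) = g v"
        using S unfolding surj_matrix_def by blast
      have "(\<Sum>j\<in>D. (\<Sum>w\<in>V. x w * X w j) * M t v j) = (\<Sum>w\<in>V. x w * (\<Sum>j\<in>D. X w j * M t v j))" for v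
        unfolding sum_distrib_left sum_distrib_right by (subst sum.swap) (simp add: mult_ac)
      then show "\<exists>x. \<forall>v\<in>V. (\<Sum>j\<in>D. x j * M t v j) = g v"
        using x by (intro exI[of _ "\<lambda>j. \<Sum>w\<in>V. x w * X w j"]) simp
    qed
  qed
qed

text \<open>F minus the identity contracts by 1/2 in the sup norm over I, so the steps of the
  iteration U + (z - F U) halve each time. Limits are taken in each coordinate, which avoids a
  complete metric on the function space.\<close>

lemma contraction_solve:
  fixes F :: "('i \<Rightarrow> real) \<Rightarrow> 'i \<Rightarrow> real"
  assumes \<delta>: "0 < \<delta>"
    and F: "\<And>u w r i. 0 \<le> r \<Longrightarrow> (\<And>i. i \<in> I \<Longrightarrow> \<bar>u i\<bar> \<le> \<delta>) \<Longrightarrow> (\<And>i. i \<in> I \<Longrightarrow> \<bar>w i\<bar> \<le> \<delta>) \<Longrightarrow>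
      (\<And>i. i \<in> I \<Longrightarrow> \<bar>u i - w i\<bar> \<le> r) \<Longrightarrow> i \<in> I \<Longrightarrow> \<bar>F u i - F w i - (u i - w i)\<bar> \<le> r / 2"
    and z: "\<And>i. i \<in> I \<Longrightarrow> \<bar>z i - F (\<lambda>_. 0) i\<bar> \<le> \<delta> / 4"
  shows "\<exists>u. \<forall>i\<in>I. F u i = z i"
proof -
  define U where "U = rec_nat (\<lambda>_. 0) (\<lambda>_ u i. u i + (z i - F u i))"
  have U0: "U 0 = (\<lambda>_. 0)" and US: "U (Suc m) i = U m i + (z i - F (U m) i)" for m i
    by (simp_all add: U_def)
  \<comment> \<open>The steps \<open>\<rho> / 2 ^ m\<close> add up to at most
    \<open>2 * \<rho> = \<delta> / 2\<close>, so the iterates and their limit stay in the box where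
    the hypothesis on F applies.\<close>
  define \<rho> where "\<rho> = \<delta> / 4"
  have inv: "\<forall>i\<in>I. \<bar>U (Suc m) i - U m i\<bar> \<le> \<rho> / 2 ^ m \<and> \<bar>U m i\<bar> \<le> 2 * \<rho> - 2 * \<rho> / 2 ^ m" for m
  proof (induction m)
    case 0
    then show ?case using z \<delta> by (auto simp: US U0 \<rho>_def)
  next
    case (Suc m)
    have bd: "\<bar>U (Suc m) i\<bar> \<le> 2 * \<rho> - 2 * \<rho> / 2 ^ Suc m" if "i \<in> I" for i
    proof -
      have "\<bar>U (Suc m) i\<bar> \<le> \<bar>U m i\<bar> + \<bar>U (Suc m) i - U m i\<bar>" by linarith
      also have "\<dots> \<le> (2 * \<rho> - 2 * \<rho> / 2 ^ m) + \<rho> / 2 ^ m" using Suc that by (intro add_mono) auto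
      also have "\<dots> = 2 * \<rho> - 2 * \<rho> / 2 ^ Suc m" by (simp add: field_simps)
      finally show ?thesis .
    qed
    have le: "x \<le> \<delta>" if "x \<le> 2 * \<rho> - 2 * \<rho> / 2 ^ l" for x l
    proof -
      have "0 \<le> 2 * \<rho> / 2 ^ l" using \<delta> by (simp add: \<rho>_def)
      moreover have "2 * \<rho> \<le> \<delta>" using \<delta> by (simp add: \<rho>_def)
      ultimately show ?thesis using that by linarith
    qed
    have "\<bar>U (Suc (Suc m)) i - U (Suc m) i\<bar> \<le> \<rho> / 2 ^ Suc m" if i: "i \<in> I" for i
    proof -
      have "U (Suc (Suc m)) i - U (Suc m) i = - (F (U (Suc m)) i - F (U m) i - (U (Suc m) i - U m i))"
        by (simp add: US)
      moreover have "\<bar>F (U (Suc m)) i - F (U m) i - (U (Suc m) i - U m i)\<bar> \<le> (\<rho> / 2 ^ m) / 2"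
        using Suc bd le \<delta> i by (intro F) (auto simp: \<rho>_def)
      ultimately have "\<bar>U (Suc (Suc m)) i - U (Suc m) i\<bar> \<le> (\<rho> / 2 ^ m) / 2" by simp
      then show ?thesis by simp
    qed
    then show ?case using bd by blast
  qed
  have step: "\<bar>U (Suc m) i - U m i\<bar> \<le> \<rho> / 2 ^ m" and bd: "\<bar>U m i\<bar> \<le> 2 * \<rho>" if "i \<in> I" for i m
  proof -
    show "\<bar>U (Suc m) i - U m i\<bar> \<le> \<rho> / 2 ^ m" using inv that by blast
    have "0 \<le> 2 * \<rho> / 2 ^ m" using \<delta> by (simp add: \<rho>_def)
    then show "\<bar>U m i\<bar> \<le> 2 * \<rho>" using inv[of m] that by fastforce
  qed
  have tail: "\<bar>U (m + l) i - U m i\<bar> \<le> 2 * \<rho> / 2 ^ m" if i: "i \<in> I" for i m l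
  proof -
    have "\<bar>U (m + l) i - U m i\<bar> \<le> 2 * \<rho> / 2 ^ m - 2 * \<rho> / 2 ^ (m + l)"
    proof (induction l)
      case 0
      show ?case by simp
    next
      case (Suc l)
      have "\<bar>U (m + Suc l) i - U m i\<bar> \<le> \<bar>U (m + l) i - U m i\<bar> + \<bar>U (Suc (m + l)) i - U (m + l) i\<bar>"
        by simp
      also have "\<dots> \<le> (2 * \<rho> / 2 ^ m - 2 * \<rho> / 2 ^ (m + l)) + \<rho> / 2 ^ (m + l)"
        using Suc step[OF i] by (intro add_mono)
      also have "\<dots> = 2 * \<rho> / 2 ^ m - 2 * \<rho> / 2 ^ (m + Suc l)" by (simp add: field_simps)
      finally show ?case .
    qed
    moreover have "0 \<le> 2 * \<rho> / 2 ^ (m + l)" using \<delta> by (simp add: \<rho>_def)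
    ultimately show ?thesis by linarith
  qed
  have "convergent (\<lambda>m. U m i)" if i: "i \<in> I" for i
  proof -
    have "summable (\<lambda>m. U (Suc m) i - U m i)"
    proof (rule summable_comparison_test)
      show "\<exists>N. \<forall>m\<ge>N. norm (U (Suc m) i - U m i) \<le> \<rho> * (1 / 2) ^ m"
        using step[OF i] by (auto simp: power_one_over field_simps)
      show "summable (\<lambda>m. \<rho> * (1 / 2) ^ m)" by (intro summable_mult summable_geometric) simp
    qed
    then have "convergent (\<lambda>m. \<Sum>l<m. U (Suc l) i - U l i)" by (simp add: summable_iff_convergent)
    moreover have "(\<Sum>l<m. U (Suc l) i - U l i) = U m i" for m by (induction m) (simp_all add: U0)
    ultimately show ?thesis by simp
  qed
  then obtain l where l: "\<And>i. i \<in> I \<Longrightarrow> (\<lambda>m. U m i) \<longlonglongrightarrow> l i"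
    unfolding convergent_def by metis
  have lb: "\<bar>l i\<bar> \<le> 2 * \<rho>" if i: "i \<in> I" for i
    using tendsto_rabs[OF l[OF i]] bd[OF i] by (intro LIMSEQ_le_const2) auto
  have lU: "\<bar>l i - U m i\<bar> \<le> 2 * \<rho> / 2 ^ m" if i: "i \<in> I" for i m
  proof -
    have "(\<lambda>n. \<bar>U (m + n) i - U m i\<bar>) \<longlonglongrightarrow> \<bar>l i - U m i\<bar>"
      by (intro tendsto_intros LIMSEQ_ignore_initial_segment[OF l[OF i], of m, unfolded add.commute[of _ m]])
    then show ?thesis using tail[OF i] by (intro LIMSEQ_le_const2) auto
  qed
  have "F l i = z i" if i: "i \<in> I" for i
  proof -
    have "\<bar>F l i - z i\<bar> \<le> 4 * \<rho> * (1 / 2) ^ m" for m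
    proof -
      have A: "\<bar>F l i - F (U m) i - (l i - U m i)\<bar> \<le> (2 * \<rho> / 2 ^ m) / 2"
      proof (rule F)
        show "0 \<le> 2 * \<rho> / 2 ^ m" using \<delta> by (simp add: \<rho>_def)
        have "2 * \<rho> \<le> \<delta>" using \<delta> by (simp add: \<rho>_def)
        then show "\<bar>l i\<bar> \<le> \<delta>" "\<bar>U m i\<bar> \<le> \<delta>" if "i \<in> I" for i using lb[OF that] bd[OF that, of m] by linarith+
      qed (use lU i in auto)
      have "F (U m) i - z i = - (U (Suc m) i - U m i)" by (simp add: US)
      then have eq: "F l i - z i = (F l i - F (U m) i - (l i - U m i)) + (l i - U m i) - (U (Suc m) i - U m i)"
        by simp
      have "\<bar>x + y - w\<bar> \<le> \<bar>x\<bar> + \<bar>y\<bar> + \<bar>w\<bar>" for x y w :: real by linarith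
      then have "\<bar>F l i - z i\<bar> \<le> \<bar>F l i - F (U m) i - (l i - U m i)\<bar> + \<bar>l i - U m i\<bar> + \<bar>U (Suc m) i - U m i\<bar>"
        by (subst eq)
      also have "\<dots> \<le> (2 * \<rho> / 2 ^ m) / 2 + 2 * \<rho> / 2 ^ m + \<rho> / 2 ^ m"
        by (intro add_mono A lU step i)
      also have "\<dots> = 4 * \<rho> * (1 / 2) ^ m" by (simp add: power_one_over field_simps)
      finally show ?thesis .
    qed
    moreover have "(\<lambda>m. 4 * \<rho> * (1 / 2 :: real) ^ m) \<longlonglongrightarrow> 4 * \<rho> * 0"
      by (intro tendsto_intros LIMSEQ_power_zero) simp
    ultimately have "\<bar>F l i - z i\<bar> \<le> 4 * \<rho> * 0" by (intro LIMSEQ_le_const[where X = "\<lambda>m. 4 * \<rho> * (1 / 2) ^ m"]) auto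
    then show ?thesis by simp
  qed
  then show ?thesis by blast
qed

section \<open>Strict differentiability in finitely many coordinates\<close>

definition linear_err :: "'j set \<Rightarrow> (('j \<Rightarrow> real) \<Rightarrow> real) \<Rightarrow> ('j \<Rightarrow> real) \<Rightarrow> ('j \<Rightarrow> real) \<Rightarrow> real \<Rightarrow> real \<Rightarrow> bool" where
  "linear_err J f x\<^sub>0 g d e \<longleftrightarrow> (\<forall>x y r. 0 \<le> r \<longrightarrow>
     (\<forall>j\<in>J. \<bar>x j - x\<^sub>0 j\<bar> < d) \<longrightarrow> (\<forall>j\<in>J. \<bar>y j - x\<^sub>0 j\<bar> < d) \<longrightarrow> (\<forall>j\<in>J. \<bar>x j - y j\<bar> \<le> r) \<longrightarrow>
     \<bar>f x - f y - (\<Sum>j\<in>J. g j * (x j - y j))\<bar> \<le> e * r)"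

lemmas linear_errD = linear_err_def[THEN iffD1, rule_format]

text \<open>Strict differentiability compares two arbitrary points near \<open>x\<^sub>0\<close>
  instead of one point with \<open>x\<^sub>0\<close>. This is the estimate a contraction argument
  uses, and it passes through sums and compositions directly. Distances are measured on J
  only.\<close>

definition strict_deriv :: "'j set \<Rightarrow> (('j \<Rightarrow> real) \<Rightarrow> real) \<Rightarrow> ('j \<Rightarrow> real) \<Rightarrow> ('j \<Rightarrow> real) \<Rightarrow> bool" where
  "strict_deriv J f x\<^sub>0 g \<longleftrightarrow> (\<forall>e>0. \<exists>d>0. linear_err J f x\<^sub>0 g d e)"

lemmas strict_derivD = strict_deriv_def[THEN iffD1, rule_format]

lemma strict_derivI: "(\<And>e. 0 < e \<Longrightarrow> \<exists>d>0. linear_err J f x\<^sub>0 g d e) \<Longrightarrow> strict_deriv J f x\<^sub>0 g"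
  by (simp add: strict_deriv_def)

lemma strict_deriv_linear: "strict_deriv J (\<lambda>x. \<Sum>j\<in>J. w j * x j) x\<^sub>0 w"
  by (rule strict_derivI, rule exI[of _ 1])
    (simp add: linear_err_def sum_subtractf[symmetric] right_diff_distrib[symmetric])

lemma strict_deriv_add:
  assumes "strict_deriv J f x\<^sub>0 g" "strict_deriv J f' x\<^sub>0 g'"
  shows "strict_deriv J (\<lambda>x. f x + f' x) x\<^sub>0 (\<lambda>j. g j + g' j)"
proof (rule strict_derivI)
  fix e :: real assume e: "0 < e"
  obtain d where d: "0 < d" "linear_err J f x\<^sub>0 g d (e / 2)"
    using strict_derivD[OF assms(1) half_gt_zero[OF e]] by blast
  obtain d' where d': "0 < d'" "linear_err J f' x\<^sub>0 g' d' (e / 2)"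
    using strict_derivD[OF assms(2) half_gt_zero[OF e]] by blast
  show "\<exists>d>0. linear_err J (\<lambda>x. f x + f' x) x\<^sub>0 (\<lambda>j. g j + g' j) d e"
    unfolding linear_err_def
  proof (intro exI[of _ "min d d'"] conjI allI impI)
    fix x y r assume H: "(0::real) \<le> r" "\<forall>j\<in>J. \<bar>x j - x\<^sub>0 j\<bar> < min d d'"
      "\<forall>j\<in>J. \<bar>y j - x\<^sub>0 j\<bar> < min d d'" "\<forall>j\<in>J. \<bar>x j - y j\<bar> \<le> r"
    have 1: "\<bar>f x - f y - (\<Sum>j\<in>J. g j * (x j - y j))\<bar> \<le> e / 2 * r" by (rule linear_errD[OF d(2)]) (use H in auto)
    have 2: "\<bar>f' x - f' y - (\<Sum>j\<in>J. g' j * (x j - y j))\<bar> \<le> e / 2 * r" by (rule linear_errD[OF d'(2)]) (use H in auto)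
    have "(\<Sum>j\<in>J. (g j + g' j) * (x j - y j)) = (\<Sum>j\<in>J. g j * (x j - y j)) + (\<Sum>j\<in>J. g' j * (x j - y j))"
      by (simp add: distrib_right sum.distrib)
    then show "\<bar>f x + f' x - (f y + f' y) - (\<Sum>j\<in>J. (g j + g' j) * (x j - y j))\<bar> \<le> e * r"
      using 1 2 by linarith
  qed (use d d' in auto)
qed

lemma strict_deriv_sum:
  assumes "finite A" "\<And>a. a \<in> A \<Longrightarrow> strict_deriv J (f a) x\<^sub>0 (g a)"
  shows "strict_deriv J (\<lambda>x. \<Sum>a\<in>A. f a x) x\<^sub>0 (\<lambda>j. \<Sum>a\<in>A. g a j)"
  using assms
proof (induction A)
  case empty
  show ?case using strict_deriv_linear[of J "\<lambda>_. 0"] by simp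
next
  case (insert a A)
  then have "strict_deriv J (f a) x\<^sub>0 (g a)" "strict_deriv J (\<lambda>x. \<Sum>a\<in>A. f a x) x\<^sub>0 (\<lambda>j. \<Sum>a\<in>A. g a j)"
    by auto
  from strict_deriv_add[OF this] show ?case using insert.hyps by simp
qed

text \<open>Chain rule for an outer function of one variable: the mean value theorem writes its
  increment with \<open>\<phi>'\<close> at an intermediate point, and continuity of
  \<open>\<phi>'\<close> bounds the error. The radius a admits outer functions such as the
  logarithm, differentiable on part of the line only.\<close>

lemma strict_deriv_compose:
  assumes fg: "strict_deriv J f x\<^sub>0 g" and J: "finite J"
    and \<phi>: "0 < a" "\<And>s. \<bar>s - f x\<^sub>0\<bar> < a \<Longrightarrow> (\<phi> has_real_derivative \<phi>' s) (at s)"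
    and cont: "isCont \<phi>' (f x\<^sub>0)"
  shows "strict_deriv J (\<lambda>x. \<phi> (f x)) x\<^sub>0 (\<lambda>j. \<phi>' (f x\<^sub>0) * g j)"
proof (rule strict_derivI)
  fix e :: real assume e: "0 < e"
  define G where "G = (\<Sum>j\<in>J. \<bar>g j\<bar>) + 1"
  have G: "0 < G" by (simp add: G_def add_nonneg_pos sum_nonneg)
  define P where "P = \<bar>\<phi>' (f x\<^sub>0)\<bar> + 1"
  have P: "0 < P" by (simp add: P_def add_nonneg_pos)
  obtain b where b: "0 < b" "\<And>s. \<bar>s - f x\<^sub>0\<bar> < b \<Longrightarrow> \<bar>\<phi>' s - \<phi>' (f x\<^sub>0)\<bar> < e / (2 * G)"
  proof -
    have "0 < e / (2 * G)" using e G by simp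
    then obtain b where b: "b > 0"
      "\<And>s. s \<noteq> f x\<^sub>0 \<Longrightarrow> norm (s - f x\<^sub>0) < b \<Longrightarrow> norm (\<phi>' s - \<phi>' (f x\<^sub>0)) < e / (2 * G)"
      using cont unfolding isCont_def LIM_eq by blast
    have "\<bar>\<phi>' s - \<phi>' (f x\<^sub>0)\<bar> < e / (2 * G)" if "\<bar>s - f x\<^sub>0\<bar> < b" for s
      using b(2)[of s] that \<open>0 < e / (2 * G)\<close> by (cases "s = f x\<^sub>0") auto
    then show ?thesis using b(1) by (intro that[of b])
  qed
  obtain d1 where d1: "0 < d1" "linear_err J f x\<^sub>0 g d1 (1)"
    using strict_derivD[OF fg zero_less_one] by blast
  obtain d2 where d2: "0 < d2" "linear_err J f x\<^sub>0 g d2 (e / (2 * P))"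
    using strict_derivD[OF fg divide_pos_pos[OF e mult_pos_pos[OF zero_less_numeral P]]] by blast
  define c where "c = min a b / (2 * G)"
  have c: "0 < c" using \<phi>(1) b(1) G by (simp add: c_def)
  have lip: "\<bar>f x - f y\<bar> \<le> G * r" if "0 \<le> r" "\<And>j. j \<in> J \<Longrightarrow> \<bar>x j - x\<^sub>0 j\<bar> < d1"
    "\<And>j. j \<in> J \<Longrightarrow> \<bar>y j - x\<^sub>0 j\<bar> < d1" "\<And>j. j \<in> J \<Longrightarrow> \<bar>x j - y j\<bar> \<le> r" for x y r
  proof -
    have "\<bar>\<Sum>j\<in>J. g j * (x j - y j)\<bar> \<le> (\<Sum>j\<in>J. \<bar>g j * (x j - y j)\<bar>)" by (rule sum_abs)
    also have "\<dots> \<le> (\<Sum>j\<in>J. \<bar>g j\<bar> * r)" unfolding abs_mult using that by (intro sum_mono mult_left_mono) auto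
    also have "\<dots> = (\<Sum>j\<in>J. \<bar>g j\<bar>) * r" by (simp add: sum_distrib_right)
    finally show ?thesis using linear_errD[OF d1(2) that(1), of x y] that(2-4) by (simp add: G_def distrib_right)
  qed
  define d where "d = min (min d1 d2) c"
  show "\<exists>d>0. linear_err J (\<lambda>x. \<phi> (f x)) x\<^sub>0 (\<lambda>j. \<phi>' (f x\<^sub>0) * g j) d e"
    unfolding linear_err_def
  proof (intro exI[of _ d] conjI allI impI)
    show "d > 0" using d1 d2 c by (simp add: d_def)
    fix x y r assume r: "(0::real) \<le> r" and x: "\<forall>j\<in>J. \<bar>x j - x\<^sub>0 j\<bar> < d"
      and y: "\<forall>j\<in>J. \<bar>y j - x\<^sub>0 j\<bar> < d" and xy: "\<forall>j\<in>J. \<bar>x j - y j\<bar> \<le> r"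
    have near: "\<bar>f w - f x\<^sub>0\<bar> < min a b" if "\<forall>j\<in>J. \<bar>w j - x\<^sub>0 j\<bar> < d" for w
    proof -
      have "\<bar>f w - f x\<^sub>0\<bar> \<le> G * c"
        using that c d1(1) by (intro lip) (auto simp: d_def intro: less_imp_le)
      also have "G * c = min a b / 2" using G by (simp add: c_def)
      also have "\<dots> < min a b" using half_gt_zero[of "min a b"] \<phi>(1) b(1) by linarith
      finally show ?thesis .
    qed
    have fxy: "\<bar>f x - f y\<bar> \<le> G * r" using x y xy r by (intro lip) (auto simp: d_def)
    have lin: "\<bar>f x - f y - (\<Sum>j\<in>J. g j * (x j - y j))\<bar> \<le> e / (2 * P) * r"
      using x y xy r by (intro linear_errD[OF d2(2)]) (auto simp: d_def)
    have "\<exists>s. \<bar>s - f x\<^sub>0\<bar> < min a b \<and> \<phi> (f x) - \<phi> (f y) = (f x - f y) * \<phi>' s"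
    proof -
      have mv: "\<exists>s. \<bar>s - f x\<^sub>0\<bar> < min a b \<and> \<phi> q - \<phi> p = (q - p) * \<phi>' s"
        if "p < q" "\<bar>p - f x\<^sub>0\<bar> < min a b" "\<bar>q - f x\<^sub>0\<bar> < min a b" for p q
      proof -
        have "\<exists>s>p. s < q \<and> \<phi> q - \<phi> p = (q - p) * \<phi>' s"
          using that by (intro MVT2 \<phi>(2)) auto
        then obtain s where s: "p < s" "s < q" "\<phi> q - \<phi> p = (q - p) * \<phi>' s" by blast
        then have "\<bar>s - f x\<^sub>0\<bar> < min a b" using that by linarith
        then show ?thesis using s(3) by blast
      qed
      show ?thesis
      proof (cases "f x" "f y" rule: linorder_cases)
        case less
        then obtain s where "\<bar>s - f x\<^sub>0\<bar> < min a b" "\<phi> (f y) - \<phi> (f x) = (f y - f x) * \<phi>' s"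
          using mv near[OF x] near[OF y] by blast
        then show ?thesis by (intro exI[of _ s]) (auto simp: algebra_simps)
      next
        case equal
        then show ?thesis using near[OF x] by auto
      next
        case greater
        then show ?thesis using mv near[OF x] near[OF y] by blast
      qed
    qed
    then obtain s where s: "\<bar>s - f x\<^sub>0\<bar> < min a b" "\<phi> (f x) - \<phi> (f y) = (f x - f y) * \<phi>' s" by blast
    have "\<phi> (f x) - \<phi> (f y) - (\<Sum>j\<in>J. \<phi>' (f x\<^sub>0) * g j * (x j - y j)) =
      (f x - f y) * (\<phi>' s - \<phi>' (f x\<^sub>0)) + \<phi>' (f x\<^sub>0) * (f x - f y - (\<Sum>j\<in>J. g j * (x j - y j)))"
      by (simp add: s(2) algebra_simps sum_distrib_left)
    also have "\<bar>\<dots>\<bar> \<le> \<bar>f x - f y\<bar> * \<bar>\<phi>' s - \<phi>' (f x\<^sub>0)\<bar> + \<bar>\<phi>' (f x\<^sub>0)\<bar> * \<bar>f x - f y - (\<Sum>j\<in>J. g j * (x j - y j))\<bar>"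
      unfolding abs_mult[symmetric] by (rule abs_triangle_ineq)
    also have "\<dots> \<le> (G * r) * (e / (2 * G)) + P * (e / (2 * P) * r)"
      using fxy lin b(2)[of s] s(1) r G P by (intro add_mono mult_mono) (auto simp: P_def)
    also have "\<dots> = e * r" using G P by (simp add: field_simps)
    finally show "\<bar>\<phi> (f x) - \<phi> (f y) - (\<Sum>j\<in>J. \<phi>' (f x\<^sub>0) * g j * (x j - y j))\<bar> \<le> e * r" .
  qed
qed

text \<open>Local surjectivity of a submersion. Along the affine subspace through
  \<open>x\<^sub>0\<close> given by a right inverse X of the derivative, f is the identity up to
  translation and a small Lipschitz error, so the contraction argument solves f = z.\<close>

lemma strict_deriv_surj:
  assumes I: "finite I" and J: "finite J"
    and f: "\<And>i. i \<in> I \<Longrightarrow> strict_deriv J (f i) x\<^sub>0 (g i)" and surj: "surj_matrix I J g"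
  shows "\<exists>e>0. \<forall>z. (\<forall>i\<in>I. \<bar>z i - f i x\<^sub>0\<bar> < e) \<longrightarrow> (\<exists>x. \<forall>i\<in>I. f i x = z i)"
proof -
  obtain X where X: "\<forall>w\<in>I. \<forall>v\<in>I. (\<Sum>j\<in>J. X w j * g v j) = (if v = w then 1 else 0)"
    using surj_matrix_right_inverse[OF surj] by blast
  define B where "B = (\<Sum>i\<in>I. \<Sum>j\<in>J. \<bar>X i j\<bar>) + 1"
  have B: "0 < B" by (simp add: B_def add_nonneg_pos sum_nonneg)
  define pt where "pt u j = x\<^sub>0 j + (\<Sum>i\<in>I. u i * X i j)" for u j
  have pt: "\<bar>pt u j - pt w j\<bar> \<le> B * r" if "\<And>i. i \<in> I \<Longrightarrow> \<bar>u i - w i\<bar> \<le> r" "0 \<le> r" "j \<in> J" for u w r j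
  proof -
    have "pt u j - pt w j = (\<Sum>i\<in>I. (u i - w i) * X i j)"
      by (simp add: pt_def sum_subtractf left_diff_distrib)
    also have "\<bar>\<dots>\<bar> \<le> (\<Sum>i\<in>I. \<bar>(u i - w i) * X i j\<bar>)" by (rule sum_abs)
    also have "\<dots> \<le> (\<Sum>i\<in>I. r * (\<Sum>j\<in>J. \<bar>X i j\<bar>))"
      unfolding abs_mult using that J by (intro sum_mono mult_mono) (auto intro: member_le_sum)
    also have "\<dots> = r * (\<Sum>i\<in>I. \<Sum>j\<in>J. \<bar>X i j\<bar>)" by (simp add: sum_distrib_left)
    also have "\<dots> \<le> B * r" using that(2) by (simp add: B_def algebra_simps)
    finally show ?thesis .
  qed
  \<comment> \<open>A move of size r along X changes each coordinate by at most B * r, so this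
    tolerance leaves an error of at most r / 2.\<close>
  have "0 < 1 / (2 * B)" using B by simp
  then have "\<forall>i\<in>I. \<exists>d>0. linear_err J (f i) x\<^sub>0 (g i) d (1 / (2 * B))"
    using f[unfolded strict_deriv_def] by blast
  from bchoice[OF this] obtain d where d: "\<forall>i\<in>I. d i > 0 \<and> linear_err J (f i) x\<^sub>0 (g i) (d i) (1 / (2 * B))" by blast
  define d0 where "d0 = Min (insert 1 (d ` I))"
  have d0: "0 < d0" "\<And>i. i \<in> I \<Longrightarrow> d0 \<le> d i" using d I by (auto simp: d0_def)
  define \<delta> where "\<delta> = d0 / (2 * B)"
  have \<delta>: "0 < \<delta>" using d0 B by (simp add: \<delta>_def)
  define F where "F u i = f i (pt u)" for u i
  have pt0: "pt (\<lambda>_. 0) = x\<^sub>0" by (simp add: pt_def fun_eq_iff)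
  have F: "\<bar>F u i - F w i - (u i - w i)\<bar> \<le> r / 2"
    if r: "0 \<le> r" and u: "\<And>i. i \<in> I \<Longrightarrow> \<bar>u i\<bar> \<le> \<delta>" and w: "\<And>i. i \<in> I \<Longrightarrow> \<bar>w i\<bar> \<le> \<delta>"
      and uw: "\<And>i. i \<in> I \<Longrightarrow> \<bar>u i - w i\<bar> \<le> r" and i: "i \<in> I" for u w r i
  proof -
    have near: "\<bar>pt v j - x\<^sub>0 j\<bar> < d i" if "\<And>i. i \<in> I \<Longrightarrow> \<bar>v i\<bar> \<le> \<delta>" "j \<in> J" for v j
    proof -
      have "\<bar>pt v j - x\<^sub>0 j\<bar> \<le> B * \<delta>"
        using pt[of v "\<lambda>_. 0" \<delta> j] that \<delta> by (simp add: pt0)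
      also have "\<dots> = d0 / 2" using B by (simp add: \<delta>_def)
      also have "\<dots> < d i" using d0(1) d0(2)[OF i] by linarith
      finally show ?thesis .
    qed
    have "\<bar>f i (pt u) - f i (pt w) - (\<Sum>j\<in>J. g i j * (pt u j - pt w j))\<bar> \<le> 1 / (2 * B) * (B * r)"
      by (rule linear_errD[OF d[THEN bspec, OF i, THEN conjunct2]]) (use near u w pt[OF uw r] r B in auto)
    moreover have "(\<Sum>j\<in>J. g i j * (pt u j - pt w j)) = u i - w i"
    proof -
      have "(\<Sum>j\<in>J. g i j * (pt u j - pt w j)) = (\<Sum>j\<in>J. \<Sum>l\<in>I. (u l - w l) * (X l j * g i j))"
        by (intro sum.cong)
          (auto simp: pt_def sum_subtractf[symmetric] left_diff_distrib[symmetric] sum_distrib_left mult_ac)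
      also have "\<dots> = (\<Sum>l\<in>I. (u l - w l) * (\<Sum>j\<in>J. X l j * g i j))"
        by (subst sum.swap) (simp add: sum_distrib_left)
      also have "\<dots> = (\<Sum>l\<in>I. if i = l then u l - w l else 0)"
        using X i by (intro sum.cong) auto
      also have "\<dots> = u i - w i" using I i by simp
      finally show ?thesis .
    qed
    ultimately show ?thesis using B by (simp add: F_def)
  qed
  have "\<exists>x. \<forall>i\<in>I. f i x = z i" if z: "\<forall>i\<in>I. \<bar>z i - f i x\<^sub>0\<bar> < \<delta> / 4" for z
  proof -
    have "\<exists>u. \<forall>i\<in>I. F u i = z i"
    proof (rule contraction_solve[where F = F and z = z, OF \<delta>])
      show "\<bar>z i - F (\<lambda>_. 0) i\<bar> \<le> \<delta> / 4" if "i \<in> I" for i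
        using z[rule_format, OF that] by (simp add: F_def pt0)
    qed (fact F)
    then show ?thesis unfolding F_def by blast
  qed
  then show ?thesis using \<delta> by (intro exI[of _ "\<delta> / 4"]) auto
qed

section \<open>The model and the upper bound\<close>

inductive_set pspan :: "'j set \<Rightarrow> nat \<Rightarrow> (('j \<Rightarrow> real) \<Rightarrow> real) set" for J :: "'j set" and D :: nat where
  pspan_mono: "(\<And>j. j \<in> J \<Longrightarrow> e j \<le> D) \<Longrightarrow> (\<lambda>\<zeta>. c * (\<Prod>j\<in>J. \<zeta> j ^ e j)) \<in> pspan J D"
| pspan_add: "f \<in> pspan J D \<Longrightarrow> g \<in> pspan J D \<Longrightarrow> (\<lambda>\<zeta>. f \<zeta> + g \<zeta>) \<in> pspan J D"

lemma pspan_const: "(\<lambda>_. c) \<in> pspan J D"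
  using pspan_mono[of J "\<lambda>_. 0" D c] by simp

lemma pspan_sum:
  assumes "finite A" "\<And>a. a \<in> A \<Longrightarrow> f a \<in> pspan J D"
  shows "(\<lambda>\<zeta>. \<Sum>a\<in>A. f a \<zeta>) \<in> pspan J D"
  using assms
proof (induction A)
  case empty
  show ?case using pspan_const[of 0] by simp
next
  case (insert a A)
  then have "f a \<in> pspan J D" "(\<lambda>\<zeta>. \<Sum>a\<in>A. f a \<zeta>) \<in> pspan J D" by auto
  from pspan_add[OF this] show ?case using insert.hyps by simp
qed

lemma pspan_mult:
  assumes "f \<in> pspan J D" "g \<in> pspan J D'"
  shows "(\<lambda>\<zeta>. f \<zeta> * g \<zeta>) \<in> pspan J (D + D')"
  using assms(1)
proof induction
  case (pspan_mono e c)
  show ?case using assms(2)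
  proof induction
    case (pspan_mono e' c')
    have "(\<lambda>\<zeta>. (c * c') * (\<Prod>j\<in>J. \<zeta> j ^ (e j + e' j))) \<in> pspan J (D + D')"
      using pspan_mono \<open>\<And>j. j \<in> J \<Longrightarrow> e j \<le> D\<close> by (intro pspan.pspan_mono) (simp add: add_mono)
    then show ?case by (simp add: power_add prod.distrib mult_ac)
  next
    case (pspan_add f' g')
    from pspan.pspan_add[OF pspan_add.IH] show ?case by (simp add: distrib_left)
  qed
next
  case (pspan_add f' g')
  from pspan.pspan_add[OF pspan_add.IH] show ?case by (simp add: distrib_right)
qed

lemma pspan_power: "f \<in> pspan J D \<Longrightarrow> (\<lambda>\<zeta>. f \<zeta> ^ m) \<in> pspan J (m * D)"
proof (induction m)
  case 0
  show ?case using pspan_const[of 1] by simp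
next
  case (Suc m)
  from pspan_mult[OF Suc.prems Suc.IH[OF Suc.prems]] show ?case by simp
qed

lemma pspan_prod:
  assumes "finite A" "\<And>a. a \<in> A \<Longrightarrow> f a \<in> pspan J (D a)"
  shows "(\<lambda>\<zeta>. \<Prod>a\<in>A. f a \<zeta>) \<in> pspan J (\<Sum>a\<in>A. D a)"
  using assms
proof (induction A)
  case empty
  show ?case using pspan_const[of 1] by simp
next
  case (insert a A)
  then have "f a \<in> pspan J (D a)" "(\<lambda>\<zeta>. \<Prod>a\<in>A. f a \<zeta>) \<in> pspan J (\<Sum>a\<in>A. D a)" by auto
  from pspan_mult[OF this] show ?case using insert.hyps by simp
qed

lemma pspan_coeffs:
  assumes "finite J" "f \<in> pspan J D"
  shows "\<exists>C. \<forall>\<zeta>. f \<zeta> = (\<Sum>e\<in>J \<rightarrow>\<^sub>E {..D}. C e * (\<Prod>j\<in>J. \<zeta> j ^ e j))"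
  using assms(2)
proof induction
  case (pspan_mono e c)
  let ?e = "restrict e J"
  have e: "?e \<in> J \<rightarrow>\<^sub>E {..D}" using pspan_mono by auto
  have "c * (\<Prod>j\<in>J. \<zeta> j ^ e j) = (\<Sum>e\<in>J \<rightarrow>\<^sub>E {..D}. (if e = ?e then c else 0) * (\<Prod>j\<in>J. \<zeta> j ^ e j))" for \<zeta>
  proof -
    have "(\<Sum>e\<in>J \<rightarrow>\<^sub>E {..D}. (if e = ?e then c else 0) * (\<Prod>j\<in>J. \<zeta> j ^ e j)) =
      (\<Sum>e\<in>J \<rightarrow>\<^sub>E {..D}. if e = ?e then c * (\<Prod>j\<in>J. \<zeta> j ^ e j) else 0)"
      by (intro sum.cong) auto
    also have "\<dots> = c * (\<Prod>j\<in>J. \<zeta> j ^ ?e j)"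
      using e assms(1) by (simp add: finite_PiE)
    also have "\<dots> = c * (\<Prod>j\<in>J. \<zeta> j ^ e j)" by (simp cong: prod.cong)
    finally show ?thesis by simp
  qed
  then show ?case by (intro exI[of _ "\<lambda>e. if e = ?e then c else 0"]) blast
next
  case (pspan_add f g)
  then obtain C C' where "\<forall>\<zeta>. f \<zeta> = (\<Sum>e\<in>J \<rightarrow>\<^sub>E {..D}. C e * (\<Prod>j\<in>J. \<zeta> j ^ e j))"
    "\<forall>\<zeta>. g \<zeta> = (\<Sum>e\<in>J \<rightarrow>\<^sub>E {..D}. C' e * (\<Prod>j\<in>J. \<zeta> j ^ e j))" by blast
  then show ?case by (intro exI[of _ "\<lambda>e. C e + C' e"]) (simp add: distrib_right sum.distrib)
qed

text \<open>Induction on the variables: with the other coordinates fixed in the box, a polynomial in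
  one variable has infinitely many zeros. So each of its coefficients, a polynomial in the remaining
  variables, vanishes on the smaller box.\<close>

lemma poly_zero_on_box:
  fixes y :: "'i \<Rightarrow> real"
  assumes "finite I" "0 < e"
    and "\<And>z. (\<And>i. i \<in> I \<Longrightarrow> \<bar>z i - y i\<bar> < e) \<Longrightarrow> (\<Sum>\<alpha>\<in>I \<rightarrow>\<^sub>E {..N}. c \<alpha> * (\<Prod>i\<in>I. z i ^ \<alpha> i)) = 0"
    and "\<alpha> \<in> I \<rightarrow>\<^sub>E {..N}"
  shows "c \<alpha> = 0"
  using assms(1,3,4)
proof (induction I arbitrary: c \<alpha>)
  case empty
  then show ?case by simp
next
  case (insert i I)
  have split: "(\<Sum>\<alpha>\<in>insert i I \<rightarrow>\<^sub>E {..N}. c \<alpha> * (\<Prod>l\<in>insert i I. (z(i := x)) l ^ \<alpha> l)) =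
    (\<Sum>t\<le>N. (\<Sum>\<alpha>\<in>I \<rightarrow>\<^sub>E {..N}. c (\<alpha>(i := t)) * (\<Prod>l\<in>I. z l ^ \<alpha> l)) * x ^ t)" for z x
  proof -
    have summand: "c (\<alpha>(i := t)) * (\<Prod>l\<in>insert i I. (z(i := x)) l ^ (\<alpha>(i := t)) l) =
      c (\<alpha>(i := t)) * (\<Prod>l\<in>I. z l ^ \<alpha> l) * x ^ t" for t \<alpha>
    proof -
      have "(\<Prod>l\<in>I. (z(i := x)) l ^ (\<alpha>(i := t)) l) = (\<Prod>l\<in>I. z l ^ \<alpha> l)"
        using insert.hyps by (intro prod.cong) auto
      then show ?thesis using insert.hyps by simp
    qed
    have "(\<Sum>\<alpha>\<in>insert i I \<rightarrow>\<^sub>E {..N}. c \<alpha> * (\<Prod>l\<in>insert i I. (z(i := x)) l ^ \<alpha> l)) =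
      (\<Sum>(t, \<alpha>)\<in>{..N} \<times> (I \<rightarrow>\<^sub>E {..N}). c (\<alpha>(i := t)) * (\<Prod>l\<in>insert i I. (z(i := x)) l ^ (\<alpha>(i := t)) l))"
      unfolding PiE_insert_eq
      by (subst sum.reindex[OF inj_combinator[OF insert.hyps(2)]]) (simp add: split_def)
    also have "\<dots> = (\<Sum>(t, \<alpha>)\<in>{..N} \<times> (I \<rightarrow>\<^sub>E {..N}). c (\<alpha>(i := t)) * (\<Prod>l\<in>I. z l ^ \<alpha> l) * x ^ t)"
      by (intro sum.cong refl) (simp only: split_def summand)
    also have "\<dots> = (\<Sum>t\<le>N. (\<Sum>\<alpha>\<in>I \<rightarrow>\<^sub>E {..N}. c (\<alpha>(i := t)) * (\<Prod>l\<in>I. z l ^ \<alpha> l)) * x ^ t)"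
      by (simp add: sum.cartesian_product[symmetric] sum_distrib_right)
    finally show ?thesis .
  qed
  have zero: "(\<Sum>\<alpha>\<in>I \<rightarrow>\<^sub>E {..N}. c (\<alpha>(i := t)) * (\<Prod>l\<in>I. z l ^ \<alpha> l)) = 0"
    if z: "\<And>l. l \<in> I \<Longrightarrow> \<bar>z l - y l\<bar> < e" and t: "t \<le> N" for z t
  proof (rule ccontr)
    let ?g = "\<lambda>t. \<Sum>\<alpha>\<in>I \<rightarrow>\<^sub>E {..N}. c (\<alpha>(i := t)) * (\<Prod>l\<in>I. z l ^ \<alpha> l)"
    assume "?g t \<noteq> 0"
    then have "finite {x. (\<Sum>t\<le>N. ?g t * x ^ t) = 0}" using t by (intro polyfun_roots_finite)
    moreover have "{y i<..<y i + e} \<subseteq> {x. (\<Sum>t\<le>N. ?g t * x ^ t) = 0}"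
    proof
      fix x assume x: "x \<in> {y i<..<y i + e}"
      have "(\<Sum>\<alpha>\<in>insert i I \<rightarrow>\<^sub>E {..N}. c \<alpha> * (\<Prod>l\<in>insert i I. (z(i := x)) l ^ \<alpha> l)) = 0"
        by (rule insert.prems(1)) (use z x in auto)
      then show "x \<in> {x. (\<Sum>t\<le>N. ?g t * x ^ t) = 0}" unfolding split by simp
    qed
    ultimately have "finite {y i<..<y i + e}" by (rule rev_finite_subset)
    then show False using assms(2) infinite_Ioo[of "y i" "y i + e"] by simp
  qed
  obtain t \<beta> where \<alpha>: "\<alpha> = \<beta>(i := t)" "\<beta> \<in> I \<rightarrow>\<^sub>E {..N}" "t \<le> N"
    using insert.prems(2) unfolding PiE_insert_eq by auto
  show ?case unfolding \<alpha>(1)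
    by (rule insert.IH[of "\<lambda>\<beta>. c (\<beta>(i := t))", OF _ \<alpha>(2)]) (use zero \<alpha>(3) in blast)
qed

section \<open>Projection along several coordinates\<close>

lemma semialgebraic_subset: "semialgebraic N A \<Longrightarrow> A \<subseteq> euclid N"
  by (induction rule: semialgebraic.induct) auto

lemma semialgebraic_truncate:
  assumes "semialgebraic (N + M) A"
  shows "semialgebraic N {y\<in>euclid N. \<exists>z\<in>A. \<forall>i<N. z i = y i}"
  using assms
proof (induction M arbitrary: A)
  case 0
  then have "A \<subseteq> euclid N" using semialgebraic_subset by simp
  then have "{y\<in>euclid N. \<exists>z\<in>A. \<forall>i<N. z i = y i} = A"
  proof (intro equalityI subsetI)
    fix y assume "y \<in> {y\<in>euclid N. \<exists>z\<in>A. \<forall>i<N. z i = y i}"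
    then obtain z where z: "y \<in> euclid N" "z \<in> A" "\<forall>i<N. z i = y i" by blast
    then have "z \<in> euclid N" using \<open>A \<subseteq> euclid N\<close> by blast
    then have "z = y" using z(1,3) unfolding euclid_def fun_eq_iff by (metis (mono_tags, lifting) mem_Collect_eq not_le)
    then show "y \<in> A" using z by simp
  qed auto
  then show ?case using 0 by simp
next
  case (Suc M)
  let ?B = "{y\<in>euclid (N + M). \<exists>x. y(N + M := x) \<in> A}"
  have "semialgebraic (N + M) ?B" using Suc.prems by (intro tarski_seidenberg) simp
  then have "semialgebraic N {y\<in>euclid N. \<exists>z\<in>?B. \<forall>i<N. z i = y i}" by (rule Suc.IH)
  moreover have "(\<exists>z\<in>?B. \<forall>i<N. z i = y i) \<longleftrightarrow> (\<exists>z\<in>A. \<forall>i<N. z i = y i)" for y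
  proof
    assume "\<exists>z\<in>?B. \<forall>i<N. z i = y i"
    then obtain z x where "z(N + M := x) \<in> A" "\<forall>i<N. z i = y i" by blast
    then show "\<exists>z\<in>A. \<forall>i<N. z i = y i" by (intro bexI[of _ "z(N + M := x)"]) auto
  next
    assume "\<exists>z\<in>A. \<forall>i<N. z i = y i"
    then obtain z where z: "z \<in> A" "\<forall>i<N. z i = y i" by blast
    have "z \<in> euclid (N + Suc M)" using z semialgebraic_subset[OF Suc.prems] by blast
    \<comment> \<open>Points of \<open>euclid (N + M)\<close> vanish from index N + M on; the last
      coordinate is cut off here and reappears as the quantified x.\<close>
    then have "z(N + M := 0) \<in> euclid (N + M)" by (auto simp: euclid_def)
    moreover have "(z(N + M := 0))(N + M := z (N + M)) \<in> A" using z by simp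
    ultimately have "z(N + M := 0) \<in> ?B" by blast
    then show "\<exists>z\<in>?B. \<forall>i<N. z i = y i" using z(2) by (intro bexI[of _ "z(N + M := 0)"]) auto
  qed
  ultimately show ?case by simp
qed

text \<open>The parameters W, b, c are merged into one family indexed by pairs: (a, i) stands for
  the weight between hidden node a and visible node i, where index k (resp. n) is an additional
  node that is always on. The pair (k, n) of the two constant nodes is excluded.\<close>

definition params :: "nat \<Rightarrow> nat \<Rightarrow> (nat \<times> nat) set" where
  "params n k = {..k} \<times> {..n} - {(k, n)}"

definition ext :: "nat \<Rightarrow> nat \<Rightarrow> nat \<Rightarrow> real" where
  "ext n v i = (if i < n then bitv v i else 1)"

definition unnorm :: "nat \<Rightarrow> nat \<Rightarrow> (nat \<times> nat \<Rightarrow> real) \<Rightarrow> nat \<Rightarrow> real" where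
  "unnorm n k \<theta> v = (\<Sum>h<2^k. exp (\<Sum>j\<in>params n k. \<theta> j * (ext k h (fst j) * ext n v (snd j))))"

definition norm_dist :: "nat \<Rightarrow> nat \<Rightarrow> (nat \<times> nat \<Rightarrow> real) \<Rightarrow> nat \<Rightarrow> real" where
  "norm_dist n k \<theta> v = (if v < 2^n then unnorm n k \<theta> v / (\<Sum>w<2^n. unnorm n k \<theta> w) else 0)"

lemma finite_params [simp]: "finite (params n k)"
  by (simp add: params_def)

lemma card_params: "card (params n k) = n * k + n + k"
  by (simp add: params_def card_Diff_singleton_if card_cartesian_product)

lemma sum_params:
  "(\<Sum>j\<in>params n k. f j) = (\<Sum>a<k. \<Sum>i<n. f (a, i)) + (\<Sum>i<n. f (k, i)) + (\<Sum>a<k. f (a, n))"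
  for f :: "nat \<times> nat \<Rightarrow> real"
proof -
  have "(\<Sum>j\<in>params n k. f j) = (\<Sum>j\<in>{..k} \<times> {..n}. f j) - f (k, n)"
    by (simp add: params_def sum_diff1)
  also have "(\<Sum>j\<in>{..k} \<times> {..n}. f j) = (\<Sum>a\<le>k. \<Sum>i\<le>n. f (a, i))"
    by (simp add: sum.cartesian_product)
  finally show ?thesis
    by (simp add: lessThan_Suc_atMost[symmetric] sum.distrib)
qed

lemma rbm_model_eq: "rbm_model n k = range (norm_dist n k)"
proof -
  have psi: "rbm_psi n k W b c v h =
      exp (\<Sum>j\<in>params n k. \<theta> j * (ext k h (fst j) * ext n v (snd j)))"
    if "\<And>a i. a < k \<Longrightarrow> i < n \<Longrightarrow> \<theta> (a, i) = W a i" "\<And>i. i < n \<Longrightarrow> \<theta> (k, i) = b i"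
      "\<And>a. a < k \<Longrightarrow> \<theta> (a, n) = c a" for W b c \<theta> v h
    unfolding rbm_psi_def sum_params using that by (simp add: ext_def mult_ac)
  have dist: "rbm_dist n k W b c = norm_dist n k \<theta>"
    if "\<And>a i. a < k \<Longrightarrow> i < n \<Longrightarrow> \<theta> (a, i) = W a i" "\<And>i. i < n \<Longrightarrow> \<theta> (k, i) = b i"
      "\<And>a. a < k \<Longrightarrow> \<theta> (a, n) = c a" for W b c \<theta>
    unfolding rbm_dist_def norm_dist_def rbm_Z_def unnorm_def
    using psi[where W = W and b = b and c = c and \<theta> = \<theta>] that by (simp add: fun_eq_iff)
  show ?thesis
  proof (intro equalityI subsetI)
    fix p assume "p \<in> rbm_model n k"
    then obtain W b c where p: "p = rbm_dist n k W b c" by (auto simp: rbm_model_def)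
    have "p = norm_dist n k (\<lambda>(a, i). if a < k then if i < n then W a i else c a else b i)"
      unfolding p by (rule dist) auto
    then show "p \<in> range (norm_dist n k)" by blast
  next
    fix p assume "p \<in> range (norm_dist n k)"
    then obtain \<theta> where "p = norm_dist n k \<theta>" by blast
    then have "p = rbm_dist n k (\<lambda>a i. \<theta> (a, i)) (\<lambda>i. \<theta> (k, i)) (\<lambda>a. \<theta> (a, n))" by (simp add: dist)
    then show "p \<in> rbm_model n k" unfolding rbm_model_def by blast
  qed
qed

lemma unnorm_pos: "0 < unnorm n k \<theta> v"
  unfolding unnorm_def by (intro sum_pos) (auto simp: lessThan_empty_iff)

lemma norm_dist_sum: "(\<Sum>v<2^n. norm_dist n k \<theta> v) = 1"
proof -
  have "0 < (\<Sum>w<2^n. unnorm n k \<theta> w)" by (intro sum_pos unnorm_pos) (auto simp: lessThan_empty_iff)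
  then show ?thesis by (simp add: norm_dist_def sum_divide_distrib[symmetric])
qed

section \<open>The model as the image of a polynomial map\<close>

definition mono_exp :: "nat \<Rightarrow> nat \<Rightarrow> nat \<Rightarrow> nat \<Rightarrow> nat \<times> nat \<Rightarrow> nat" where
  "mono_exp n k v h j = (if ext k h (fst j) * ext n v (snd j) = 0 then 0 else 1)"

definition upoly :: "nat \<Rightarrow> nat \<Rightarrow> nat \<Rightarrow> (nat \<times> nat \<Rightarrow> real) \<Rightarrow> real" where
  "upoly n k v \<zeta> = (\<Sum>h<2^k. \<Prod>j\<in>params n k. \<zeta> j ^ mono_exp n k v h j)"

lemma unnorm_upoly: "unnorm n k \<theta> v = upoly n k v (\<lambda>j. exp (\<theta> j))"
proof -
  have "ext k h a * ext n v i = real (mono_exp n k v h (a, i))" for h a i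
    by (auto simp: mono_exp_def ext_def bitv_def)
  then have "exp (\<theta> j * (ext k h (fst j) * ext n v (snd j))) = exp (\<theta> j) ^ mono_exp n k v h j" for h j
    by (simp add: exp_of_nat_mult[symmetric] mult.commute)
  then show ?thesis unfolding unnorm_def upoly_def by (simp add: exp_sum)
qed

lemma upoly_pspan: "upoly n k v \<in> pspan (params n k) 1"
proof -
  have "(\<lambda>\<zeta>. 1 * (\<Prod>j\<in>params n k. \<zeta> j ^ mono_exp n k v h j)) \<in> pspan (params n k) 1" for h
    by (rule pspan_mono) (simp add: mono_exp_def)
  then show ?thesis unfolding upoly_def[abs_def] by (intro pspan_sum) auto
qed

text \<open>The model is a projection. The first 2^n coordinates hold the probabilities, the others
  the exponentials of the parameters, subject to positivity and to the polynomial equations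
  (probability of v) * (partition function) = (weight of v).\<close>

lemma rbm_model_semialgebraic: "semialgebraic (2 ^ n) (rbm_model n k)"
proof -
  let ?N = "2 ^ n :: nat" and ?J = "params n k"
  define M where "M = card ?J"
  obtain f where f: "bij_betw f ?J {..<M}"
    using ex_bij_betw_finite_nat[OF finite_params] by (auto simp: M_def lessThan_atLeast0)
  define Q where "Q v z = upoly n k v (\<lambda>j. z (?N + f j))" for v and z :: "nat \<Rightarrow> real"
  let ?K = "polyfun (?N + M)"
  have R: "func_ring ?K" by (rule polyfun_ring)
  have var: "(\<lambda>z. z (?N + f j)) \<in> ?K" if "j \<in> ?J" for j
    using f that by (intro pf_var) (auto simp: bij_betw_def)
  have sumK: "(\<lambda>z. \<Sum>a\<in>A. g a z) \<in> ?K" if "finite A" "\<And>a. a \<in> A \<Longrightarrow> g a \<in> ?K"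
    for A :: "nat set" and g
    using that
  proof (induction A)
    case empty
    show ?case using pf_const[of 0] by simp
  next
    case (insert a A)
    then show ?case using pf_add[of "g a" _ "\<lambda>z. \<Sum>a\<in>A. g a z"] by simp
  qed
  have prodK: "(\<lambda>z. \<Prod>a\<in>A. g a z) \<in> ?K" if "finite A" "\<And>a. a \<in> A \<Longrightarrow> g a \<in> ?K"
    for A :: "(nat \<times> nat) set" and g
    using that
  proof (induction A)
    case empty
    show ?case using pf_const[of 1] by simp
  next
    case (insert a A)
    then show ?case using pf_mult[of "g a" _ "\<lambda>z. \<Prod>a\<in>A. g a z"] by simp
  qed
  have QK: "Q v \<in> ?K" for v
    unfolding Q_def[abs_def] upoly_def by (intro sumK prodK func_ring_power R var) auto
  obtain js where js: "set js = ?J" using finite_list[OF finite_params] by blast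
  let ?S = "{z. (\<forall>j\<in>set js. 0 < z (?N + f j)) \<and> (\<forall>v\<in>set [0..<?N]. z v * (\<Sum>w<?N. Q w z) = Q v z)}"
  have "?S \<in> sgn_alg ?K"
  proof (intro sgn_alg_conj sgn_alg_ball R sgn_alg_less sgn_alg_eq func_ring_mult sumK QK)
    show "(\<lambda>z. z (?N + f j)) \<in> ?K" if "j \<in> set js" for j using that js var by simp
    show "(\<lambda>z. z v) \<in> ?K" if "v \<in> set [0..<?N]" for v using that by (intro pf_var) auto
  qed (use func_ring_const[OF R] in auto)
  from semialgebraic_truncate[OF sgn_alg_semialgebraic[OF this]]
  have "semialgebraic ?N {y\<in>euclid ?N. \<exists>z\<in>euclid (?N + M) \<inter> ?S. \<forall>i<?N. z i = y i}" .
  moreover have "{y\<in>euclid ?N. \<exists>z\<in>euclid (?N + M) \<inter> ?S. \<forall>i<?N. z i = y i} = range (norm_dist n k)"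
  proof (intro equalityI subsetI)
    fix y assume "y \<in> {y\<in>euclid ?N. \<exists>z\<in>euclid (?N + M) \<inter> ?S. \<forall>i<?N. z i = y i}"
    then obtain z where y: "y \<in> euclid ?N" and z: "z \<in> ?S" "\<forall>i<?N. z i = y i" by blast
    define \<theta> where "\<theta> j = ln (z (?N + f j))" for j
    have "Q v z = unnorm n k \<theta> v" for v
    proof -
      have "upoly n k v (\<lambda>j. z (?N + f j)) = upoly n k v (\<lambda>j. exp (\<theta> j))"
        unfolding upoly_def using z(1) js by (intro sum.cong prod.cong refl) (auto simp: \<theta>_def)
      then show ?thesis by (simp add: Q_def unnorm_upoly)
    qed
    then have eq: "y v * (\<Sum>w<?N. unnorm n k \<theta> w) = unnorm n k \<theta> v" if "v < ?N" for v
      using z that by auto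
    have "0 < (\<Sum>w<?N. unnorm n k \<theta> w)" by (intro sum_pos unnorm_pos) (auto simp: lessThan_empty_iff)
    then have "y = norm_dist n k \<theta>" using eq y
      by (auto simp: norm_dist_def fun_eq_iff euclid_def field_simps)
    then show "y \<in> range (norm_dist n k)" by blast
  next
    fix y assume "y \<in> range (norm_dist n k)"
    then obtain \<theta> where y: "y = norm_dist n k \<theta>" by blast
    define z where "z i = (if i < ?N then y i else if i < ?N + M then exp (\<theta> (inv_into ?J f (i - ?N))) else 0)" for i
    have zf: "z (?N + f j) = exp (\<theta> j)" if "j \<in> ?J" for j
      using f that by (auto simp: z_def bij_betw_def inv_into_f_f)
    have "Q v z = unnorm n k \<theta> v" for v
      unfolding Q_def unnorm_upoly upoly_def by (intro sum.cong prod.cong refl) (auto simp: zf)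
    moreover have "0 < (\<Sum>w<?N. unnorm n k \<theta> w)" by (intro sum_pos unnorm_pos) (auto simp: lessThan_empty_iff)
    ultimately have "z \<in> ?S" using zf js by (auto simp: z_def y norm_dist_def)
    moreover have "z \<in> euclid (?N + M)" "y \<in> euclid ?N" by (auto simp: euclid_def z_def y norm_dist_def)
    ultimately show "y \<in> {y\<in>euclid ?N. \<exists>z\<in>euclid (?N + M) \<inter> ?S. \<forall>i<?N. z i = y i}"
      by (intro CollectI conjI bexI[of _ z]) (auto simp: z_def)
  qed
  ultimately show ?thesis by (simp add: rbm_model_eq)
qed

section \<open>Upper bounds for the dimension\<close>

lemma rbm_dim_upper_simplex:
  assumes "I \<subseteq> {..<2^n}" "proj_has_interior I (rbm_model n k)"
  shows "card I \<le> 2 ^ n - 1"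
proof -
  have "I \<noteq> {..<2^n}"
  proof
    assume I: "I = {..<2^n}"
    obtain y e where e: "e > 0"
      and H: "\<And>z. (\<forall>i\<in>I. \<bar>z i - y i\<bar> < e) \<Longrightarrow> \<exists>x\<in>rbm_model n k. \<forall>i\<in>I. x i = z i"
      using assms(2) unfolding proj_has_interior_def by blast
    have sum1: "(\<Sum>i\<in>I. z i) = 1" if z: "\<forall>i\<in>I. \<bar>z i - y i\<bar> < e" for z
    proof -
      obtain \<theta> where "\<forall>i\<in>I. norm_dist n k \<theta> i = z i" using H[OF z] by (auto simp: rbm_model_eq)
      then have "(\<Sum>i\<in>I. z i) = (\<Sum>i\<in>I. norm_dist n k \<theta> i)" by simp
      then show ?thesis by (simp add: I norm_dist_sum)
    qed
    \<comment> \<open>Two points of the box, the centre and a point with all coordinates raised,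
      would both be probability vectors.\<close>
    have "(\<Sum>i\<in>I. y i + e / 2) = 1" by (rule sum1) (use e in simp)
    moreover have "(\<Sum>i\<in>I. y i) = 1" by (rule sum1) (use e in simp)
    ultimately show False using e by (simp add: sum.distrib I)
  qed
  then have "card I < card {..<2^n :: nat}" using assms(1) by (intro psubset_card_mono) auto
  then show ?thesis by simp
qed

text \<open>If the projection had more coordinates than there are parameters, counting monomials
  would give a nonzero polynomial relation between these coordinates, valid on an open box.\<close>

lemma rbm_dim_upper_params:
  assumes "I \<subseteq> {..<2^n}" "proj_has_interior I (rbm_model n k)"
  shows "card I \<le> n * k + n + k"
proof (rule ccontr)
  let ?J = "params n k"
  assume "\<not> card I \<le> n * k + n + k"
  define M where "M = card ?J"
  define d where "d = card I"
  have dM: "M < d" using \<open>\<not> card I \<le> n * k + n + k\<close> by (simp add: M_def d_def card_params)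
  have fI: "finite I" using assms(1) finite_subset by blast
  \<comment> \<open>Chosen so that (d (N+1))^M = N (N+1)^M < (N+1)^(M+1), which is at most (N+1)^d:
    the d coordinates have more monomials of degree at most N in each than the M parameters have of
    degree at most m in each.\<close>
  define N where "N = d ^ M"
  define m where "m = d * N"
  define Z where "Z \<zeta> = (\<Sum>w<2^n. upoly n k w \<zeta>)" for \<zeta>
  \<comment> \<open>The complementary power of Z clears the denominators uniformly:
    \<open>F \<alpha>\<close> is the monomial in the probabilities times the common factor
    Z^m.\<close>
  define F where "F \<alpha> \<zeta> = (\<Prod>i\<in>I. upoly n k i \<zeta> ^ \<alpha> i) * Z \<zeta> ^ (m - (\<Sum>i\<in>I. \<alpha> i))" for \<alpha> \<zeta>
  have le: "(\<Sum>i\<in>I. \<alpha> i) \<le> m" if "\<alpha> \<in> I \<rightarrow>\<^sub>E {..N}" for \<alpha>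
    using that sum_bounded_above[of I \<alpha> N] by (auto simp: m_def d_def PiE_def Pi_def)
  have Z1: "Z \<in> pspan ?J 1" unfolding Z_def[abs_def] by (intro pspan_sum upoly_pspan) auto
  have "F \<alpha> \<in> pspan ?J m" if \<alpha>: "\<alpha> \<in> I \<rightarrow>\<^sub>E {..N}" for \<alpha>
  proof -
    have "(\<lambda>\<zeta>. \<Prod>i\<in>I. upoly n k i \<zeta> ^ \<alpha> i) \<in> pspan ?J (\<Sum>i\<in>I. \<alpha> i * 1)"
      by (intro pspan_prod pspan_power upoly_pspan fI)
    from pspan_mult[OF this pspan_power[OF Z1, of "m - (\<Sum>i\<in>I. \<alpha> i)"]] show ?thesis
      unfolding F_def[abs_def] using le[OF \<alpha>] by simp
  qed
  then have "\<forall>\<alpha>\<in>I \<rightarrow>\<^sub>E {..N}. \<exists>C. \<forall>\<zeta>. F \<alpha> \<zeta> = (\<Sum>e\<in>?J \<rightarrow>\<^sub>E {..m}. C e * (\<Prod>j\<in>?J. \<zeta> j ^ e j))"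
    using pspan_coeffs[OF finite_params] by blast
  from bchoice[OF this] obtain C where C: "\<forall>\<alpha>\<in>I \<rightarrow>\<^sub>E {..N}. \<forall>\<zeta>.
    F \<alpha> \<zeta> = (\<Sum>e\<in>?J \<rightarrow>\<^sub>E {..m}. C \<alpha> e * (\<Prod>j\<in>?J. \<zeta> j ^ e j))" by blast
  have "card (?J \<rightarrow>\<^sub>E {..m}) < card (I \<rightarrow>\<^sub>E {..N})"
  proof -
    have "Suc m \<le> d * Suc N" using dM by (simp add: m_def)
    then have "Suc m ^ M \<le> (d * Suc N) ^ M" by (rule power_mono) simp
    also have "\<dots> = N * Suc N ^ M" unfolding power_mult_distrib N_def ..
    also have "\<dots> < Suc N * Suc N ^ M" by simp
    also have "\<dots> = Suc N ^ Suc M" by simp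
    also have "\<dots> \<le> Suc N ^ d" using dM by (intro power_increasing) auto
    finally show ?thesis by (simp add: card_funcsetE fI M_def d_def)
  qed
  then obtain c where c: "\<exists>\<alpha>\<in>I \<rightarrow>\<^sub>E {..N}. c \<alpha> \<noteq> 0"
    "\<forall>e\<in>?J \<rightarrow>\<^sub>E {..m}. (\<Sum>\<alpha>\<in>I \<rightarrow>\<^sub>E {..N}. c \<alpha> * C \<alpha> e) = 0"
    using wide_matrix_kernel[of "I \<rightarrow>\<^sub>E {..N}" "?J \<rightarrow>\<^sub>E {..m}" "\<lambda>e \<alpha>. C \<alpha> e"] fI
    by (auto simp: finite_PiE)
  have rel: "(\<Sum>\<alpha>\<in>I \<rightarrow>\<^sub>E {..N}. c \<alpha> * F \<alpha> \<zeta>) = 0" for \<zeta>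
  proof -
    have "(\<Sum>\<alpha>\<in>I \<rightarrow>\<^sub>E {..N}. c \<alpha> * F \<alpha> \<zeta>) =
      (\<Sum>\<alpha>\<in>I \<rightarrow>\<^sub>E {..N}. \<Sum>e\<in>?J \<rightarrow>\<^sub>E {..m}. c \<alpha> * C \<alpha> e * (\<Prod>j\<in>?J. \<zeta> j ^ e j))"
      using C by (intro sum.cong) (auto simp: sum_distrib_left mult_ac)
    also have "\<dots> = (\<Sum>e\<in>?J \<rightarrow>\<^sub>E {..m}. (\<Sum>\<alpha>\<in>I \<rightarrow>\<^sub>E {..N}. c \<alpha> * C \<alpha> e) * (\<Prod>j\<in>?J. \<zeta> j ^ e j))"
      by (subst sum.swap) (simp add: sum_distrib_right)
    also have "\<dots> = 0" using c(2) by simp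
    finally show ?thesis .
  qed
  obtain y e where e: "e > 0"
    and H: "\<And>z. (\<forall>i\<in>I. \<bar>z i - y i\<bar> < e) \<Longrightarrow> \<exists>x\<in>rbm_model n k. \<forall>i\<in>I. x i = z i"
    using assms(2) unfolding proj_has_interior_def by blast
  have "(\<Sum>\<alpha>\<in>I \<rightarrow>\<^sub>E {..N}. c \<alpha> * (\<Prod>i\<in>I. z i ^ \<alpha> i)) = 0"
    if z: "\<And>i. i \<in> I \<Longrightarrow> \<bar>z i - y i\<bar> < e" for z
  proof -
    obtain \<theta> where \<theta>: "\<forall>i\<in>I. norm_dist n k \<theta> i = z i" using H[of z] z by (auto simp: rbm_model_eq)
    define \<zeta> where "\<zeta> = (\<lambda>j. exp (\<theta> j))"
    have Zp: "0 < Z \<zeta>" unfolding Z_def \<zeta>_def unnorm_upoly[symmetric]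
      by (intro sum_pos unnorm_pos) (auto simp: lessThan_empty_iff)
    have zi: "upoly n k i \<zeta> = z i * Z \<zeta>" if "i \<in> I" for i
    proof -
      have "i < 2 ^ n" using that assms(1) by auto
      then have "z i = upoly n k i \<zeta> / Z \<zeta>"
        using \<theta>[rule_format, OF that] unfolding Z_def \<zeta>_def unnorm_upoly[symmetric]
        by (simp add: norm_dist_def)
      then show ?thesis using Zp by simp
    qed
    have "F \<alpha> \<zeta> = (\<Prod>i\<in>I. z i ^ \<alpha> i) * Z \<zeta> ^ m" if "\<alpha> \<in> I \<rightarrow>\<^sub>E {..N}" for \<alpha>
    proof -
      have "(\<Prod>i\<in>I. upoly n k i \<zeta> ^ \<alpha> i) = (\<Prod>i\<in>I. z i ^ \<alpha> i) * Z \<zeta> ^ (\<Sum>i\<in>I. \<alpha> i)"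
        by (simp add: zi power_mult_distrib prod.distrib power_sum)
      then show ?thesis using le[OF that] by (simp add: F_def mult.assoc power_add[symmetric])
    qed
    then have "(\<Sum>\<alpha>\<in>I \<rightarrow>\<^sub>E {..N}. c \<alpha> * (\<Prod>i\<in>I. z i ^ \<alpha> i)) * Z \<zeta> ^ m = 0"
      using rel[of \<zeta>] by (simp add: sum_distrib_right mult.assoc)
    then show ?thesis using Zp by simp
  qed
  then have "\<forall>\<alpha>\<in>I \<rightarrow>\<^sub>E {..N}. c \<alpha> = 0" using poly_zero_on_box[OF fI e] by blast
  then show False using c(1) by blast
qed

section \<open>The Jacobian and its limit\<close>

lemma bitv_bit: "bitv v i = of_bool (bit v i)"
  by (simp add: bitv_def bit_iff_odd)

text \<open>The hidden nodes are independent given the visible ones. Induction splits the states by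
  their top bit, that is, by the summand 2^k.\<close>

lemma sum_bits_prod:
  "(\<Sum>h<(2::nat)^k. \<Prod>a<k. f a (bit h a)) = (\<Prod>a<k. f a False + f a True)"
  for f :: "nat \<Rightarrow> bool \<Rightarrow> real"
proof (induction k)
  case 0
  show ?case by simp
next
  case (Suc k)
  let ?F = "\<lambda>h. \<Prod>a<k. f a (bit h a)"
  have lo: "bit h k = False" if "h < 2 ^ k" for h :: nat
    using that by (simp add: bit_iff_odd)
  have hi: "bit (h + 2 ^ k) a = (if a = k then True else bit h a)" if "h < 2 ^ k" "a \<le> k" for h a :: nat
  proof -
    have "h + 2 ^ k = xor h (2 ^ k)"
    proof (rule disjunctive_add_eq_xor)
      show "and h (2 ^ k) = 0" by (rule bit_eqI) (use lo[OF that(1)] in \<open>auto simp: bit_simps\<close>)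
    qed
    then show ?thesis using that lo by (auto simp: bit_simps)
  qed
  have "(\<Sum>h<(2::nat)^Suc k. \<Prod>a<Suc k. f a (bit h a)) =
    (\<Sum>h<(2::nat)^k. \<Prod>a<Suc k. f a (bit h a)) + (\<Sum>h<(2::nat)^k. \<Prod>a<Suc k. f a (bit (h + 2^k) a))"
  proof -
    have "{..<2 ^ Suc k} = {..<2 ^ k} \<union> (\<lambda>h. h + 2 ^ k) ` {..<2 ^ k :: nat}"
    proof (intro equalityI subsetI)
      fix h :: nat assume h: "h \<in> {..<2 ^ Suc k}"
      show "h \<in> {..<2 ^ k} \<union> (\<lambda>h. h + 2 ^ k) ` {..<2 ^ k :: nat}"
      proof (cases "h < 2 ^ k")
        case False
        then have "h = (h - 2 ^ k) + 2 ^ k" "h - 2 ^ k < 2 ^ k" using h by auto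
        then show ?thesis by blast
      qed simp
    qed auto
    then have "(\<Sum>h<(2::nat)^Suc k. g h) = (\<Sum>h<(2::nat)^k. g h) + (\<Sum>h\<in>(\<lambda>h. h + 2 ^ k) ` {..<2 ^ k}. g h)" for g :: "nat \<Rightarrow> real"
      by (simp only:) (rule sum.union_disjoint, auto)
    then show ?thesis by (simp add: sum.reindex inj_on_def)
  qed
  also have "(\<Sum>h<(2::nat)^k. \<Prod>a<Suc k. f a (bit h a)) = (\<Sum>h<(2::nat)^k. ?F h) * f k False"
    unfolding sum_distrib_right by (intro sum.cong) (simp_all add: lo)
  also have "(\<Sum>h<(2::nat)^k. \<Prod>a<Suc k. f a (bit (h + 2^k) a)) = (\<Sum>h<(2::nat)^k. ?F h) * f k True"
    unfolding sum_distrib_right by (intro sum.cong) (simp_all add: hi)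
  finally show ?case by (simp add: Suc.IH distrib_left)
qed

definition affine_val :: "nat \<Rightarrow> (nat \<times> nat \<Rightarrow> real) \<Rightarrow> nat \<Rightarrow> nat \<Rightarrow> real" where
  "affine_val n \<theta> a v = (\<Sum>i\<le>n. \<theta> (a, i) * ext n v i)"

definition log_unnorm :: "nat \<Rightarrow> nat \<Rightarrow> (nat \<times> nat \<Rightarrow> real) \<Rightarrow> nat \<Rightarrow> real" where
  "log_unnorm n k \<theta> v = (\<Sum>i<n. \<theta> (k, i) * ext n v i) + (\<Sum>a<k. ln (1 + exp (affine_val n \<theta> a v)))"

lemma unnorm_log: "unnorm n k \<theta> v = exp (log_unnorm n k \<theta> v)"
proof -
  have "(\<Sum>j\<in>params n k. \<theta> j * (ext k h (fst j) * ext n v (snd j))) =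
    (\<Sum>i<n. \<theta> (k, i) * ext n v i) + (\<Sum>a<k. of_bool (bit h a) * affine_val n \<theta> a v)" for h
    unfolding sum_params affine_val_def
    by (simp add: ext_def[of k] bitv_bit lessThan_Suc_atMost[symmetric] sum.distrib sum_distrib_left
        distrib_left mult_ac)
  note expo = this
  have "unnorm n k \<theta> v = (\<Sum>h<(2::nat)^k. exp (\<Sum>i<n. \<theta> (k, i) * ext n v i) *
      (\<Prod>a<k. (\<lambda>a c. if c then exp (affine_val n \<theta> a v) else 1) a (bit h a)))"
    unfolding unnorm_def expo
  proof (intro sum.cong refl)
    fix h
    have "exp (\<Sum>a<k. of_bool (bit h a) * affine_val n \<theta> a v) =
      (\<Prod>a<k. exp (of_bool (bit h a) * affine_val n \<theta> a v))" by (rule exp_sum) simp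
    also have "\<dots> = (\<Prod>a<k. if bit h a then exp (affine_val n \<theta> a v) else 1)"
      by (intro prod.cong) auto
    finally show "exp ((\<Sum>i<n. \<theta> (k, i) * ext n v i) + (\<Sum>a<k. of_bool (bit h a) * affine_val n \<theta> a v)) =
      exp (\<Sum>i<n. \<theta> (k, i) * ext n v i) *
      (\<Prod>a<k. (\<lambda>a c. if c then exp (affine_val n \<theta> a v) else 1) a (bit h a))"
      by (simp only: exp_add)
  qed
  also have "\<dots> = exp (\<Sum>i<n. \<theta> (k, i) * ext n v i) * (\<Prod>a<k. 1 + exp (affine_val n \<theta> a v))"
    using sum_bits_prod[where k = k and f = "\<lambda>a c. if c then exp (affine_val n \<theta> a v) else 1"]
    by (simp add: sum_distrib_left[symmetric])
  also have "\<dots> = exp (log_unnorm n k \<theta> v)"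
    unfolding log_unnorm_def exp_add exp_sum[OF finite_lessThan]
    by (intro arg_cong2[of _ _ _ _ "(*)"] prod.cong refl) (simp add: add_pos_pos)
  finally show ?thesis .
qed

definition sigmoid :: "real \<Rightarrow> real" where
  "sigmoid s = exp s / (1 + exp s)"

text \<open>The pair (k, n) has the entry 1. It belongs to no parameter and supplies the constant
  function that normalisation brings in.\<close>

definition log_grad :: "nat \<Rightarrow> nat \<Rightarrow> (nat \<times> nat \<Rightarrow> real) \<Rightarrow> nat \<Rightarrow> nat \<times> nat \<Rightarrow> real" where
  "log_grad n k \<theta> v j = (if fst j < k then sigmoid (affine_val n \<theta> (fst j) v) else 1) * ext n v (snd j)"

lemma strict_deriv_cong:
  assumes "strict_deriv J f x\<^sub>0 g" "\<And>x. f x = f' x" "\<And>j. j \<in> J \<Longrightarrow> g j = g' j"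
  shows "strict_deriv J f' x\<^sub>0 g'"
proof -
  have "f = f'" "\<And>x y. (\<Sum>j\<in>J. g j * (x j - y j)) = (\<Sum>j\<in>J. g' j * (x j - y j))"
    using assms(2,3) by (auto intro: sum.cong)
  then show ?thesis using assms(1) unfolding strict_deriv_def linear_err_def by simp
qed

lemma exp_plus1_pos: "0 < 1 + exp (s::real)"
  by (simp add: add_pos_pos)

lemma strict_deriv_log_unnorm:
  "strict_deriv (params n k) (\<lambda>\<theta>. log_unnorm n k \<theta> v) \<theta>\<^sub>0 (log_grad n k \<theta>\<^sub>0 v)"
proof -
  let ?J = "params n k"
  \<comment> \<open>Coefficients of the linear form of node a, extended by 0 to all parameters;
    \<open>w k\<close> belongs to the visible biases.\<close>
  define w where "w a j = of_bool (fst j = a) * ext n v (snd j)" for a and j :: "nat \<times> nat"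
  have aff: "(\<Sum>j\<in>?J. w a j * \<theta> j) = affine_val n \<theta> a v" if "a < k" for a \<theta>
  proof -
    have "(\<Sum>b<k. \<Sum>i<n. w a (b, i) * \<theta> (b, i)) = (\<Sum>b<k. if b = a then \<Sum>i<n. ext n v i * \<theta> (a, i) else 0)"
      by (intro sum.cong) (auto simp: w_def)
    moreover have "(\<Sum>b<k. w a (b, n) * \<theta> (b, n)) = (\<Sum>b<k. if b = a then ext n v n * \<theta> (a, n) else 0)"
      by (intro sum.cong) (auto simp: w_def)
    ultimately show ?thesis unfolding sum_params affine_val_def
      using that by (simp add: w_def lessThan_Suc_atMost[symmetric] mult.commute)
  qed
  have bia: "(\<Sum>j\<in>?J. w k j * \<theta> j) = (\<Sum>i<n. \<theta> (k, i) * ext n v i)" for \<theta>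
    unfolding sum_params by (simp add: w_def mult.commute)
  have sp: "strict_deriv ?J (\<lambda>\<theta>. ln (1 + exp (\<Sum>j\<in>?J. w a j * \<theta> j))) \<theta>\<^sub>0
      (\<lambda>j. sigmoid (\<Sum>j\<in>?J. w a j * \<theta>\<^sub>0 j) * w a j)" for a
  proof (rule strict_deriv_compose[OF strict_deriv_linear finite_params zero_less_one,
        where \<phi> = "\<lambda>s. ln (1 + exp s)" and \<phi>' = sigmoid])
    show "((\<lambda>s. ln (1 + exp s)) has_real_derivative sigmoid s) (at s)" for s
      unfolding sigmoid_def using exp_plus1_pos[of s] by (auto intro!: derivative_eq_intros)
    show "isCont sigmoid (\<Sum>j\<in>?J. w a j * \<theta>\<^sub>0 j)"
      unfolding sigmoid_def[abs_def] using exp_plus1_pos by (intro continuous_intros) (simp add: less_imp_neq[symmetric])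
  qed
  have "strict_deriv ?J (\<lambda>\<theta>. (\<Sum>j\<in>?J. w k j * \<theta> j) + (\<Sum>a<k. ln (1 + exp (\<Sum>j\<in>?J. w a j * \<theta> j)))) \<theta>\<^sub>0
      (\<lambda>j. w k j + (\<Sum>a<k. sigmoid (\<Sum>j\<in>?J. w a j * \<theta>\<^sub>0 j) * w a j))"
    by (intro strict_deriv_add strict_deriv_linear strict_deriv_sum sp finite_lessThan)
  then show ?thesis
  proof (rule strict_deriv_cong)
    show "(\<Sum>j\<in>?J. w k j * \<theta> j) + (\<Sum>a<k. ln (1 + exp (\<Sum>j\<in>?J. w a j * \<theta> j))) = log_unnorm n k \<theta> v" for \<theta>
      unfolding log_unnorm_def bia using aff by simp
    fix j assume j: "j \<in> ?J"
    have "(\<Sum>a<k. sigmoid (\<Sum>j\<in>?J. w a j * \<theta>\<^sub>0 j) * w a j) =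
      (\<Sum>a<k. if a = fst j then sigmoid (affine_val n \<theta>\<^sub>0 (fst j) v) * ext n v (snd j) else 0)"
      by (intro sum.cong) (auto simp: aff, auto simp: w_def)
    then show "w k j + (\<Sum>a<k. sigmoid (\<Sum>j\<in>?J. w a j * \<theta>\<^sub>0 j) * w a j) = log_grad n k \<theta>\<^sub>0 v j"
      using j by (auto simp: log_grad_def w_def params_def)
  qed
qed

text \<open>The logarithm of the probability is \<open>log_unnorm\<close> minus the logarithm of the
  partition function, so its gradient is the unnormalised one minus its mean. Writing the quotient
  as an exponential leaves only sums and one-variable compositions to differentiate.\<close>

lemma strict_deriv_norm_dist:
  assumes "v < 2 ^ n"
  shows "strict_deriv (params n k) (\<lambda>\<theta>. norm_dist n k \<theta> v) \<theta>\<^sub>0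
    (\<lambda>j. norm_dist n k \<theta>\<^sub>0 v * (log_grad n k \<theta>\<^sub>0 v j - (\<Sum>w<2^n. norm_dist n k \<theta>\<^sub>0 w * log_grad n k \<theta>\<^sub>0 w j)))"
proof -
  let ?J = "params n k" and ?L = "\<lambda>v \<theta>. log_unnorm n k \<theta> v" and ?g = "log_grad n k \<theta>\<^sub>0"
  let ?Z = "\<lambda>\<theta>. \<Sum>w<2^n. exp (?L w \<theta>)"
  have Zpos: "0 < ?Z \<theta>" for \<theta> by (intro sum_pos) (auto simp: lessThan_empty_iff)
  have E: "strict_deriv ?J (\<lambda>\<theta>. exp (f \<theta>)) \<theta>\<^sub>0 (\<lambda>j. exp (f \<theta>\<^sub>0) * g j)" if "strict_deriv ?J f \<theta>\<^sub>0 g" for f g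
    by (rule strict_deriv_compose[OF that finite_params zero_less_one]) (auto intro!: derivative_eq_intros)
  have "strict_deriv ?J ?Z \<theta>\<^sub>0 (\<lambda>j. \<Sum>w<2^n. exp (?L w \<theta>\<^sub>0) * ?g w j)"
    by (intro strict_deriv_sum E strict_deriv_log_unnorm finite_lessThan)
  then have "strict_deriv ?J (\<lambda>\<theta>. - ln (?Z \<theta>)) \<theta>\<^sub>0
      (\<lambda>j. - (1 / ?Z \<theta>\<^sub>0) * (\<Sum>w<2^n. exp (?L w \<theta>\<^sub>0) * ?g w j))"
  proof (rule strict_deriv_compose[OF _ finite_params Zpos[of \<theta>\<^sub>0],
        where \<phi> = "\<lambda>s. - ln s" and \<phi>' = "\<lambda>s. - (1 / s)"])
    show "((\<lambda>s. - ln s) has_real_derivative - (1 / s)) (at s)" if "\<bar>s - ?Z \<theta>\<^sub>0\<bar> < ?Z \<theta>\<^sub>0" for s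
      using that by (auto intro!: derivative_eq_intros)
    show "isCont (\<lambda>s. - (1 / s)) (?Z \<theta>\<^sub>0)"
      using Zpos[of \<theta>\<^sub>0] by (intro continuous_intros) auto
  qed
  from E[OF strict_deriv_add[OF strict_deriv_log_unnorm[of n k v] this]]
  have "strict_deriv ?J (\<lambda>\<theta>. exp (?L v \<theta> + - ln (?Z \<theta>))) \<theta>\<^sub>0
    (\<lambda>j. exp (?L v \<theta>\<^sub>0 + - ln (?Z \<theta>\<^sub>0)) * (?g v j + - (1 / ?Z \<theta>\<^sub>0) * (\<Sum>w<2^n. exp (?L w \<theta>\<^sub>0) * ?g w j)))" .
  moreover have p: "norm_dist n k \<theta> w = exp (?L w \<theta>) / ?Z \<theta>" if "w < 2 ^ n" for \<theta> w
    using that by (simp add: norm_dist_def unnorm_log)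
  moreover have "exp (?L v \<theta> + - ln (?Z \<theta>)) = exp (?L v \<theta>) / ?Z \<theta>" for \<theta>
    using Zpos[of \<theta>] by (simp add: exp_diff)
  moreover have "- (1 / ?Z \<theta>\<^sub>0) * (\<Sum>w<2^n. exp (?L w \<theta>\<^sub>0) * ?g w j) =
      - (\<Sum>w<2^n. norm_dist n k \<theta>\<^sub>0 w * ?g w j)" for j
    by (simp add: p sum_divide_distrib)
  ultimately show ?thesis using assms by (auto elim!: strict_deriv_cong)
qed

section \<open>From the Jacobian to open boxes\<close>

lemma proj_has_interiorI:
  assumes I: "I \<subseteq> {..<2^n}"
    and surj: "surj_matrix I (params n k) (\<lambda>v j. norm_dist n k \<theta> v *
      (log_grad n k \<theta> v j - (\<Sum>w<2^n. norm_dist n k \<theta> w * log_grad n k \<theta> w j)))"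
  shows "proj_has_interior I (rbm_model n k)"
proof -
  have "finite I" using I finite_subset by blast
  have "\<exists>e>0. \<forall>z. (\<forall>i\<in>I. \<bar>z i - norm_dist n k \<theta> i\<bar> < e) \<longrightarrow> (\<exists>x. \<forall>i\<in>I. norm_dist n k x i = z i)"
    by (rule strict_deriv_surj[OF \<open>finite I\<close> finite_params strict_deriv_norm_dist surj]) (use I in auto)
  then obtain e where e: "e > 0"
    "\<forall>z. (\<forall>i\<in>I. \<bar>z i - norm_dist n k \<theta> i\<bar> < e) \<longrightarrow> (\<exists>x. \<forall>i\<in>I. norm_dist n k x i = z i)" by (elim exE conjE)
  show ?thesis unfolding proj_has_interior_def rbm_model_eq
  proof (intro exI conjI allI impI)
    fix z assume "\<forall>i\<in>I. \<bar>z i - norm_dist n k \<theta> i\<bar> < e"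
    then obtain x where "\<forall>i\<in>I. norm_dist n k x i = z i" using e(2) by presburger
    then show "\<exists>x\<in>range (norm_dist n k). \<forall>i\<in>I. x i = z i" by (intro bexI[of _ "norm_dist n k x"]) auto
  qed (rule e(1))
qed

lemma norm_dist_pos: "v < 2 ^ n \<Longrightarrow> 0 < norm_dist n k \<theta> v"
  by (auto simp: norm_dist_def intro!: divide_pos_pos unnorm_pos sum_pos simp: lessThan_empty_iff)

abbreviation all_params :: "nat \<Rightarrow> nat \<Rightarrow> (nat \<times> nat) set" where
  "all_params n k \<equiv> {..k} \<times> {..n}"

lemma sum_all_params: "(\<Sum>j\<in>all_params n k. f j) = f (k, n) + (\<Sum>j\<in>params n k. f j)"
  for f :: "nat \<times> nat \<Rightarrow> real"
  by (simp add: params_def sum_diff1)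

lemma log_grad_const: "log_grad n k \<theta> v (k, n) = 1"
  by (simp add: log_grad_def ext_def)

definition full_projection :: "nat \<Rightarrow> nat \<Rightarrow> nat \<Rightarrow> bool" where
  "full_projection n k d \<longleftrightarrow> (\<exists>I\<subseteq>{..<2^n}. card I = d \<and> proj_has_interior I (rbm_model n k))"

text \<open>A relation among the centred gradients is one among the gradients and the constant 1,
  with minus the weighted mean as coefficient of 1. The positive factors
  \<open>norm_dist n k \<theta> v\<close> cancel.\<close>

lemma dim_lower_inj:
  assumes inj: "inj_matrix {..<2^n} (all_params n k) (log_grad n k \<theta>)"
  shows "full_projection n k (n * k + n + k)"
proof -
  define m where "m j = (\<Sum>w<2^n. norm_dist n k \<theta> w * log_grad n k \<theta> w j)" for j
  have "inj_matrix {..<2^n} (params n k) (\<lambda>v j. norm_dist n k \<theta> v * (log_grad n k \<theta> v j - m j))"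
    unfolding inj_matrix_def
  proof (intro allI impI)
    fix c assume c: "\<forall>v\<in>{..<2^n}. (\<Sum>j\<in>params n k. c j * (norm_dist n k \<theta> v * (log_grad n k \<theta> v j - m j))) = 0"
    define c' where "c' j = (if j = (k, n) then - (\<Sum>j\<in>params n k. c j * m j) else c j)" for j
    have "(\<Sum>j\<in>all_params n k. c' j * log_grad n k \<theta> v j) = 0" if v: "v \<in> {..<2^n}" for v
    proof -
      have "norm_dist n k \<theta> v * (\<Sum>j\<in>params n k. c j * (log_grad n k \<theta> v j - m j)) = 0"
        using c[rule_format, OF v] by (simp add: sum_distrib_left mult_ac)
      then have "(\<Sum>j\<in>params n k. c j * (log_grad n k \<theta> v j - m j)) = 0"
        using norm_dist_pos[of v n k \<theta>] v by simp
      moreover have "(\<Sum>j\<in>params n k. c' j * log_grad n k \<theta> v j) = (\<Sum>j\<in>params n k. c j * log_grad n k \<theta> v j)"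
        by (intro sum.cong) (auto simp: c'_def params_def)
      ultimately show ?thesis
        by (simp add: sum_all_params log_grad_const c'_def right_diff_distrib sum_subtractf)
    qed
    then have "\<forall>j\<in>all_params n k. c' j = 0" using inj unfolding inj_matrix_def by blast
    then show "\<forall>j\<in>params n k. c j = 0" by (auto simp: c'_def params_def split: if_splits)
  qed
  from inj_matrix_rows[OF finite_params _ this] obtain I where I: "I \<subseteq> {..<2^n}" "card I = card (params n k)"
    "surj_matrix I (params n k) (\<lambda>v j. norm_dist n k \<theta> v * (log_grad n k \<theta> v j - m j))" by blast
  then show ?thesis using proj_has_interiorI[OF I(1), of k \<theta>] by (auto simp: full_projection_def card_params m_def)
qed

lemma dim_lower_surj:
  assumes surj: "surj_matrix {..<2^n} (all_params n k) (log_grad n k \<theta>)"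
  shows "full_projection n k (2 ^ n - 1)"
proof -
  define m where "m j = (\<Sum>w<2^n. norm_dist n k \<theta> w * log_grad n k \<theta> w j)" for j
  let ?p = "norm_dist n k \<theta>"
  define I where "I = {..<2^n :: nat} - {0}"
  have split: "(\<Sum>v<2^n. f v) = f 0 + (\<Sum>v\<in>I. f v)" for f :: "nat \<Rightarrow> real"
    unfolding I_def by (subst sum.remove[of _ 0]) auto
  have "surj_matrix I (params n k) (\<lambda>v j. ?p v * (log_grad n k \<theta> v j - m j))"
    unfolding surj_matrix_def
  proof
    fix g
    \<comment> \<open>The omitted state 0 leaves one value free. It is chosen to give G mean zero,
      which forces the coefficient of the constant function to be exactly minus the mean that the
      centred gradients contain.\<close>
    define G where "G v = (if v = 0 then - (\<Sum>v\<in>I. g v) / ?p 0 else g v / ?p v)" for v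
    obtain x where x: "\<forall>v\<in>{..<2^n}. (\<Sum>j\<in>all_params n k. x j * log_grad n k \<theta> v j) = G v"
      using surj unfolding surj_matrix_def by blast
    then have G: "G v = x (k, n) + (\<Sum>j\<in>params n k. x j * log_grad n k \<theta> v j)" if "v < 2 ^ n" for v
      using that by (simp add: sum_all_params log_grad_const)
    have "(\<Sum>v<2^n. ?p v * G v) = x (k, n) + (\<Sum>j\<in>params n k. x j * m j)"
    proof -
      have "(\<Sum>v<2^n. ?p v * G v) = (\<Sum>v<2^n. ?p v * x (k, n) + (\<Sum>j\<in>params n k. x j * (?p v * log_grad n k \<theta> v j)))"
        by (intro sum.cong) (auto simp: G distrib_left sum_distrib_left mult_ac)
      also have "\<dots> = (\<Sum>v<2^n. ?p v) * x (k, n) + (\<Sum>j\<in>params n k. x j * m j)"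
        unfolding m_def sum.distrib sum_distrib_right by (subst sum.swap) (simp add: sum_distrib_left)
      finally show ?thesis by (simp add: norm_dist_sum)
    qed
    moreover have "(\<Sum>v<2^n. ?p v * G v) = 0"
    proof -
      have "(\<Sum>v\<in>I. ?p v * G v) = (\<Sum>v\<in>I. g v)"
      proof (rule sum.cong)
        fix v assume "v \<in> I"
        then have "v \<noteq> 0" "0 < ?p v" using norm_dist_pos by (auto simp: I_def)
        then show "?p v * G v = g v" by (simp add: G_def)
      qed simp
      moreover have "?p 0 \<noteq> 0" using norm_dist_pos[of 0 n k \<theta>] by simp
      ultimately show ?thesis unfolding split by (simp add: G_def)
    qed
    ultimately have x0: "x (k, n) = - (\<Sum>j\<in>params n k. x j * m j)" by simp
    have "(\<Sum>j\<in>params n k. x j * (?p v * (log_grad n k \<theta> v j - m j))) = g v" if v: "v \<in> I" for v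
    proof -
      have "v < 2 ^ n" "v \<noteq> 0" "?p v \<noteq> 0" using v norm_dist_pos[of v n k \<theta>] by (auto simp: I_def)
      have "(\<Sum>j\<in>params n k. x j * (?p v * (log_grad n k \<theta> v j - m j))) =
          ?p v * ((\<Sum>j\<in>params n k. x j * log_grad n k \<theta> v j) - (\<Sum>j\<in>params n k. x j * m j))"
        unfolding sum_subtractf[symmetric] sum_distrib_left by (intro sum.cong) (auto simp: algebra_simps)
      also have "\<dots> = ?p v * G v" using G[OF \<open>v < 2 ^ n\<close>] x0 by simp
      finally show ?thesis using \<open>v \<noteq> 0\<close> \<open>?p v \<noteq> 0\<close> by (simp add: G_def)
    qed
    then show "\<exists>x. \<forall>v\<in>I. (\<Sum>j\<in>params n k. x j * (?p v * (log_grad n k \<theta> v j - m j))) = g v" by blast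
  qed
  moreover have "I \<subseteq> {..<2^n}" "card I = 2 ^ n - 1" by (auto simp: I_def)
  ultimately show ?thesis using proj_has_interiorI[of I n k \<theta>] unfolding m_def full_projection_def by blast
qed

section \<open>Half-spaces as limits of sigmoids\<close>

definition step_matrix :: "nat \<Rightarrow> nat \<Rightarrow> (nat \<Rightarrow> nat \<Rightarrow> bool) \<Rightarrow> nat \<Rightarrow> nat \<times> nat \<Rightarrow> real" where
  "step_matrix n k s v j = (if fst j < k then of_bool (s (fst j) v) else 1) * ext n v (snd j)"

text \<open>Both inequalities are strict: at a state on the hyperplane the sigmoid would stay at 1/2
  and not tend to an indicator.\<close>

definition separates :: "nat \<Rightarrow> nat \<Rightarrow> (nat \<times> nat \<Rightarrow> real) \<Rightarrow> (nat \<Rightarrow> nat \<Rightarrow> bool) \<Rightarrow> bool" where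
  "separates n k \<theta> s \<longleftrightarrow> (\<forall>a<k. \<forall>v<2^n. if s a v then 0 < affine_val n \<theta> a v else affine_val n \<theta> a v < 0)"

lemma sigmoid_limit_pos: assumes "0 < c" shows "(\<lambda>t. sigmoid (real t * c)) \<longlonglongrightarrow> 1"
proof -
  have "(\<lambda>t. exp (- c) ^ t) \<longlonglongrightarrow> 0" using assms by (intro LIMSEQ_power_zero) simp
  from tendsto_divide[OF tendsto_const tendsto_add[OF tendsto_const this], of 1 1]
  have "(\<lambda>t. 1 / (1 + exp (- c) ^ t)) \<longlonglongrightarrow> 1" by simp
  moreover have "1 / (1 + exp (- c) ^ t) = sigmoid (real t * c)" for t
  proof -
    have "exp (- c) ^ t = 1 / exp (real t * c)" by (simp add: exp_of_nat_mult exp_minus power_inverse divide_inverse)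
    moreover have "1 / (1 + 1 / E) = E / (1 + E)" if "0 < E" for E :: real
      using that by (simp add: field_simps)
    ultimately show ?thesis unfolding sigmoid_def by simp
  qed
  ultimately show ?thesis by simp
qed

lemma sigmoid_limit_neg: assumes "c < 0" shows "(\<lambda>t. sigmoid (real t * c)) \<longlonglongrightarrow> 0"
proof -
  have "(\<lambda>t. exp c ^ t) \<longlonglongrightarrow> 0" using assms by (intro LIMSEQ_power_zero) simp
  from tendsto_divide[OF this tendsto_add[OF tendsto_const this], of 1]
  have "(\<lambda>t. exp c ^ t / (1 + exp c ^ t)) \<longlonglongrightarrow> 0" by simp
  then show ?thesis by (simp add: sigmoid_def exp_of_nat_mult)
qed

lemma log_grad_limit:
  assumes "separates n k \<theta> s" "v < 2 ^ n"
  shows "(\<lambda>t. log_grad n k (\<lambda>j. real t * \<theta> j) v j) \<longlonglongrightarrow> step_matrix n k s v j"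
proof (cases "fst j < k")
  case True
  have "affine_val n (\<lambda>j. real t * \<theta> j) a v = real t * affine_val n \<theta> a v" for t a
    by (simp add: affine_val_def sum_distrib_left mult_ac)
  moreover {
  have "(\<lambda>t. sigmoid (real t * affine_val n \<theta> (fst j) v)) \<longlonglongrightarrow> of_bool (s (fst j) v)"
    using assms True sigmoid_limit_pos sigmoid_limit_neg unfolding separates_def by (auto split: if_splits)
  then have "(\<lambda>t. sigmoid (real t * affine_val n \<theta> (fst j) v) * ext n v (snd j)) \<longlonglongrightarrow>
    of_bool (s (fst j) v) * ext n v (snd j)" by (rule tendsto_mult[OF _ tendsto_const]) }
  ultimately show ?thesis using True by (simp only: log_grad_def step_matrix_def if_True)
next
  case False
  then show ?thesis by (simp add: log_grad_def step_matrix_def)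
qed

lemma dim_lower_step_inj:
  assumes "separates n k \<theta> s" "inj_matrix {..<2^n} (all_params n k) (step_matrix n k s)"
  shows "full_projection n k (n * k + n + k)"
proof -
  have "eventually (\<lambda>t. inj_matrix {..<2^n} (all_params n k) (log_grad n k (\<lambda>j. real t * \<theta> j))) sequentially"
    by (rule inj_matrix_stable[OF _ _ assms(2)]) (use log_grad_limit[OF assms(1)] in auto)
  then obtain t where "inj_matrix {..<2^n} (all_params n k) (log_grad n k (\<lambda>j. real t * \<theta> j))"
    unfolding eventually_sequentially by blast
  then show ?thesis by (rule dim_lower_inj)
qed

lemma dim_lower_step_surj:
  assumes "separates n k \<theta> s" "surj_matrix {..<2^n} (all_params n k) (step_matrix n k s)"
  shows "full_projection n k (2 ^ n - 1)"
proof -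
  have "eventually (\<lambda>t. surj_matrix {..<2^n} (all_params n k) (log_grad n k (\<lambda>j. real t * \<theta> j))) sequentially"
    by (rule surj_matrix_stable[OF _ _ assms(2)]) (use log_grad_limit[OF assms(1)] in auto)
  then obtain t where "surj_matrix {..<2^n} (all_params n k) (log_grad n k (\<lambda>j. real t * \<theta> j))"
    unfolding eventually_sequentially by blast
  then show ?thesis by (rule dim_lower_surj)
qed

section \<open>Hamming balls and codes\<close>

lemma bit_imp_less: fixes v :: nat assumes "v < 2 ^ n" "bit v i" shows "i < n"
proof (rule ccontr)
  assume "\<not> i < n"
  then have "(2::nat) ^ n \<le> 2 ^ i" by (intro power_increasing) auto
  then have "v < 2 ^ i" using assms(1) by (rule order_less_le_trans[rotated])
  then have "v div 2 ^ i = 0" by simp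
  then show False using assms(2) by (simp add: bit_iff_odd)
qed

lemma less_if_bits: fixes v :: nat assumes "\<And>i. bit v i \<Longrightarrow> i < n" shows "v < 2 ^ n"
proof -
  have "take_bit n v = v" by (rule bit_eqI) (use assms in \<open>auto simp: bit_take_bit_iff\<close>)
  then show ?thesis by (simp add: take_bit_nat_eq_self_iff)
qed

lemma xor_less: "x < 2 ^ n \<Longrightarrow> y < 2 ^ n \<Longrightarrow> xor x y < 2 ^ n" for x y :: nat
  by (rule less_if_bits) (auto simp: bit_xor_iff dest: bit_imp_less)

lemma bit_flip: "bit (flip_bit i v) l = (bit v l \<noteq> (l = i))" for v :: nat
  by (auto simp: bit_flip_bit_iff)

lemma flip_less: fixes v :: nat assumes "v < 2 ^ n" "i < n" shows "flip_bit i v < 2 ^ n"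
  by (rule less_if_bits) (use assms in \<open>auto simp: bit_flip dest: bit_imp_less split: if_splits\<close>)

lemma flip_flip: "flip_bit i (flip_bit i v) = v" for v :: nat
  by (rule bit_eqI) (auto simp: bit_flip)

lemma ext_bit: "i < n \<Longrightarrow> ext n v i = of_bool (bit v i)" and ext_last: "ext n v n = 1"
  by (simp_all add: ext_def bitv_bit)

lemma affine_flip:
  assumes "i < n"
  shows "(\<Sum>l\<le>n. c l * ext n (flip_bit i v) l) = (\<Sum>l\<le>n. c l * ext n v l) + (if bit v i then - c i else c i)"
proof -
  have "(\<Sum>l\<le>n. c l * ext n (flip_bit i v) l) - (\<Sum>l\<le>n. c l * ext n v l) =
    (\<Sum>l\<le>n. if l = i then if bit v i then - c i else c i else 0)"
    unfolding sum_subtractf[symmetric] using assms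
    by (intro sum.cong) (auto simp: ext_def bitv_bit bit_flip)
  then show ?thesis using assms by simp
qed

definition ball :: "nat \<Rightarrow> nat \<Rightarrow> nat \<Rightarrow> bool" where
  "ball n u v \<longleftrightarrow> v = u \<or> (\<exists>i<n. v = flip_bit i u)"

text \<open>Coefficients of the affine function 3/2 - d(u, v), where d is the Hamming distance and
  index n holds the constant term. The value 3/2 separates distances 0 and 1 from the others without
  ties.\<close>

definition ball_weight :: "nat \<Rightarrow> nat \<Rightarrow> nat \<Rightarrow> real" where
  "ball_weight n u i = (if i < n then if bit u i then 1 else -1 else 3 / 2 - (\<Sum>l<n. of_bool (bit u l)))"

lemma ball_separated:
  assumes "u < 2 ^ n" "v < 2 ^ n"
  shows "if ball n u v then 0 < (\<Sum>i\<le>n. ball_weight n u i * ext n v i)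
    else (\<Sum>i\<le>n. ball_weight n u i * ext n v i) < 0"
proof -
  define D where "D = {i. i < n \<and> bit u i \<noteq> bit v i}"
  have "(\<Sum>i\<le>n. ball_weight n u i * ext n v i) =
    3 / 2 - (\<Sum>l<n. of_bool (bit u l)) + (\<Sum>i<n. (if bit u i then 1 else -1) * of_bool (bit v i))"
    by (simp add: lessThan_Suc_atMost[symmetric] ball_weight_def ext_bit ext_last)
  also have "\<dots> = 3 / 2 - (\<Sum>i<n. of_bool (bit u i) - (if bit u i then 1 else -1) * of_bool (bit v i))"
    by (simp add: sum_subtractf)
  also have "(\<Sum>i<n. of_bool (bit u i) - (if bit u i then 1 else -1) * of_bool (bit v i)) =
    (\<Sum>i<n. if i \<in> D then 1 else (0::real))"
    by (intro sum.cong) (auto simp: D_def)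
  also have "\<dots> = real (card D)" by (simp add: sum.If_cases D_def Int_def)
  finally have val: "(\<Sum>i\<le>n. ball_weight n u i * ext n v i) = 3 / 2 - real (card D)" .
  have finD: "finite D" by (simp add: D_def)
  have "ball n u v \<longleftrightarrow> card D \<le> 1"
  proof
    assume "ball n u v"
    then consider "v = u" | i where "i < n" "v = flip_bit i u" by (auto simp: ball_def)
    then show "card D \<le> 1"
    proof cases
      case 1
      then show ?thesis by (simp add: D_def)
    next
      case 2
      then have "D \<subseteq> {i}" by (auto simp: D_def bit_flip)
      then show ?thesis using card_mono[of "{i}" D] by simp
    qed
  next
    assume "card D \<le> 1"
    then consider "D = {}" | i where "D = {i}"
      using finD by (metis One_nat_def card_0_eq card_1_singletonE le_Suc_eq le_zero_eq)
    then show "ball n u v"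
    proof cases
      case 1
      have "v = u" by (rule bit_eqI) (use 1 assms in \<open>auto simp: D_def dest: bit_imp_less\<close>)
      then show ?thesis by (simp add: ball_def)
    next
      case 2
      then have i: "i < n" "bit u i \<noteq> bit v i" by (auto simp: D_def)
      have "bit v l = bit (flip_bit i u) l" for l
      proof (cases "l = i")
        case False
        then have "l \<notin> D" using 2 by simp
        then have "bit u l = bit v l" using bit_imp_less[OF assms(1)] bit_imp_less[OF assms(2)] by (auto simp: D_def)
        then show ?thesis using False by (simp add: bit_flip)
      qed (use i in \<open>auto simp: bit_flip\<close>)
      then have "v = flip_bit i u" by (intro bit_eqI)
      then show ?thesis using i by (auto simp: ball_def)
    qed
  qed
  then show ?thesis unfolding val by auto
qed

lemma separates_balls:
  assumes "\<And>a. a < k \<Longrightarrow> U a < 2 ^ n"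
  shows "separates n k (\<lambda>j. ball_weight n (U (fst j)) (snd j)) (\<lambda>a. ball n (U a))"
  unfolding separates_def affine_val_def using ball_separated[OF assms] by simp

lemma step_sum:
  "(\<Sum>j\<in>all_params n k. c j * step_matrix n k s v j) =
    (\<Sum>i\<le>n. c (k, i) * ext n v i) + (\<Sum>a<k. of_bool (s a v) * (\<Sum>i\<le>n. c (a, i) * ext n v i))"
proof -
  have "(\<Sum>j\<in>all_params n k. c j * step_matrix n k s v j) = (\<Sum>a\<le>k. \<Sum>i\<le>n. c (a, i) * step_matrix n k s v (a, i))"
    by (simp add: sum.cartesian_product)
  also have "\<dots> = (\<Sum>a<k. \<Sum>i\<le>n. c (a, i) * step_matrix n k s v (a, i)) + (\<Sum>i\<le>n. c (k, i) * step_matrix n k s v (k, i))"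
    by (simp add: lessThan_Suc_atMost[symmetric])
  also have "(\<Sum>a<k. \<Sum>i\<le>n. c (a, i) * step_matrix n k s v (a, i)) =
      (\<Sum>a<k. of_bool (s a v) * (\<Sum>i\<le>n. c (a, i) * ext n v i))"
    by (intro sum.cong) (auto simp: step_matrix_def)
  finally show ?thesis by (simp add: step_matrix_def)
qed

text \<open>Affine spanning in dual form: no nonzero affine function vanishes on S. The coefficient
  at n is the constant term.\<close>

definition affine_span :: "nat \<Rightarrow> nat set \<Rightarrow> bool" where
  "affine_span n S \<longleftrightarrow> (\<forall>c. (\<forall>v\<in>S. (\<Sum>i\<le>n. c i * ext n v i) = 0) \<longrightarrow> (\<forall>i\<le>n. c i = 0))"

lemma affine_span_if_linear:
  assumes "v \<in> S" "\<And>c i. (\<forall>v\<in>S. (\<Sum>i\<le>n. c i * ext n v i) = 0) \<Longrightarrow> i < n \<Longrightarrow> c i = 0"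
  shows "affine_span n S"
  unfolding affine_span_def
proof (intro allI impI)
  fix c i assume c: "\<forall>v\<in>S. (\<Sum>i\<le>n. c i * ext n v i) = 0" and i: "i \<le> n"
  have z: "c i = 0" if "i < n" for i using assms(2)[OF c that] .
  have "(\<Sum>i\<le>n. c i * ext n v i) = c n" by (simp add: lessThan_Suc_atMost[symmetric] z ext_last)
  then show "c i = 0" using c assms(1) z i by (cases "i = n") auto
qed

lemma affine_span_ball: "affine_span n {v. ball n u v}"
proof (rule affine_span_if_linear[of u])
  fix c i assume c: "\<forall>v\<in>{v. ball n u v}. (\<Sum>i\<le>n. c i * ext n v i) = 0" and i: "i < n"
  have "ball n u u" "ball n u (flip_bit i u)" using i by (auto simp: ball_def)
  then have "(\<Sum>i\<le>n. c i * ext n u i) = 0" "(\<Sum>l\<le>n. c l * ext n (flip_bit i u) l) = 0" using c by auto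
  then show "c i = 0" unfolding affine_flip[OF i] by (auto split: if_splits)
qed (simp add: ball_def)

lemma affine_interpolate_ball: "\<exists>c. \<forall>v. ball n u v \<longrightarrow> (\<Sum>i\<le>n. c i * ext n v i) = g v"
proof -
  \<comment> \<open>Flipping bit i changes an affine function by its i-th coefficient, with a sign
    given by that bit of u; so the values at the neighbours of u prescribe the linear part.\<close>
  define c0 where "c0 i = (g (flip_bit i u) - g u) * (if bit u i then -1 else 1)" for i
  define c where "c i = (if i < n then c0 i else g u - (\<Sum>l<n. c0 l * of_bool (bit u l)))" for i
  have u: "(\<Sum>i\<le>n. c i * ext n u i) = g u"
    by (simp add: lessThan_Suc_atMost[symmetric] c_def ext_bit ext_last)
  have "(\<Sum>l\<le>n. c l * ext n (flip_bit i u) l) = g (flip_bit i u)" if "i < n" for i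
    unfolding affine_flip[OF that] u using that by (simp add: c_def c0_def)
  then have "\<forall>v. ball n u v \<longrightarrow> (\<Sum>i\<le>n. c i * ext n v i) = g v" using u by (auto simp: ball_def)
  then show ?thesis by blast
qed

lemma ball_less: "u < 2 ^ n \<Longrightarrow> ball n u v \<Longrightarrow> v < 2 ^ n"
  by (auto simp: ball_def flip_less)

text \<open>Outside all balls a relation involves only the biases, row k, and S spans, so they
  vanish. On the ball of \<open>U a\<close> only node a is then left, and a ball spans too.\<close>

lemma dim_packing:
  assumes U: "\<And>a. a < k \<Longrightarrow> U a < 2 ^ n"
    and disj: "\<And>a b v. a < k \<Longrightarrow> b < k \<Longrightarrow> ball n (U a) v \<Longrightarrow> ball n (U b) v \<Longrightarrow> a = b"
    and S: "S \<subseteq> {..<2^n}" "\<And>v a. v \<in> S \<Longrightarrow> a < k \<Longrightarrow> \<not> ball n (U a) v" "affine_span n S"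
  shows "full_projection n k (n * k + n + k)"
proof (rule dim_lower_step_inj[OF separates_balls[OF U]])
  show "inj_matrix {..<2^n} (all_params n k) (step_matrix n k (\<lambda>a. ball n (U a)))"
    unfolding inj_matrix_def
  proof (intro allI impI)
    fix c assume c: "\<forall>v\<in>{..<2^n}. (\<Sum>j\<in>all_params n k. c j * step_matrix n k (\<lambda>a. ball n (U a)) v j) = 0"
    have "(\<Sum>i\<le>n. c (k, i) * ext n v i) = 0" if "v \<in> S" for v
    proof -
      have "(\<Sum>a<k. of_bool (ball n (U a) v) * (\<Sum>i\<le>n. c (a, i) * ext n v i)) = 0"
        using S(2)[OF that] by (intro sum.neutral) auto
      moreover have "v \<in> {..<2^n}" using S(1) that by blast
      ultimately show ?thesis using c[unfolded step_sum, rule_format, of v] by simp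
    qed
    then have k: "c (k, i) = 0" if "i \<le> n" for i
      using S(3)[unfolded affine_span_def, rule_format, of "\<lambda>i. c (k, i)"] that by blast
    have a: "c (a, i) = 0" if a: "a < k" and i: "i \<le> n" for a i
    proof -
      have "(\<Sum>i\<le>n. c (a, i) * ext n v i) = 0" if v: "ball n (U a) v" for v
      proof -
        have "(\<Sum>b<k. of_bool (ball n (U b) v) * (\<Sum>i\<le>n. c (b, i) * ext n v i)) =
          (\<Sum>b<k. if b = a then \<Sum>i\<le>n. c (a, i) * ext n v i else 0)"
        proof (rule sum.cong)
          fix b assume "b \<in> {..<k}"
          then have "ball n (U b) v \<longleftrightarrow> b = a" using disj[OF _ a _ v, of b] v by blast
          then show "of_bool (ball n (U b) v) * (\<Sum>i\<le>n. c (b, i) * ext n v i) =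
            (if b = a then \<Sum>i\<le>n. c (a, i) * ext n v i else 0)" by simp
        qed simp
        also have "\<dots> = (\<Sum>i\<le>n. c (a, i) * ext n v i)" using a by simp
        finally have "(\<Sum>b<k. of_bool (ball n (U b) v) * (\<Sum>i\<le>n. c (b, i) * ext n v i)) =
          (\<Sum>i\<le>n. c (a, i) * ext n v i)" .
        moreover have "(\<Sum>i\<le>n. c (k, i) * ext n v i) = 0" using k by simp
        moreover have "v \<in> {..<2^n}" using ball_less[OF U[OF a] v] by simp
        ultimately show ?thesis using c[unfolded step_sum, rule_format, of v] by simp
      qed
      then show ?thesis
        using affine_span_ball[of n "U a", unfolded affine_span_def, rule_format, of "\<lambda>i. c (a, i)"] i by blast
    qed
    show "\<forall>j\<in>all_params n k. c j = 0" using a k by (auto simp: le_less)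
  qed
qed

text \<open>Each state is assigned to one ball containing it. Node a interpolates the target on the
  states assigned to it and 0 on the rest of its ball; row k is set to 0.\<close>

lemma dim_covering:
  assumes U: "\<And>a. a < k \<Longrightarrow> U a < 2 ^ n" and cover: "\<And>v. v < 2 ^ n \<Longrightarrow> \<exists>a<k. ball n (U a) v"
  shows "full_projection n k (2 ^ n - 1)"
proof (rule dim_lower_step_surj[OF separates_balls[OF U]])
  obtain A where A: "\<And>v. v < 2 ^ n \<Longrightarrow> A v < k \<and> ball n (U (A v)) v" using cover by metis
  show "surj_matrix {..<2^n} (all_params n k) (step_matrix n k (\<lambda>a. ball n (U a)))"
    unfolding surj_matrix_def
  proof
    fix g
    have "\<forall>a. \<exists>c. \<forall>v. ball n (U a) v \<longrightarrow> (\<Sum>i\<le>n. c i * ext n v i) = (if A v = a then g v else 0)"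
      by (intro allI affine_interpolate_ball)
    then obtain c where c: "\<And>a v. ball n (U a) v \<Longrightarrow> (\<Sum>i\<le>n. c a i * ext n v i) = (if A v = a then g v else 0)"
      by metis
    define x where "x j = (if fst j < k then c (fst j) (snd j) else 0)" for j :: "nat \<times> nat"
    have "(\<Sum>j\<in>all_params n k. x j * step_matrix n k (\<lambda>a. ball n (U a)) v j) = g v" if v: "v \<in> {..<2^n}" for v
    proof -
      have "(\<Sum>a<k. of_bool (ball n (U a) v) * (\<Sum>i\<le>n. x (a, i) * ext n v i)) = (\<Sum>a<k. if a = A v then g v else 0)"
      proof (rule sum.cong)
        fix a assume "a \<in> {..<k}"
        then show "of_bool (ball n (U a) v) * (\<Sum>i\<le>n. x (a, i) * ext n v i) = (if a = A v then g v else 0)"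
          using c[of a v] A[of v] v by (auto simp: x_def)
      qed simp
      then show ?thesis unfolding step_sum using A[of v] v by (simp add: x_def)
    qed
    then show "\<exists>x. \<forall>v\<in>{..<2^n}. (\<Sum>j\<in>all_params n k. x j * step_matrix n k (\<lambda>a. ball n (U a)) v j) = g v"
      by blast
  qed
qed

text \<open>Parity check over the field with two elements: column i of the check matrix is
  \<open>h i\<close> in binary, and addition is \<open>xor\<close>.\<close>

primrec syndrome :: "(nat \<Rightarrow> nat) \<Rightarrow> nat \<Rightarrow> nat \<Rightarrow> nat" where
  "syndrome h 0 v = 0"
| "syndrome h (Suc n) v = xor (syndrome h n v) (if bit v n then h n else 0)"

lemma syndrome_xor: "syndrome h n (xor v w) = xor (syndrome h n v) (syndrome h n w)"
  by (induction n) (auto simp: bit_xor_iff intro!: bit_eqI)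

lemma syndrome_flip:
  "syndrome h n (flip_bit i v) = (if i < n then xor (syndrome h n v) (h i) else syndrome h n v)"
proof (induction n)
  case 0
  show ?case by simp
next
  case (Suc n)
  consider "i < n" | "i = n" | "n < i" by linarith
  then show ?case
  proof cases
    case 2
    then show ?thesis using Suc by (auto simp: bit_flip bit_xor_iff intro!: bit_eqI)
  qed (use Suc in \<open>auto simp: bit_flip bit_xor_iff intro!: bit_eqI\<close>)
qed

lemma syndrome_0: "syndrome h n 0 = 0"
  by (induction n) auto

lemma syndrome_less: "(\<And>i. i < n \<Longrightarrow> h i < 2 ^ r) \<Longrightarrow> syndrome h n v < 2 ^ r"
  by (induction n) (auto intro!: xor_less)

definition code :: "(nat \<Rightarrow> nat) \<Rightarrow> nat \<Rightarrow> nat set" where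
  "code h n = {v. v < 2 ^ n \<and> syndrome h n v = 0}"

lemma finite_code [simp]: "finite (code h n)"
  by (simp add: code_def)

text \<open>Pigeonhole over the 2^r syndromes: translation by a word of syndrome s embeds the fibre
  over s into the code.\<close>

lemma code_card_lower:
  assumes "\<And>i. i < n \<Longrightarrow> h i < 2 ^ r"
  shows "2 ^ n \<le> 2 ^ r * card (code h n)"
proof -
  have fib: "card {v. v < 2 ^ n \<and> syndrome h n v = s} \<le> card (code h n)" for s
  proof (cases "\<exists>w. w < 2 ^ n \<and> syndrome h n w = s")
    case True
    then obtain w where w: "w < 2 ^ n" "syndrome h n w = s" by blast
    show ?thesis
    proof (rule card_inj_on_le[of "\<lambda>v. xor v w"])
      show "inj_on (\<lambda>v. xor v w) {v. v < 2 ^ n \<and> syndrome h n v = s}"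
        by (rule inj_onI) (metis xor.right_neutral xor_self_eq xor.assoc)
      show "(\<lambda>v. xor v w) ` {v. v < 2 ^ n \<and> syndrome h n v = s} \<subseteq> code h n"
        using w by (auto simp: code_def xor_less syndrome_xor)
    qed simp
  next
    case False
    then have "{v. v < 2 ^ n \<and> syndrome h n v = s} = {}" by blast
    then show ?thesis by (metis card.empty zero_le)
  qed
  have "{..<2^n} = (\<Union>s<2^r. {v. v < 2 ^ n \<and> syndrome h n v = s})"
    using syndrome_less[OF assms] by auto
  then have "card {..<2^n :: nat} \<le> (\<Sum>s<2^r. card {v. v < 2 ^ n \<and> syndrome h n v = s})"
    by (metis card_UN_le finite_lessThan)
  also have "\<dots> \<le> (\<Sum>s<(2::nat)^r. card (code h n))" by (intro sum_mono fib)
  finally show ?thesis by simp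
qed

lemma ball_syndrome:
  assumes "u \<in> code h n" "ball n u v"
  shows "v = u \<and> syndrome h n v = 0 \<or> (\<exists>i<n. u = flip_bit i v \<and> syndrome h n v = h i)"
  using assms by (auto simp: ball_def code_def syndrome_flip flip_flip)

text \<open>Syndrome decoding: with distinct nonzero columns the syndrome of v determines which bit,
  if any, has to be flipped to reach the codeword.\<close>

lemma code_balls_disjoint:
  assumes "inj_on h {..<n}" "\<And>i. i < n \<Longrightarrow> h i \<noteq> 0"
    and "u \<in> code h n" "u' \<in> code h n" "ball n u v" "ball n u' v"
  shows "u = u'"
proof (cases "syndrome h n v = 0")
  case True
  then have "v = u" "v = u'"
    using ball_syndrome[OF assms(3,5)] ball_syndrome[OF assms(4,6)] assms(2) by metis+
  then show ?thesis by simp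
next
  case False
  obtain i where i: "i < n" "u = flip_bit i v" "syndrome h n v = h i"
    using ball_syndrome[OF assms(3,5)] False by auto
  obtain i' where i': "i' < n" "u' = flip_bit i' v" "syndrome h n v = h i'"
    using ball_syndrome[OF assms(4,6)] False by auto
  have "i = i'" using assms(1) i i' by (auto dest: inj_onD)
  then show ?thesis using i i' by simp
qed

lemma dim_code:
  assumes h: "inj_on h {..<n}" "\<And>i. i < n \<Longrightarrow> h i \<noteq> 0"
    and C: "C \<subseteq> code h n" "card C = k"
    and S: "S \<subseteq> {..<2^n}" "\<And>v u. v \<in> S \<Longrightarrow> u \<in> C \<Longrightarrow> \<not> ball n u v" "affine_span n S"
  shows "full_projection n k (n * k + n + k)"
proof -
  have "finite C" using finite_subset[OF C(1)] by simp
  then obtain U where U: "bij_betw U {..<k} C"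
    using ex_bij_betw_nat_finite C(2) by (metis atLeast0LessThan)
  then have mem: "U a \<in> C" if "a < k" for a using that by (auto simp: bij_betw_def)
  show ?thesis
  proof (rule dim_packing[where U = U and S = S])
    show "U a < 2 ^ n" if "a < k" for a using mem[OF that] C by (auto simp: code_def)
    show "a = b" if ab: "a < k" "b < k" and v: "ball n (U a) v" "ball n (U b) v" for a b v
    proof -
      have "U a = U b" using code_balls_disjoint[OF h _ _ v] mem[OF ab(1)] mem[OF ab(2)] C(1) by blast
      then show ?thesis using U ab by (auto simp: bij_betw_def inj_on_def)
    qed
    show "\<not> ball n (U a) v" if "v \<in> S" "a < k" for v a using S(2)[OF that(1) mem[OF that(2)]] .
  qed (use S in auto)
qed

lemma dim_small_code:
  assumes h: "inj_on h {..<n}" "\<And>i. i < n \<Longrightarrow> h i \<noteq> 0" and k: "k < card (code h n)"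
  shows "full_projection n k (n * k + n + k)"
proof -
  obtain C where C: "C \<subseteq> code h n" "card C = k" using k obtain_subset_with_card_n[of k "code h n"] by auto
  have "C \<noteq> code h n" using C k by auto
  then obtain u where u: "u \<in> code h n" "u \<notin> C" using C by blast
  show ?thesis
  proof (rule dim_code[OF h C, where S = "{v. ball n u v}"])
    show "{v. ball n u v} \<subseteq> {..<2^n}" using ball_less u by (auto simp: code_def)
    show "\<not> ball n u' v" if "v \<in> {v. ball n u v}" "u' \<in> C" for v u'
      using code_balls_disjoint[OF h u(1), of u' v] that C(1) u(2) by blast
  qed (use affine_span_ball in auto)
qed

lemma dim_covering_code:
  assumes r: "2 ^ r \<le> n + 1" and k: "2 ^ (n - r) \<le> k" and rn: "r \<le> n"
  shows "full_projection n k (2 ^ n - 1)"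
proof -
  \<comment> \<open>The Hamming code on the first 2^r - 1 coordinates, with all further coordinates
    free. Every nonzero syndrome is a column, so at most one flip leads from any state into the
    code.\<close>
  define h where "h i = (if i + 1 < 2 ^ r then i + 1 else 0)" for i :: nat
  have hr: "h i < 2 ^ r" for i by (simp add: h_def)
  \<comment> \<open>The state with syndrome s obtained from the codeword u by at most one flip.
    Injectivity in (u, s) bounds the number of codewords by 2^(n-r).\<close>
  define f where "f u s = (if s = 0 then u else flip_bit (s - 1) u)" for u s :: nat
  have fs: "syndrome h n (f u s) = s \<and> f u s < 2 ^ n" if u: "u \<in> code h n" and s: "s < 2 ^ r" for u s
  proof (cases "s = 0")
    case False
    then have "s - 1 < n" "h (s - 1) = s" using s r by (auto simp: h_def)
    then show ?thesis using u False by (simp add: f_def code_def syndrome_flip flip_less)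
  qed (use u in \<open>simp add: f_def code_def\<close>)
  have "card (code h n \<times> {..<2^r :: nat}) \<le> card {..<2^n :: nat}"
  proof (rule card_inj_on_le[of "\<lambda>(u, s). f u s"])
    show "inj_on (\<lambda>(u, s). f u s) (code h n \<times> {..<2^r})"
    proof (rule inj_onI, clarsimp)
      fix u s u' s' assume A: "u \<in> code h n" "s < 2 ^ r" "u' \<in> code h n" "s' < 2 ^ r" "f u s = f u' s'"
      then have "s = s'" using fs by metis
      then have "u = u'" using A(5) flip_flip by (metis f_def)
      then show "u = u' \<and> s = s'" using \<open>s = s'\<close> by simp
    qed
    show "(\<lambda>(u, s). f u s) ` (code h n \<times> {..<2^r}) \<subseteq> {..<2^n}" using fs by auto
  qed simp
  then have "card (code h n) * 2 ^ r \<le> 2 ^ (n - r) * 2 ^ r"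
    using rn by (simp add: card_cartesian_product power_add[symmetric])
  then have card: "card (code h n) \<le> k" using k by simp
  obtain U where U: "bij_betw U {..<card (code h n)} (code h n)"
    using ex_bij_betw_nat_finite[OF finite_code] by (metis atLeast0LessThan)
  have mem: "U a \<in> code h n" if "a < card (code h n)" for a using U that by (auto simp: bij_betw_def)
  \<comment> \<open>Surplus nodes all take the ball about 0.\<close>
  define U' where "U' a = (if a < card (code h n) then U a else 0)" for a
  show ?thesis
  proof (rule dim_covering[where U = U'])
    show "U' a < 2 ^ n" for a using mem[of a] by (auto simp: U'_def code_def)
    fix v :: nat assume v: "v < 2 ^ n"
    have "\<exists>u\<in>code h n. ball n u v"
    proof (cases "syndrome h n v = 0")
      case True
      then show ?thesis using v by (auto simp: code_def ball_def)
    next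
      case False
      define i where "i = syndrome h n v - 1"
      have "syndrome h n v < 2 ^ r" by (rule syndrome_less) (rule hr)
      then have i: "i < n" "h i = syndrome h n v" using False r by (auto simp: i_def h_def)
      then have "flip_bit i v \<in> code h n" using v by (simp add: code_def flip_less syndrome_flip)
      moreover have "ball n (flip_bit i v) v" using i(1) flip_flip by (metis ball_def)
      ultimately show ?thesis by blast
    qed
    then obtain u where u: "u \<in> code h n" "ball n u v" by blast
    then obtain a where "a < card (code h n)" "U a = u"
      using U unfolding bij_betw_def by (metis imageE lessThan_iff)
    then show "\<exists>a<k. ball n (U' a) v" using card u by (intro exI[of _ a]) (simp add: U'_def)
  qed
qed

section \<open>Cosets of shortened Hamming codes\<close>

text \<open>Orthogonality of characters on a coset of the code: a codeword that contains i but not l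
  pairs off the points of the coset, flipping coordinate i and fixing coordinate l.\<close>

lemma affine_span_coset:
  assumes w: "\<And>i l. i < n \<Longrightarrow> l < n \<Longrightarrow> i \<noteq> l \<Longrightarrow> \<exists>w\<in>code h n. bit w i \<and> \<not> bit w l"
    and n: "2 \<le> n" and v0: "v\<^sub>0 < 2 ^ n" "syndrome h n v\<^sub>0 = s"
  shows "affine_span n {v. v < 2 ^ n \<and> syndrome h n v = s}"
proof -
  define S where "S = {v. v < 2 ^ n \<and> syndrome h n v = s}"
  have finS: "finite S" by (simp add: S_def)
  \<comment> \<open>The character (-1)^(bit i of v). Translation by a codeword w that contains i
    preserves the coset and changes the sign, so the sum of \<open>\<chi> i\<close> against any
    function invariant under w vanishes.\<close>
  define \<chi> where "\<chi> i v = (1::real) - 2 * of_bool (bit v i)" for i and v :: nat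
  have shift: "(\<Sum>v\<in>S. f v) = (\<Sum>v\<in>S. f (xor v w))" if w: "w \<in> code h n" for f :: "nat \<Rightarrow> real" and w
  proof (rule sum.reindex_bij_witness[of _ "\<lambda>v. xor v w" "\<lambda>v. xor v w"])
    show "xor (xor a w) w = a" for a by (simp add: xor.assoc)
    then show "f (xor (xor a w) w) = f a" for a by simp
    show "xor a w \<in> S" if "a \<in> S" for a
      using that w by (simp add: S_def code_def xor_less syndrome_xor)
    then show "xor a w \<in> S" if "a \<in> S" for a using that .
  qed (simp add: xor.assoc)
  have chi0: "(\<Sum>v\<in>S. \<chi> i v * f v) = 0" if w: "w \<in> code h n" "bit w i" and f: "\<And>v. f (xor v w) = f v"
    for i f w
  proof -
    have "(\<Sum>v\<in>S. \<chi> i v * f v) = (\<Sum>v\<in>S. \<chi> i (xor v w) * f (xor v w))" by (rule shift[OF w(1)])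
    also have "\<dots> = - (\<Sum>v\<in>S. \<chi> i v * f v)"
      unfolding sum_negf[symmetric] using w(2) by (intro sum.cong) (auto simp: \<chi>_def bit_xor_iff f)
    finally show ?thesis by simp
  qed
  have "affine_span n S"
  proof (rule affine_span_if_linear)
    show "v\<^sub>0 \<in> S" using v0 by (simp add: S_def)
    fix c i assume c: "\<forall>v\<in>S. (\<Sum>i\<le>n. c i * ext n v i) = 0" and i: "i < n"
    obtain l where l: "l < n" "l \<noteq> i"
      using n by (intro that[of "if i = 0 then 1 else 0"]) (auto split: if_splits)
    obtain w0 where w0: "w0 \<in> code h n" "bit w0 i" using w[OF i l(1)] l(2) by auto
    have one: "(\<Sum>v\<in>S. \<chi> i v) = 0" using chi0[OF w0, of "\<lambda>_. 1"] by simp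
    have other: "(\<Sum>v\<in>S. \<chi> i v * of_bool (bit v l)) = 0" if lt: "l < n" "l \<noteq> i" for l
    proof -
      obtain w1 where "w1 \<in> code h n" "bit w1 i" "\<not> bit w1 l" using w[OF i lt(1)] lt(2) by auto
      then show ?thesis by (intro chi0[of w1]) (auto simp: bit_xor_iff)
    qed
    have self: "(\<Sum>v\<in>S. \<chi> i v * of_bool (bit v i)) = - (card S / 2)"
    proof -
      have "(\<Sum>v\<in>S. \<chi> i v * of_bool (bit v i)) = (\<Sum>v\<in>S. (\<chi> i v - 1) / 2)"
        by (intro sum.cong) (auto simp: \<chi>_def)
      also have "\<dots> = ((\<Sum>v\<in>S. \<chi> i v) - card S) / 2"
        by (simp add: sum_subtractf sum_divide_distrib[symmetric])
      finally show ?thesis using one by simp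
    qed
    have term_i: "(\<Sum>v\<in>S. \<chi> i v * ext n v l) = (if l = i then - (card S / 2) else 0)" if "l \<le> n" for l
    proof (cases "l = n")
      case True
      then show ?thesis using one i by (simp add: ext_last)
    next
      case False
      then have "l < n" using that by simp
      then show ?thesis using self other[of l] by (simp add: ext_bit)
    qed
    \<comment> \<open>Pairing the relation with \<open>\<chi> i\<close> isolates \<open>c i\<close>:
      coordinate i contributes minus half the size of the coset, all else is orthogonal.\<close>
    have "0 = (\<Sum>v\<in>S. \<chi> i v * (\<Sum>l\<le>n. c l * ext n v l))" using c by simp
    also have "\<dots> = (\<Sum>l\<le>n. c l * (\<Sum>v\<in>S. \<chi> i v * ext n v l))"
      unfolding sum_distrib_left by (subst sum.swap) (simp add: mult_ac)
    also have "\<dots> = (\<Sum>l\<le>n. if l = i then - (c i * (card S / 2)) else 0)"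
      by (intro sum.cong) (auto simp: term_i)
    also have "\<dots> = - (c i * (card S / 2))" using i by simp
    finally have "c i * card S = 0" by simp
    moreover have "card S \<noteq> 0" using v0 finS by (auto simp: S_def)
    ultimately show "c i = 0" by simp
  qed
  then show ?thesis by (simp add: S_def)
qed

text \<open>A coset whose syndrome is neither 0 nor a column has distance at least 2 from the code,
  so it avoids all balls even if every codeword is used.\<close>

lemma dim_code_coset:
  assumes h: "inj_on h {..<n}" "\<And>i. i < n \<Longrightarrow> h i \<noteq> 0" and k: "k \<le> card (code h n)"
    and s: "s \<noteq> 0" "\<And>i. i < n \<Longrightarrow> h i \<noteq> s"
    and w: "\<And>i l. i < n \<Longrightarrow> l < n \<Longrightarrow> i \<noteq> l \<Longrightarrow> \<exists>w\<in>code h n. bit w i \<and> \<not> bit w l"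
    and n: "2 \<le> n" and v0: "v\<^sub>0 < 2 ^ n" "syndrome h n v\<^sub>0 = s"
  shows "full_projection n k (n * k + n + k)"
proof -
  obtain C where C: "C \<subseteq> code h n" "card C = k" using k obtain_subset_with_card_n[of k "code h n"] by auto
  show ?thesis
  proof (rule dim_code[OF h C, where S = "{v. v < 2 ^ n \<and> syndrome h n v = s}"])
    show "\<not> ball n u v" if "v \<in> {v. v < 2 ^ n \<and> syndrome h n v = s}" "u \<in> C" for v u
    proof
      assume "ball n u v"
      moreover have "u \<in> code h n" using that C(1) by blast
      ultimately show False using ball_syndrome[of u h n v] that(1) s by fastforce
    qed
    show "affine_span n {v. v < 2 ^ n \<and> syndrome h n v = s}" by (rule affine_span_coset[OF w n v0])
  qed auto
qed

text \<open>The columns of the parity check matrix are the complements of 0, ..., n - 1 in r bits.\<close>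

definition hcol :: "nat \<Rightarrow> nat \<Rightarrow> nat" where
  "hcol r i = xor i (mask r)"

lemma mask_less: "mask r < (2::nat) ^ r"
  by (simp add: mask_eq_exp_minus_1)

lemma xor_cancel: "xor a b = xor a c \<longleftrightarrow> b = c" "xor b a = xor c a \<longleftrightarrow> b = c" for a b c :: nat
  by (metis xor.assoc xor.commute xor_self_eq xor.right_neutral)+

lemma xor_eq_0: "xor a b = 0 \<longleftrightarrow> a = b" for a b :: nat
  using xor_cancel(1)[of a b a] by auto

lemma hcol_less: "i < 2 ^ r \<Longrightarrow> hcol r i < 2 ^ r"
  unfolding hcol_def by (intro xor_less mask_less)

lemma inj_hcol: "inj_on (hcol r) A"
  by (auto simp: inj_on_def hcol_def xor_cancel)

lemma hcol_eq: assumes "i < 2 ^ r" shows "hcol r i = 2 ^ r - 1 - i"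
proof -
  have "i + xor i (mask r) = xor i (xor i (mask r))"
  proof (rule disjunctive_add_eq_xor)
    show "and i (xor i (mask r)) = 0"
      by (rule bit_eqI) (use bit_imp_less[OF assms] in \<open>auto simp: bit_simps\<close>)
  qed
  also have "\<dots> = mask r" by (simp add: xor.assoc[symmetric])
  finally show ?thesis by (simp add: hcol_def mask_eq_exp_minus_1)
qed

lemma syndrome_power: "i < n \<Longrightarrow> syndrome h n (2 ^ i) = h i"
  using syndrome_flip[of h n i 0] by (simp add: syndrome_0)

lemma code3:
  assumes "i < n" "l < n" "m < n" "distinct [i, l, m]" "xor (xor (h i) (h l)) (h m) = 0" "p \<notin> {i, l, m}"
  shows "\<exists>w\<in>code h n. bit w i \<and> \<not> bit w p"
proof
  let ?w = "flip_bit m (flip_bit l (flip_bit i (0::nat)))"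
  show "?w \<in> code h n" using assms by (simp add: code_def flip_less syndrome_flip syndrome_power)
  show "bit ?w i \<and> \<not> bit ?w p" using assms by (auto simp: bit_flip bit_exp_iff)
qed

lemma code4:
  assumes "i < n" "l < n" "m < n" "q < n" "distinct [i, l, m, q]"
    "xor (xor (xor (h i) (h l)) (h m)) (h q) = 0" "p \<notin> {i, l, m, q}"
  shows "\<exists>w\<in>code h n. bit w i \<and> \<not> bit w p"
proof
  let ?w = "flip_bit q (flip_bit m (flip_bit l (flip_bit i (0::nat))))"
  show "?w \<in> code h n" using assms by (simp add: code_def flip_less syndrome_flip syndrome_power)
  show "bit ?w i \<and> \<not> bit ?w p" using assms by (auto simp: bit_flip bit_exp_iff)
qed

text \<open>With complemented columns, four columns cancel iff their indices have \<open>xor\<close>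
  0, and three iff their indices have \<open>xor\<close> equal to the mask. The indices below
  2^(r-1), a multiple of 8 as r is at least 4, split into blocks of eight with plenty of quadruples;
  a higher index is completed to a triple by two indices below 2^(r-1).\<close>

lemma hcol_separating_words:
  assumes r: "4 \<le> r" "2 ^ (r - 1) \<le> n" "n + 1 < 2 ^ r" and i: "i < n" and p: "i \<noteq> p"
  shows "\<exists>w\<in>code (hcol r) n. bit w i \<and> \<not> bit w p"
proof (cases "i < 2 ^ (r - 1)")
  case True
  have "(2::nat) ^ 3 \<le> 2 ^ (r - 1)" using r(1) by (intro power_increasing) auto
  then have d8: "xor i d < n" if "d < 8" for d using xor_less[of i "r - 1" d] True that r(2) by simp
  have word: ?thesis if d: "d < 8" "e < 8" "xor d e < 8" "d \<noteq> 0" "e \<noteq> 0" "d \<noteq> e"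
    "xor i p \<notin> {d, e, xor d e}" for d e
  proof (rule code4[of i n "xor i d" "xor i e" "xor i (xor d e)"])
    have ne: "xor i d \<noteq> i" if "d \<noteq> 0" for d using xor_cancel(1)[of i d 0] that by simp
    have "d \<noteq> xor d e" "e \<noteq> xor d e" using d xor_cancel(1)[of d 0 e] xor_cancel(2)[of 0 e d] by auto
    then show "distinct [i, xor i d, xor i e, xor i (xor d e)]"
      using d ne[of d] ne[of e] ne[of "xor d e"] xor_eq_0[of d e] by (auto simp: xor_cancel)
    show "xor (xor (xor (hcol r i) (hcol r (xor i d))) (hcol r (xor i e))) (hcol r (xor i (xor d e))) = 0"
      by (rule bit_eqI) (auto simp: hcol_def bit_xor_iff)
    have "xor i (xor i x) = x" for x by (simp add: xor.assoc[symmetric])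
    then show "p \<notin> {i, xor i d, xor i e, xor i (xor d e)}" using p d(7) by auto
  qed (use d8 d i in auto)
  \<comment> \<open>One of the \<open>xor\<close> subgroups {0,1,2,3}, {0,2,4,6} and {0,1,4,5}
    misses the nonzero number \<open>xor i p\<close>; its translate by i is the support of the
    codeword.\<close>
  consider "xor i p \<notin> {1, 2, 3}" | "xor i p = 1" | "xor i p = 2 \<or> xor i p = 3" by blast
  then show ?thesis
  proof cases
    case 1
    then show ?thesis by (intro word[of 1 2]) auto
  next
    case 2
    then show ?thesis by (intro word[of 2 4]) auto
  next
    case 3
    then show ?thesis by (intro word[of 1 4]) auto
  qed
next
  case False
  have i2: "i < 2 ^ r" using i r(3) by simp
  define e where "e = hcol r i"
  have pow: "(2::nat) ^ r = 2 * 2 ^ (r - 1)" using r(1) by (cases r) auto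
  have e: "e < 2 ^ (r - 1)" "e \<noteq> 0" using False i r(3) pow unfolding e_def hcol_eq[OF i2] by auto
  have "(2::nat) ^ 3 \<le> 2 ^ (r - 1)" using r(1) by (intro power_increasing) auto
  then have b: "l < 2 ^ (r - 1)" "xor l e < 2 ^ (r - 1)" if "l < 8" for l
    using that xor_less[of l "r - 1" e] e by auto
  \<comment> \<open>Three candidates against two forbidden values, p and
    \<open>xor p e\<close>.\<close>
  obtain l where l: "l < 3" "l \<noteq> p" "xor l e \<noteq> p"
  proof -
    have "card {p, xor p e} < card {..<3 :: nat}" using card_insert_le_m1[of 2 "{xor p e}" p] by simp
    then have "\<not> {..<3} \<subseteq> {p, xor p e}" by (meson card_mono finite.emptyI finite.insertI not_le)
    then obtain l where "l < 3" "l \<noteq> p" "l \<noteq> xor p e" by blast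
    moreover have "xor (xor l e) e = l" by (simp add: xor.assoc)
    ultimately show ?thesis by (intro that[of l]) auto
  qed
  show ?thesis
  proof (rule code3[of i n l "xor l e"])
    show "l < n" "xor l e < n" using b[of l] l(1) r(2) by auto
    show "distinct [i, l, xor l e]"
      using b[of l] l(1) False e(2) xor_cancel(1)[of l e 0] by auto
    show "xor (xor (hcol r i) (hcol r l)) (hcol r (xor l e)) = 0"
      by (rule bit_eqI) (auto simp: hcol_def e_def bit_xor_iff)
    show "p \<notin> {i, l, xor l e}" using p l by auto
  qed (rule i)
qed

text \<open>Only four indices lie below 2^(r-1), too few for a block of eight. The columns are the
  points of the Fano plane except 1, and \<open>trip\<close> lists the four lines that avoid 1,
  started from each of their points. Two of these lines pass through each point and meet nowhere
  else, so one of them misses p.\<close>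

lemma hcol_separating_words_6:
  assumes "i < 6" "p < 6" "i \<noteq> p"
  shows "\<exists>w\<in>code (hcol 3) 6. bit w i \<and> \<not> bit w p"
proof -
  have hv: "hcol 3 0 = 7" "hcol 3 1 = 6" "hcol 3 2 = 5" "hcol 3 3 = 4" "hcol 3 4 = 3" "hcol 3 5 = 2"
    by (simp_all add: hcol_eq)
  have i: "i \<in> {0, 1, 2, 3, 4, 5}" using assms(1) by auto
  define trip where "trip i l m \<longleftrightarrow> (i, l, m) \<in> {(0,2,5), (0,3,4), (1,2,4), (1,3,5), (2,0,5), (2,1,4),
    (3,0,4), (3,1,5), (4,0,3), (4,1,2), (5,0,2), (5,1,3)}" for i l m :: nat
  have t: ?thesis if "trip i l m" "p \<notin> {l, m}" for l m
    by (rule code3[of i 6 l m]) (use that assms in \<open>auto simp: trip_def hv hv[unfolded One_nat_def] xor_eq_0\<close>)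
  have "trip i ([2,2,0,0,0,0] ! i) ([5,4,5,4,3,2] ! i)" "trip i ([3,3,1,1,1,1] ! i) ([4,5,4,5,2,3] ! i)"
    using i by (elim insertE emptyE; simp add: trip_def)+
  moreover have "p \<notin> {[2,2,0,0,0,0] ! i, [5,4,5,4,3,2] ! i} \<or> p \<notin> {[3,3,1,1,1,1] ! i, [4,5,4,5,2,3] ! i}"
    using i by (elim insertE emptyE) auto
  ultimately show ?thesis using t by blast
qed

text \<open>As n + 1 < 2^r, the columns are all at least 2, which leaves 1 as syndrome of the coset.
  The state 3 represents it, because columns 0 and 1 differ in the lowest bit only.\<close>

lemma dim_hcol_full:
  assumes r: "n + 1 < 2 ^ r" "r \<le> n" and k: "k \<le> 2 ^ (n - r)" and n: "2 \<le> n"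
    and w: "\<And>i p. i < n \<Longrightarrow> p < n \<Longrightarrow> i \<noteq> p \<Longrightarrow> \<exists>w\<in>code (hcol r) n. bit w i \<and> \<not> bit w p"
  shows "full_projection n k (n * k + n + k)"
proof (rule dim_code_coset[where h = "hcol r" and s = 1 and v\<^sub>0 = 3])
  show "inj_on (hcol r) {..<n}" by (rule inj_hcol)
  show "hcol r i \<noteq> 0" "hcol r i \<noteq> 1" if "i < n" for i using that r by (simp_all add: hcol_eq)
  have "2 ^ (n - r) * 2 ^ r \<le> card (code (hcol r) n) * 2 ^ r"
    using code_card_lower[of n "hcol r" r] hcol_less r by (simp add: power_add[symmetric] mult.commute)
  then show "k \<le> card (code (hcol r) n)" using k by simp
  have "(2::nat) ^ 2 \<le> 2 ^ n" using n by (intro power_increasing) auto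
  then show "(3::nat) < 2 ^ n" by simp
  have "flip_bit 1 (flip_bit 0 0) = (3::nat)" by (simp add: flip_bit_eq_xor)
  moreover have "syndrome (hcol r) n (flip_bit 1 (flip_bit 0 0)) = 1"
  proof -
    have "syndrome (hcol r) n (flip_bit 1 (flip_bit 0 0)) = xor (hcol r 0) (hcol r 1)"
      unfolding syndrome_flip[of _ _ 1] unfolding syndrome_flip[of _ _ 0] using n by (simp add: syndrome_0)
    also have "\<dots> = 1" by (rule bit_eqI) (auto simp: hcol_def bit_xor_iff)
    finally show ?thesis .
  qed
  ultimately show "syndrome (hcol r) n 3 = 1" by simp
qed (use w n in auto)

text \<open>Five parameters for a simplex of dimension 3, so spanning is the aim. The ball about 0
  misses only the state 3: the constant \<open>g 3\<close> settles that state, and the node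
  interpolates the difference \<open>g v - g 3\<close> on the ball.\<close>

lemma dim_2_1: "full_projection 2 1 (2 ^ 2 - 1)"
proof (rule dim_lower_step_surj[OF separates_balls[where U = "\<lambda>_. 0"]])
  show "surj_matrix {..<2^2} (all_params 2 1) (step_matrix 2 1 (\<lambda>a. ball 2 0))"
    unfolding surj_matrix_def
  proof
    fix g :: "nat \<Rightarrow> real"
    obtain c where c: "\<And>v. ball 2 0 v \<Longrightarrow> (\<Sum>i\<le>2. c i * ext 2 v i) = g v - g 3"
      using affine_interpolate_ball[of 2 0 "\<lambda>v. g v - g 3"] by blast
    define x where "x j = (if fst j = 0 then c (snd j) else if snd j = 2 then g 3 else 0)" for j :: "nat \<times> nat"
    have b: "ball 2 0 v \<longleftrightarrow> v \<noteq> 3" if "v < 4" for v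
    proof -
      have "ball 2 0 v \<longleftrightarrow> v = 0 \<or> v = flip_bit 0 0 \<or> v = flip_bit 1 0"
        unfolding ball_def less_2_cases_iff One_nat_def by blast
      then have "ball 2 0 v \<longleftrightarrow> v = 0 \<or> v = 1 \<or> v = 2" by (simp add: flip_bit_eq_xor)
      then show ?thesis using that by auto
    qed
    have "(\<Sum>j\<in>all_params 2 1. x j * step_matrix 2 1 (\<lambda>a. ball 2 0) v j) = g v" if v: "v \<in> {..<2^2}" for v
    proof -
      have "(\<Sum>i\<le>2. x (1, i) * ext 2 v i) = g 3"
      proof -
        have "(\<Sum>i\<le>2. x (1, i) * ext 2 v i) = (\<Sum>i\<le>(2::nat). if i = 2 then g 3 else 0)"
          by (intro sum.cong) (auto simp: x_def ext_last)
        then show ?thesis by simp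
      qed
      moreover have "(\<Sum>i\<le>2. x (0, i) * ext 2 v i) = g v - g 3" if "ball 2 0 v"
        using c[OF that] by (simp add: x_def)
      moreover have "v = 3" if "\<not> ball 2 0 v" using b[of v] v that by simp
      ultimately show ?thesis unfolding step_sum by (cases "ball 2 0 v") simp_all
    qed
    then show "\<exists>x. \<forall>v\<in>{..<2^2}. (\<Sum>j\<in>all_params 2 1. x j * step_matrix 2 1 (\<lambda>a. ball 2 0) v j) = g v" by blast
  qed
qed simp

section \<open>Two exceptional cases\<close>

lemma sum_atMost_numerals:
  "(\<Sum>i\<le>4. f i) = f 0 + f 1 + f 2 + f 3 + f (4::nat)"
  "(\<Sum>i\<le>5. f i) = f 0 + f 1 + f 2 + f 3 + f 4 + f (5::nat)"
  "(\<Sum>a<2. f a) = f 0 + f (1::nat)"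
  "(\<Sum>a<4. f a) = f 0 + f 1 + f 2 + f (3::nat)" for f :: "nat \<Rightarrow> real"
  by (simp_all add: eval_nat_numeral)

definition weight_table :: "real list list \<Rightarrow> nat \<times> nat \<Rightarrow> real" where
  "weight_table W j = W ! fst j ! snd j"

text \<open>For these sizes the points outside the balls of a linear code of minimum distance 3 lie in a
  hyperplane. The half-spaces below were found by a computer search.\<close>

lemma dim_4_2: "full_projection 4 2 (4 * 2 + 4 + 2)"
proof -
  \<comment> \<open>Each row lists the weights of the bits and then the constant term. The first
    half-space is a cylinder: at most one of the bits 0, 1, 2 is set, bit 3 is free.\<close>
  define \<theta> where "\<theta> = weight_table [[-1, -1, -1, 0, 3/2], [-2, -1, 1, -2, 3/2]]"
  define s where "s a v \<longleftrightarrow> v \<in> [{0, 1, 2, 4, 8, 9, 10, 12},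
    {0, 2, 4, 5, 6, 12} :: nat set] ! a" for a v
  have V: "v \<in> {0, 1, 2, 3, 4, 5, 6, 7, 8, 9, 10, 11, 12, 13, 14, 15}" if "v < 2 ^ 4" for v :: nat
    using that by simp presburger
  have "if s a v then 0 < affine_val 4 \<theta> a v else affine_val 4 \<theta> a v < 0" if "a \<in> {0, 1}" "v < 2 ^ 4" for a v
    using that(1) V[OF that(2)]
    by (elim insertE emptyE; simp add: s_def \<theta>_def weight_table_def affine_val_def sum_atMost_numerals ext_def bitv_def)
  moreover have "a \<in> {0, 1}" if "a < 2" for a :: nat using that by auto
  ultimately have sep: "separates 4 2 \<theta> s" unfolding separates_def by blast
  have "inj_matrix {..<2^4} (all_params 4 2) (step_matrix 4 2 s)"
    unfolding inj_matrix_def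
  proof (intro allI impI)
    fix c assume c: "\<forall>v\<in>{..<2^4}. (\<Sum>j\<in>all_params 4 2. c j * step_matrix 4 2 s v j) = 0"
    have L: "(\<Sum>i\<le>4. c (2, i) * ext 4 v i) + (\<Sum>a<2. of_bool (s a v) * (\<Sum>i\<le>4. c (a, i) * ext 4 v i)) = 0"
      if "v < 2 ^ 4" for v using c that unfolding step_sum by blast
    note ev = sum_atMost_numerals ext_def bitv_def s_def
    \<comment> \<open>Equation \<open>e(i)\<close> belongs to the state i - 1.\<close>
    note e = L[of 0, simplified ev, simplified] L[of 1, simplified ev, simplified]
      L[of 2, simplified ev, simplified] L[of 3, simplified ev, simplified]
      L[of 4, simplified ev, simplified] L[of 5, simplified ev, simplified]
      L[of 6, simplified ev, simplified] L[of 7, simplified ev, simplified]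
      L[of 8, simplified ev, simplified] L[of 9, simplified ev, simplified]
      L[of 10, simplified ev, simplified] L[of 11, simplified ev, simplified]
      L[of 12, simplified ev, simplified] L[of 13, simplified ev, simplified]
      L[of 14, simplified ev, simplified] L[of 15, simplified ev, simplified]
    \<comment> \<open>The states 3, 7, 11, 13, 14 lie in neither half-space, so their equations
      contain only the bias row.\<close>
    have z2: "c (2, 0) = 0" "c (2, Suc 0) = 0" "c (2, 2) = 0" "c (2, 3) = 0" "c (2, 4) = 0"
      using e(4, 8, 12, 14, 15) by linarith+
    have z0: "c (0, 0) = 0" "c (0, Suc 0) = 0" "c (0, 2) = 0" "c (0, 3) = 0" "c (0, 4) = 0"
      using e(1, 2, 3, 4, 5, 7, 8, 9, 10, 11, 12, 14, 15) by linarith+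
    have z1: "c (Suc 0, 0) = 0" "c (Suc 0, Suc 0) = 0" "c (Suc 0, 2) = 0" "c (Suc 0, 3) = 0" "c (Suc 0, 4) = 0"
      using e(1, 2, 3, 4, 5, 6, 7, 9, 10, 11, 12, 13, 14, 15) by linarith+
    have "a \<in> {0, 1, 2}" if "a \<le> 2" for a :: nat using that by auto
    moreover have "i \<in> {0, 1, 2, 3, 4}" if "i \<le> 4" for i :: nat using that by auto
    ultimately show "\<forall>j\<in>all_params 4 2. c j = 0"
      using z0 z1 z2 by (simp add: Ball_def) blast
  qed
  from dim_lower_step_inj[OF sep this] show ?thesis .
qed

lemma dim_5_4: "full_projection 5 4 (5 * 4 + 5 + 4)"
proof -
  \<comment> \<open>Three balls, about the codewords 0, 7 and 25 of the linear code {0, 7, 25, 30}.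
    The ball about 30 is replaced by the cylinder in which at most one of the bits 0, 1, 3 is
    set.\<close>
  define \<theta> where "\<theta> = weight_table [[-1, -1, -1, -1, -1, 3/2], [1, 1, 1, -1, -1, -3/2],
    [1, -1, -1, 1, 1, -3/2], [-1, -1, 0, -1, 0, 3/2]]"
  define s where "s a v \<longleftrightarrow> v \<in> [{0, 1, 2, 4, 8, 16},
    {3, 5, 6, 7, 15, 23},
    {9, 17, 24, 25, 27, 29},
    {0, 1, 2, 4, 5, 6, 8, 12, 16, 17, 18, 20, 21, 22, 24, 28} :: nat set] ! a" for a v
  have V: "v \<in> {0, 1, 2, 3, 4, 5, 6, 7, 8, 9, 10, 11, 12, 13, 14, 15,
    16, 17, 18, 19, 20, 21, 22, 23, 24, 25, 26, 27, 28, 29, 30, 31}"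
    if "v < 2 ^ 5" for v :: nat
    using that by simp presburger
  have "if s a v then 0 < affine_val 5 \<theta> a v else affine_val 5 \<theta> a v < 0" if "a \<in> {0, 1, 2, 3}" "v < 2 ^ 5" for a v
    using that(1) V[OF that(2)]
    by (elim insertE emptyE; simp add: s_def \<theta>_def weight_table_def affine_val_def sum_atMost_numerals ext_def bitv_def)
  moreover have "a \<in> {0, 1, 2, 3}" if "a < 4" for a :: nat using that by auto
  ultimately have sep: "separates 5 4 \<theta> s" unfolding separates_def by blast
  have "inj_matrix {..<2^5} (all_params 5 4) (step_matrix 5 4 s)"
    unfolding inj_matrix_def
  proof (intro allI impI)
    fix c assume c: "\<forall>v\<in>{..<2^5}. (\<Sum>j\<in>all_params 5 4. c j * step_matrix 5 4 s v j) = 0"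
    have L: "(\<Sum>i\<le>5. c (4, i) * ext 5 v i) + (\<Sum>a<4. of_bool (s a v) * (\<Sum>i\<le>5. c (a, i) * ext 5 v i)) = 0"
      if "v < 2 ^ 5" for v using c that unfolding step_sum by blast
    note ev = sum_atMost_numerals ext_def bitv_def s_def
    note e = L[of 0, simplified ev, simplified] L[of 1, simplified ev, simplified]
      L[of 2, simplified ev, simplified] L[of 3, simplified ev, simplified]
      L[of 4, simplified ev, simplified] L[of 5, simplified ev, simplified]
      L[of 6, simplified ev, simplified] L[of 7, simplified ev, simplified]
      L[of 8, simplified ev, simplified] L[of 9, simplified ev, simplified]
      L[of 10, simplified ev, simplified] L[of 11, simplified ev, simplified]
      L[of 12, simplified ev, simplified] L[of 13, simplified ev, simplified]
      L[of 14, simplified ev, simplified] L[of 15, simplified ev, simplified]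
      L[of 16, simplified ev, simplified] L[of 17, simplified ev, simplified]
      L[of 18, simplified ev, simplified] L[of 19, simplified ev, simplified]
      L[of 20, simplified ev, simplified] L[of 21, simplified ev, simplified]
      L[of 22, simplified ev, simplified] L[of 23, simplified ev, simplified]
      L[of 24, simplified ev, simplified] L[of 25, simplified ev, simplified]
      L[of 26, simplified ev, simplified] L[of 27, simplified ev, simplified]
      L[of 28, simplified ev, simplified] L[of 29, simplified ev, simplified]
      L[of 30, simplified ev, simplified] L[of 31, simplified ev, simplified]
    \<comment> \<open>The states 10, 11, 13, 14, 19, 26 lie in none of the four half-spaces.\<close>
    have z4: "c (4, 0) = 0" "c (4, Suc 0) = 0" "c (4, 2) = 0" "c (4, 3) = 0" "c (4, 4) = 0" "c (4, 5) = 0"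
      using e(11, 12, 14, 15, 20, 27) by linarith+
    \<comment> \<open>States in the cylinder alone show that rows 3 and 4 add up to zero; the ball
      about 0 lies inside the cylinder, so its equations then leave only row 0.\<close>
    have z0: "c (0, 0) = 0" "c (0, Suc 0) = 0" "c (0, 2) = 0" "c (0, 3) = 0" "c (0, 4) = 0" "c (0, 5) = 0"
      using e(1, 2, 3, 5, 9, 13, 17, 19, 21, 22, 23, 29) by linarith+
    have z1: "c (Suc 0, 0) = 0" "c (Suc 0, Suc 0) = 0" "c (Suc 0, 2) = 0" "c (Suc 0, 3) = 0" "c (Suc 0, 4) = 0" "c (Suc 0, 5) = 0"
      using e(4, 6, 7, 8, 11, 12, 13, 15, 16, 20, 22, 23, 24, 27, 29) by linarith+
    have z2: "c (2, 0) = 0" "c (2, Suc 0) = 0" "c (2, 2) = 0" "c (2, 3) = 0" "c (2, 4) = 0" "c (2, 5) = 0"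
      using e(10, 11, 12, 14, 15, 18, 19, 22, 23, 25, 26, 27, 28, 29, 30) by linarith+
    have z3: "c (3, 0) = 0" "c (3, Suc 0) = 0" "c (3, 2) = 0" "c (3, 3) = 0" "c (3, 4) = 0" "c (3, 5) = 0"
      using e(11, 12, 13, 14, 15, 19, 20, 21, 22, 23, 27, 29) by linarith+
    have "a \<in> {0, 1, 2, 3, 4}" if "a \<le> 4" for a :: nat using that by auto
    moreover have "i \<in> {0, 1, 2, 3, 4, 5}" if "i \<le> 5" for i :: nat using that by auto
    ultimately show "\<forall>j\<in>all_params 5 4. c j = 0"
      using z0 z1 z2 z3 z4 by (simp add: Ball_def) blast
  qed
  from dim_lower_step_inj[OF sep this] show ?thesis .
qed

section \<open>Choice of the code\<close>

text \<open>All that the codes use of the ceiling: r is the least number of bits that provides n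
  distinct nonzero columns.\<close>

lemma nat_ceiling_log:
  assumes "n \<ge> 1" and r: "r = nat \<lceil>log 2 (real n + 1)\<rceil>"
  shows "n + 1 \<le> 2 ^ r" "2 ^ (r - 1) \<le> n" "1 \<le> r" "r \<le> n"
proof -
  let ?x = "log 2 (real n + 1)"
  have "0 < ?x" using assms(1) by simp
  then have c: "1 \<le> \<lceil>?x\<rceil>" by linarith
  then have rr: "real r = of_int \<lceil>?x\<rceil>" by (simp add: r)
  show r1: "1 \<le> r" using c unfolding r by linarith
  have "?x \<le> real r" using rr by linarith
  then have "real n + 1 \<le> 2 powr real r" by (subst (asm) log_le_iff) auto
  then have "real (n + 1) \<le> real (2 ^ r)" by (simp add: powr_realpow)
  then show "n + 1 \<le> 2 ^ r" by (simp only: of_nat_le_iff)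
  have "real (r - 1) < ?x" using rr r1 by (simp add: of_nat_diff) linarith
  then have "2 powr real (r - 1) < real n + 1" by (subst (asm) less_log_iff) auto
  then have "real (2 ^ (r - 1)) < real (n + 1)" by (simp add: powr_realpow)
  then have "2 ^ (r - 1) < n + 1" by (simp only: of_nat_less_iff)
  then show le: "2 ^ (r - 1) \<le> n" by simp
  have "(2::nat) ^ (r - 1) < 2 ^ n" using le less_exp[of n] by linarith
  then show "r \<le> n" by simp
qed

lemma nat_floor_log:
  assumes r: "r = nat \<lfloor>log 2 (real n + 1)\<rfloor>"
  shows "2 ^ r \<le> n + 1" "r \<le> n"
proof -
  let ?x = "log 2 (real n + 1)"
  have "0 \<le> ?x" by simp
  then have "real r \<le> ?x" unfolding r by linarith
  then have "2 powr real r \<le> real n + 1" by (subst (asm) le_log_iff) auto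
  then have "real (2 ^ r) \<le> real (n + 1)" by (simp add: powr_realpow)
  then show le: "2 ^ r \<le> n + 1" by (simp only: of_nat_le_iff)
  have "n + 1 \<le> 2 ^ n" using less_exp[of n] by (simp add: Suc_le_eq)
  then have "(2::nat) ^ r \<le> 2 ^ n" using le by (rule le_trans[rotated])
  then show "r \<le> n" by simp
qed

text \<open>At equality with n + 1 = 2^r there are (n + 1) k + n = 2^n + n parameters, so the
  dimension of the simplex is the target. Below 8, the conditions n + 1 < 2^r and 2^(r-1) \<le> n
  leave only n = 2, 4, 5, 6.\<close>

lemma dim_lower_code:
  assumes "n \<ge> 1" and r: "n + 1 \<le> 2 ^ r" "2 ^ (r - 1) \<le> n" "r \<le> n" and k: "k \<le> 2 ^ (n - r)"
  shows "full_projection n k (n * k + n + k) \<or> full_projection n k (2 ^ n - 1)"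
proof (cases "k < 2 ^ (n - r)")
  case True
  have "2 ^ (n - r) * 2 ^ r \<le> card (code (hcol r) n) * 2 ^ r"
    using code_card_lower[of n "hcol r" r] hcol_less r by (simp add: power_add[symmetric] mult.commute)
  then have "k < card (code (hcol r) n)" using True by simp
  moreover have "hcol r i \<noteq> 0" if "i < n" for i using that r by (simp add: hcol_eq)
  ultimately have "full_projection n k (n * k + n + k)"
    by (intro dim_small_code[OF inj_hcol])
  then show ?thesis by blast
next
  case False
  then have keq: "k = 2 ^ (n - r)" using k by simp
  show ?thesis
  proof (cases "n + 1 = 2 ^ r")
    case True
    have "full_projection n k (2 ^ n - 1)"
      by (rule dim_covering_code[of r]) (use True keq r in auto)
    then show ?thesis by blast
  next
    case False
    then have lt: "n + 1 < 2 ^ r" using r by simp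
    have r4: "4 \<le> r" if "8 \<le> n"
    proof (rule ccontr)
      assume "\<not> 4 \<le> r"
      then have "(2::nat) ^ r \<le> 2 ^ 3" by (intro power_increasing) auto
      then show False using lt that by simp
    qed
    have rs: "r \<in> {0, 1, 2, 3}" if "n < 8"
    proof (rule ccontr)
      assume "r \<notin> {0, 1, 2, 3}"
      then have "(2::nat) ^ 3 \<le> 2 ^ (r - 1)" by (intro power_increasing) auto
      then show False using r(2) that by simp
    qed
    have "n \<in> {1, 2, 3, 4, 5, 6, 7} \<or> 8 \<le> n" using assms(1) by auto
    then consider "n = 2" "r = 2" | "n = 4" "r = 3" | "n = 5" "r = 3" | "n = 6" "r = 3" | "8 \<le> n"
      using rs lt r(2) by auto
    then show ?thesis
    proof cases
      case 1
      then show ?thesis using dim_2_1 keq by auto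
    next
      case 2
      then show ?thesis using dim_4_2 keq by auto
    next
      case 3
      then show ?thesis using dim_5_4 keq by auto
    next
      case 4
      have "full_projection n k (n * k + n + k)"
        by (rule dim_hcol_full[OF lt r(3) k]) (use 4 hcol_separating_words_6 in auto)
      then show ?thesis by blast
    next
      case 5
      have "full_projection n k (n * k + n + k)"
        by (rule dim_hcol_full[OF lt r(3) k]) (use 5 hcol_separating_words[OF r4 r(2) lt] in auto)
      then show ?thesis by blast
    qed
  qed
qed

theorem theorem1p2:
  fixes n k :: nat
  assumes "n \<ge> 1" and "k \<ge> 1"
    and "k \<le> 2 ^ (n - nat \<lceil>log 2 (real n + 1)\<rceil>)
         \<or> k \<ge> 2 ^ (n - nat \<lfloor>log 2 (real n + 1)\<rfloor>)"
  shows "semialgebraic (2 ^ n) (rbm_model n k)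
         \<and> sa_dim (2 ^ n) (rbm_model n k) = min (n * k + n + k) (2 ^ n - 1)"
proof
  show "semialgebraic (2 ^ n) (rbm_model n k)" by (rule rbm_model_semialgebraic)
  have "full_projection n k (n * k + n + k) \<or> full_projection n k (2 ^ n - 1)"
    using assms(3)
  proof
    assume "k \<le> 2 ^ (n - nat \<lceil>log 2 (real n + 1)\<rceil>)"
    then show ?thesis using nat_ceiling_log[OF assms(1) refl] by (intro dim_lower_code assms(1))
  next
    assume "k \<ge> 2 ^ (n - nat \<lfloor>log 2 (real n + 1)\<rfloor>)"
    then show ?thesis using dim_covering_code nat_floor_log[OF refl, of n] by meson
  qed
  then obtain I where I: "I \<subseteq> {..<2^n}" "card I = n * k + n + k \<or> card I = 2 ^ n - 1"
    "proj_has_interior I (rbm_model n k)" unfolding full_projection_def by blast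
  have upper: "card J \<le> min (n * k + n + k) (2 ^ n - 1)"
    if "J \<subseteq> {..<2^n}" "proj_has_interior J (rbm_model n k)" for J
    using rbm_dim_upper_params[OF that] rbm_dim_upper_simplex[OF that] by simp
  \<comment> \<open>Whichever of the two values is attained, both upper bounds hold for it, so it is
    the smaller one.\<close>
  have "card I = min (n * k + n + k) (2 ^ n - 1)" using I(2) upper[OF I(1,3)] by auto
  then show "sa_dim (2 ^ n) (rbm_model n k) = min (n * k + n + k) (2 ^ n - 1)"
    unfolding sa_dim_def using I(1,3) upper by (intro Greatest_equality) auto
qed

end
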